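(* There is an algorithm which, given conditional sampling access to a distribution $\mu$ over $\Omega=\{1,\ldots,N\}$ and a parameter $\varepsilon>0$, solves the $\varepsilon$-histogram learning task, i.e. with probability at least $2/3$ outputs a distribution $\tau$ over $\Omega$ with $D_{\mathrm H}(\mu;\tau)\le\varepsilon$, using $O\!\left(\frac{\log N\log\log N}{\varepsilon^7}\cdot\mathrm{poly}(\log\varepsilon^{-1})\right)$ conditional samples.
   Context: Conditional sampling access to $\mu$: an oracle which, given $A\subseteq\Omega$, returns an element of $A$ distributed according to $\mu$ conditioned on $A$, independently of past calls. For distributions $\mu,\tau$ over $\Omega$, with $S(\Omega)$ the set of permutations of $\Omega$, the histogram divergence is $D_{\mathrm H}(\mu;\tau)=\min\{\varepsilon\ge0:\ \min_{\pi\in S(\Omega)}\Pr_{x\sim\mu}[\mu(x)\notin[(1-\varepsilon)\tau(\pi(x)),(1+\varepsilon)\tau(\pi(x))]]\le\varepsilon\}$. *)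

theory Defs
  imports "HOL-Probability.Probability" "HOL-Combinatorics.Permutations"
    "HOL-Computational_Algebra.Polynomial"
begin

text \<open>
  A distribution over a finite set \<open>\<Omega>\<close> of naturals is a \<open>pmf\<close> whose support lies in \<open>\<Omega>\<close>.
\<close>

definition hist_mismatch :: "nat pmf \<Rightarrow> nat pmf \<Rightarrow> (nat \<Rightarrow> nat) \<Rightarrow> real \<Rightarrow> real" where
  "hist_mismatch \<mu> \<tau> \<pi> \<epsilon> =
     measure_pmf.prob \<mu>
       {x. pmf \<mu> x \<notin> {(1 - \<epsilon>) * pmf \<tau> (\<pi> x) .. (1 + \<epsilon>) * pmf \<tau> (\<pi> x)}}"

definition hist_div_set :: "nat set \<Rightarrow> nat pmf \<Rightarrow> nat pmf \<Rightarrow> real set" where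
  "hist_div_set \<Omega> \<mu> \<tau> =
     {\<epsilon>. 0 \<le> \<epsilon> \<and> Min ((\<lambda>\<pi>. hist_mismatch \<mu> \<tau> \<pi> \<epsilon>) ` {\<pi>. \<pi> permutes \<Omega>}) \<le> \<epsilon>}"

text \<open>
  The histogram divergence is a minimum over an infinite set of reals. It is written with \<open>Inf\<close>;
  the lemma \<open>hist_div_attained\<close> below shows that the minimum exists.
\<close>

definition hist_div :: "nat set \<Rightarrow> nat pmf \<Rightarrow> nat pmf \<Rightarrow> real" where
  "hist_div \<Omega> \<mu> \<tau> = Inf (hist_div_set \<Omega> \<mu> \<tau>)"

lemma hist_div_set_iff:
  assumes "finite \<Omega>"
  shows "\<epsilon> \<in> hist_div_set \<Omega> \<mu> \<tau> \<longleftrightarrow>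
           0 \<le> \<epsilon> \<and> (\<exists>\<pi>. \<pi> permutes \<Omega> \<and> hist_mismatch \<mu> \<tau> \<pi> \<epsilon> \<le> \<epsilon>)"
proof -
  have "{\<pi>. \<pi> permutes \<Omega>} \<noteq> {}"
    using permutes_id by blast
  then show ?thesis
    using finite_permutations[OF assms] by (auto simp: hist_div_set_def Min_le_iff)
qed

lemma closed_hist_div_set:
  assumes "finite \<Omega>" and "set_pmf \<mu> \<subseteq> \<Omega>"
  shows "closed (hist_div_set \<Omega> \<mu> \<tau>)"
proof -
  define G where "G \<pi> B = {\<epsilon>::real. 0 \<le> \<epsilon> \<and> measure_pmf.prob \<mu> B \<le> \<epsilon> \<and>
    (\<forall>x\<in>\<Omega> - B. (1 - \<epsilon>) * pmf \<tau> (\<pi> x) \<le> pmf \<mu> x \<and> pmf \<mu> x \<le> (1 + \<epsilon>) * pmf \<tau> (\<pi> x))}"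
    for \<pi> B
  have "hist_div_set \<Omega> \<mu> \<tau> = (\<Union>\<pi>\<in>{\<pi>. \<pi> permutes \<Omega>}. \<Union>B\<in>Pow \<Omega>. G \<pi> B)" (is "_ = ?R")
  proof (intro equalityI subsetI)
    fix \<epsilon> assume "\<epsilon> \<in> hist_div_set \<Omega> \<mu> \<tau>"
    then obtain \<pi> where e: "0 \<le> \<epsilon>" "\<pi> permutes \<Omega>" "hist_mismatch \<mu> \<tau> \<pi> \<epsilon> \<le> \<epsilon>"
      by (auto simp: hist_div_set_iff[OF assms(1)])
    define B where
      "B = \<Omega> \<inter> {x. pmf \<mu> x \<notin> {(1 - \<epsilon>) * pmf \<tau> (\<pi> x) .. (1 + \<epsilon>) * pmf \<tau> (\<pi> x)}}"
    have "measure_pmf.prob \<mu> B \<le> hist_mismatch \<mu> \<tau> \<pi> \<epsilon>"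
      unfolding hist_mismatch_def by (rule measure_pmf.finite_measure_mono) (auto simp: B_def)
    then have "\<epsilon> \<in> G \<pi> B" using e by (auto simp: G_def B_def)
    then show "\<epsilon> \<in> ?R" using e by (auto simp: B_def)
  next
    fix \<epsilon> assume "\<epsilon> \<in> ?R"
    then obtain \<pi> B where e: "\<pi> permutes \<Omega>" "\<epsilon> \<in> G \<pi> B" by auto
    have "hist_mismatch \<mu> \<tau> \<pi> \<epsilon> \<le> measure_pmf.prob \<mu> B"
      unfolding hist_mismatch_def
      by (rule measure_pmf.finite_measure_mono_AE) (use e assms(2) in \<open>auto simp: AE_measure_pmf_iff G_def\<close>)
    then show "\<epsilon> \<in> hist_div_set \<Omega> \<mu> \<tau>"
      using e by (auto simp: hist_div_set_iff[OF assms(1)] G_def)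
  qed
  moreover have "closed (G \<pi> B)" for \<pi> B
    unfolding G_def Ball_def
    by (intro closed_Collect_conj closed_Collect_all closed_Collect_imp closed_Collect_le
        continuous_intros) auto
  ultimately show ?thesis
    using assms(1) by (auto intro!: closed_UN finite_permutations)
qed

lemma hist_div_attained:
  assumes "finite \<Omega>" and "set_pmf \<mu> \<subseteq> \<Omega>"
  shows "hist_div \<Omega> \<mu> \<tau> \<in> hist_div_set \<Omega> \<mu> \<tau>"
    and "\<epsilon> \<in> hist_div_set \<Omega> \<mu> \<tau> \<Longrightarrow> hist_div \<Omega> \<mu> \<tau> \<le> \<epsilon>"
proof -
  have "1 \<in> hist_div_set \<Omega> \<mu> \<tau>"
    using permutes_id[of \<Omega>] by (auto simp: hist_div_set_iff[OF assms(1)] hist_mismatch_def intro: exI[of _ id])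
  moreover have bdd: "bdd_below (hist_div_set \<Omega> \<mu> \<tau>)"
    by (rule bdd_belowI[of _ 0]) (auto simp: hist_div_set_def)
  ultimately show "hist_div \<Omega> \<mu> \<tau> \<in> hist_div_set \<Omega> \<mu> \<tau>"
    unfolding hist_div_def by (intro closed_contains_Inf closed_hist_div_set assms) auto
  show "\<epsilon> \<in> hist_div_set \<Omega> \<mu> \<tau> \<Longrightarrow> hist_div \<Omega> \<mu> \<tau> \<le> \<epsilon>"
    unfolding hist_div_def by (rule cInf_lower[OF _ bdd])
qed

text \<open>
  Conditioning on \<open>A\<close> is meaningful only if \<open>A\<close> has positive mass. On a nonempty set of mass zero
  the oracle still returns an element of \<open>A\<close>, but nothing is promised about its distribution.
\<close>

definition cond_oracle :: "nat set \<Rightarrow> nat pmf \<Rightarrow> (nat set \<Rightarrow> nat pmf) \<Rightarrow> bool" where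
  "cond_oracle \<Omega> \<mu> orc \<longleftrightarrow>
     (\<forall>A. A \<subseteq> \<Omega> \<and> A \<noteq> {} \<longrightarrow>
        set_pmf (orc A) \<subseteq> A \<and> (set_pmf \<mu> \<inter> A \<noteq> {} \<longrightarrow> orc A = cond_pmf \<mu> A))"

text \<open>
  An adaptive randomized algorithm with oracle access is a tree: \<open>Query A f\<close> asks for a sample
  conditioned on \<open>A\<close> and continues with \<open>f x\<close> on the answer \<open>x\<close>; \<open>Toss D f\<close> draws internal
  randomness from \<open>D\<close>. In \<open>run\<close> every query draws afresh from the oracle, so the answer to a query
  is independent of past calls.
\<close>

datatype 'r cond_alg =
    Output 'r
  | Query "nat set" "nat \<Rightarrow> 'r cond_alg"
  | Toss "nat pmf" "nat \<Rightarrow> 'r cond_alg"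

primrec run :: "(nat set \<Rightarrow> nat pmf) \<Rightarrow> 'r cond_alg \<Rightarrow> 'r pmf" where
  "run orc (Output r) = return_pmf r"
| "run orc (Query A f) = bind_pmf (orc A) (\<lambda>x. run orc (f x))"
| "run orc (Toss D f) = bind_pmf D (\<lambda>i. run orc (f i))"

text \<open>
  The next two predicates look at all branches that can occur: answers to \<open>Query A\<close> lie in \<open>A\<close>.
  The first says that all queries are legal, the second that no run makes more than \<open>n\<close> queries.
\<close>

primrec queries_within :: "nat set \<Rightarrow> 'r cond_alg \<Rightarrow> bool" where
  "queries_within \<Omega> (Output r) = True"
| "queries_within \<Omega> (Query A f) = (A \<subseteq> \<Omega> \<and> A \<noteq> {} \<and> (\<forall>x\<in>A. queries_within \<Omega> (f x)))"
| "queries_within \<Omega> (Toss D f) = (\<forall>i\<in>set_pmf D. queries_within \<Omega> (f i))"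

primrec queries_at_most :: "'r cond_alg \<Rightarrow> nat \<Rightarrow> bool" where
  "queries_at_most (Output r) n = True"
| "queries_at_most (Query A f) n = (n \<ge> 1 \<and> (\<forall>x\<in>A. queries_at_most (f x) (n - 1)))"
| "queries_at_most (Toss D f) n = (\<forall>i\<in>set_pmf D. queries_at_most (f i) n)"

definition solves_histogram_learning :: "nat set \<Rightarrow> real \<Rightarrow> nat pmf cond_alg \<Rightarrow> bool" where
  "solves_histogram_learning \<Omega> \<epsilon> alg \<longleftrightarrow>
     queries_within \<Omega> alg \<and>
     (\<forall>\<mu> orc. set_pmf \<mu> \<subseteq> \<Omega> \<and> cond_oracle \<Omega> \<mu> orc \<longrightarrow>
        measure_pmf.prob (run orc alg) {\<tau>. set_pmf \<tau> \<subseteq> \<Omega> \<and> hist_div \<Omega> \<mu> \<tau> \<le> \<epsilon>} \<ge> 2 / 3)"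

end

theory Submission imports Defs begin

text \<open>
  Almost all of the information in the histogram is the distribution of the scale
  \<open>\<lfloor>- ln (\<mu> x) / e\<rfloor>\<close> for \<open>x \<sim> \<mu>\<close>, where \<open>e\<close> is of order \<open>\<epsilon>\<close>. There are \<open>O(log N / e)\<close> relevant
  scales, so \<open>O(log N / e\<^sup>3)\<close> samples \<open>x\<close> determine this distribution up to \<open>e\<close> in total variation.
  Any \<open>\<tau>\<close> that admits a nearly full coupling with the empirical scales is then also coupled with
  \<open>\<mu>\<close>; as closeness only depends on the order of the masses, a monotone rearrangement turns this
  coupling into a permutation.

  To find the scale of \<open>x\<close>, compare it with a random set \<open>A\<close> of density \<open>\<rho>\<close>. Let \<open>G\<close> be the sum of
  \<open>\<mu> y / (\<mu> x + \<mu> y)\<close> over \<open>y \<noteq> x\<close>, plus \<open>1\<close> for \<open>x\<close> itself. Sampling from \<open>A \<union> {x}\<close> until \<open>x\<close> is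
  returned, and counting an answer \<open>y\<close> when a query to \<open>{x, y}\<close> returns \<open>x\<close>, has mean \<open>\<rho> G\<close>, while
  \<open>\<mu> x G\<close> is the probability that \<open>x\<close> wins against an independent sample from \<open>\<mu>\<close>; the quotient of
  the two gives \<open>\<mu> x\<close>. A suitable \<open>\<rho>\<close> is found by bisection over the powers of \<open>1/2\<close>: the error
  probability of a probe decays geometrically with its distance from the correct scale, hence a
  union bound over the \<open>O(log log N)\<close> probes costs no further factor.
\<close>

section \<open>Couplings and histogram divergence\<close>

text \<open>The capped odds behind \<open>G\<close>, rather than the ratio of the masses of
  \<open>A\<close> and \<open>x\<close>, are what makes sampling affordable: a heavy
  \<open>y\<close> contributes at most 1 to \<open>G\<close>, so variances are controlled by means,
  whereas the plain ratio could be dominated by few heavy elements. The price is that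
  \<open>\<mu> x * G\<close> can be tiny. It is at least \<open>e / 2\<close> as soon as the
  elements no heavier than \<open>x\<close> carry mass \<open>e\<close>; the other \<open>x\<close>,
  and those of mass below \<open>e / N\<close>, carry mass at most \<open>2 * e\<close> and are
  given up. The reported scale of \<open>x\<close> is random and may be any of several neighbouring
  ones. This is harmless, because the learner only fits the joint law of elements and reported
  scales. The exponent 7 is 1 + 2 + 3 + 1: about \<open>log N / e\<close> scales,
  \<open>1 / e^2\<close> samples per scale for the empirical law, \<open>1 / e^3\<close> repetitions
  for a mass estimate (relative error \<open>e\<close> for a mean possibly as small as
  \<open>e / 2\<close>), and \<open>1 / e\<close> expected queries per repetition. The factor log
  log N stems from the bisection.\<close>

definition log_close :: "real \<Rightarrow> real \<Rightarrow> real \<Rightarrow> bool" where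
  "log_close d a b \<longleftrightarrow> 0 < a \<and> 0 < b \<and> \<bar>ln a - ln b\<bar> \<le> d"

lemma log_close_sym: "log_close d a b \<Longrightarrow> log_close d b a"
  by (auto simp: log_close_def)

lemma log_close_trans: "log_close d a b \<Longrightarrow> log_close d' b c \<Longrightarrow> log_close (d + d') a c"
  by (auto simp: log_close_def)

lemma log_close_upper:
  assumes "log_close d a b" shows "a \<le> exp d * b"
proof -
  have "ln a \<le> ln (exp d * b)" using assms by (auto simp: log_close_def ln_mult)
  then show ?thesis using assms by (simp add: log_close_def)
qed

lemma ex_pos_of_sum_pos:
  fixes f :: "'a \<Rightarrow> real"
  assumes "0 < sum f A" shows "\<exists>x\<in>A. 0 < f x"
  using assms by (meson leI not_le sum_nonpos)

lemma quotient_le_one: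
  fixes a b :: real
  assumes "0 \<le> a" "a \<le> b" shows "a / b \<le> 1"
  using assms by (cases "b = 0") (auto simp: divide_le_eq_1)

lemma ex_decreasing_enumeration:
  fixes h :: "nat \<Rightarrow> real"
  assumes "finite A"
  obtains f where "bij_betw f {..<card A} A"
    and "\<And>i j. i \<le> j \<Longrightarrow> j < card A \<Longrightarrow> h (f j) \<le> h (f i)"
proof -
  define xs where "xs = sort_key (\<lambda>x. - h x) (sorted_list_of_set A)"
  have d: "distinct xs" and s: "set xs = A" and l: "length xs = card A"
    using assms by (auto simp: xs_def)
  have "bij_betw ((!) xs) {..<card A} A"
    by (rule bij_betw_nth[OF d]) (simp_all only: l s)
  moreover have "h (xs ! j) \<le> h (xs ! i)" if "i \<le> j" "j < card A" for i j
  proof -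
    have "sorted (map (\<lambda>x. - h x) xs)" by (simp add: xs_def)
    from sorted_nth_mono[OF this that(1)] show ?thesis using that l by simp
  qed
  ultimately show thesis using that by blast
qed

text \<open>
  If intervals of lengths \<open>r i \<le> 1\<close> are laid out consecutively, the ones that contain an integer
  carry at least the \<open>r\<close>-weighted total of a decreasing weight \<open>h\<close>.
\<close>

lemma sum_crossing_ge:
  fixes r h :: "nat \<Rightarrow> real"
  defines "P \<equiv> \<lambda>i. \<Sum>j<i. r j"
  assumes r: "\<And>i. i < n \<Longrightarrow> 0 \<le> r i" "\<And>i. i < n \<Longrightarrow> r i \<le> 1"
    and h: "\<And>i. i < n \<Longrightarrow> 0 \<le> h i" "\<And>i j. i \<le> j \<Longrightarrow> j < n \<Longrightarrow> h j \<le> h i"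
  shows "(\<Sum>i<n. r i * h i) \<le> (\<Sum>i\<in>{i. i < n \<and> \<lceil>P i\<rceil> < \<lceil>P (Suc i)\<rceil>}. h i)"
proof -
  define e where "e i = of_int \<lceil>P i\<rceil> - P i" for i
  have e: "0 \<le> e i" for i by (simp add: e_def)
  \<comment> \<open>Partial summation: \<open>e i\<close> is the gap from \<open>P i\<close> up to
    the next integer; it starts at 0 and stays nonnegative, so decreasing weights make the weighted
    sum of its increments nonnegative. The bound \<open>c\<close> is kept free because the induction
    step needs the claim for \<open>h m\<close> in place of \<open>c\<close>.\<close>
  have "c * e m \<le> (\<Sum>i<m. h i * (e (Suc i) - e i))"
    if "m \<le> n" "0 \<le> c" "\<And>i. i < m \<Longrightarrow> c \<le> h i" for m c
    using that
  proof (induction m arbitrary: c)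
    case 0
    then show ?case by (simp add: e_def P_def)
  next
    case (Suc m)
    have "h m * e m \<le> (\<Sum>i<m. h i * (e (Suc i) - e i))"
      using Suc.prems h by (intro Suc.IH) auto
    moreover have "c * e (Suc m) \<le> h m * e (Suc m)"
      using Suc.prems e by (intro mult_right_mono) auto
    ultimately show ?case by (simp add: algebra_simps)
  qed
  from this[of n 0] have "0 \<le> (\<Sum>i<n. h i * (e (Suc i) - e i))" using h by simp
  also have "\<dots> \<le> (\<Sum>i<n. (if \<lceil>P i\<rceil> < \<lceil>P (Suc i)\<rceil> then h i else 0) - r i * h i)"
  proof (rule sum_mono)
    fix i assume "i \<in> {..<n}"
    then have i: "i < n" by simp
    have PS: "P (Suc i) = P i + r i" by (simp add: P_def)
    have "\<lceil>P (Suc i)\<rceil> \<le> \<lceil>P i + 1\<rceil>" unfolding PS using r(2)[OF i] by (intro ceiling_mono) simp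
    then have "\<lceil>P (Suc i)\<rceil> \<le> \<lceil>P i\<rceil> + 1" by simp
    then have "real_of_int \<lceil>P (Suc i)\<rceil> - real_of_int \<lceil>P i\<rceil> \<le> (if \<lceil>P i\<rceil> < \<lceil>P (Suc i)\<rceil> then 1 else 0)"
      by auto
    then have "h i * (real_of_int \<lceil>P (Suc i)\<rceil> - real_of_int \<lceil>P i\<rceil>)
        \<le> h i * (if \<lceil>P i\<rceil> < \<lceil>P (Suc i)\<rceil> then 1 else 0)"
      using h(1)[OF i] by (rule mult_left_mono)
    then show "h i * (e (Suc i) - e i) \<le> (if \<lceil>P i\<rceil> < \<lceil>P (Suc i)\<rceil> then h i else 0) - r i * h i"
      by (auto simp: e_def PS algebra_simps)
  qed
  also have "\<dots> = (\<Sum>i\<in>{i. i < n \<and> \<lceil>P i\<rceil> < \<lceil>P (Suc i)\<rceil>}. h i) - (\<Sum>i<n. r i * h i)"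
    by (simp add: sum_subtractf sum.inter_restrict[symmetric] sum.If_cases Int_def lessThan_def)
  finally show ?thesis by simp
qed

text \<open>
  Monotone rearrangement keeps the coupled values close, and rounding it at the integers turns a
  fractional matching into a matching.
\<close>

lemma fractional_matching_rounding_sorted:
  fixes W :: "nat \<Rightarrow> nat \<Rightarrow> real" and h k :: "nat \<Rightarrow> real"
  assumes W: "\<And>i j. 0 \<le> W i j"
    and row: "\<And>i. i < n \<Longrightarrow> (\<Sum>j<n. W i j) \<le> 1"
    and col: "\<And>j. j < n \<Longrightarrow> (\<Sum>i<n. W i j) \<le> 1"
    and cl: "\<And>i j. i < n \<Longrightarrow> j < n \<Longrightarrow> 0 < W i j \<Longrightarrow> log_close D (h i) (k j)"
    and h: "\<And>i. i < n \<Longrightarrow> 0 \<le> h i" "\<And>i j. i \<le> j \<Longrightarrow> j < n \<Longrightarrow> h j \<le> h i"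
    and k: "\<And>i j. i \<le> j \<Longrightarrow> j < n \<Longrightarrow> k j \<le> k i"
  obtains X m where "X \<subseteq> {..<n}" "inj_on m X" "m ` X \<subseteq> {..<n}"
    "\<And>i. i \<in> X \<Longrightarrow> log_close D (h i) (k (m i))"
    "(\<Sum>i<n. \<Sum>j<n. W i j * h i) \<le> (\<Sum>i\<in>X. h i)"
proof -
  define r where "r i = (\<Sum>j<n. W i j)" for i
  define c where "c j = (\<Sum>i<n. W i j)" for j
  define P where "P i = (\<Sum>i'<i. r i')" for i
  define Q where "Q j = (\<Sum>j'<j. c j')" for j
  \<comment> \<open>Rows and columns are laid out as consecutive half-open intervals on the same
    segment, starting at \<open>P i\<close> and \<open>Q j\<close>. A row belongs to
    \<open>X\<close> if its interval contains an integer, which is then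
    \<open>\<lceil>P i\<rceil>\<close>, and \<open>m\<close> sends it to the column whose interval
    contains this integer. Column intervals have length at most 1, so they hold at most one integer
    each and \<open>m\<close> is injective.\<close>
  define X where "X = {i. i < n \<and> \<lceil>P i\<rceil> < \<lceil>P (Suc i)\<rceil>}"
  define m where "m i = (LEAST j. of_int \<lceil>P i\<rceil> < Q (Suc j))" for i
  have r0: "0 \<le> r i" for i by (simp add: r_def W sum_nonneg)
  have c0: "0 \<le> c i" for i by (simp add: c_def W sum_nonneg)
  have PQ: "P n = Q n" unfolding P_def Q_def r_def c_def by (rule sum.swap)
  have Pmono: "P i \<le> P j" if "i \<le> j" for i j
    unfolding P_def using that r0 by (intro sum_mono2) auto
  have X: "i < n" "P i \<le> of_int \<lceil>P i\<rceil>" "of_int \<lceil>P i\<rceil> < P (Suc i)" if "i \<in> X" for i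
    using that by (auto simp: X_def less_ceiling_iff)
  have m: "m i < n" "Q (m i) \<le> of_int \<lceil>P i\<rceil>" "of_int \<lceil>P i\<rceil> < Q (Suc (m i))" if "i \<in> X" for i
  proof -
    have "P (Suc i) \<le> Q n" using X[OF that] PQ Pmono[of "Suc i" n] by simp
    then have "of_int \<lceil>P i\<rceil> < Q (Suc (n - 1))" using X[OF that] by simp
    from LeastI[of "\<lambda>j. of_int \<lceil>P i\<rceil> < Q (Suc j)", OF this]
      Least_le[of "\<lambda>j. of_int \<lceil>P i\<rceil> < Q (Suc j)", OF this]
    show "of_int \<lceil>P i\<rceil> < Q (Suc (m i))" "m i < n" using X[OF that] by (auto simp: m_def)
    show "Q (m i) \<le> of_int \<lceil>P i\<rceil>"
    proof (cases "m i")
      case 0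
      have "0 \<le> P i" using r0 by (simp add: P_def sum_nonneg)
      then show ?thesis using 0 by (simp add: Q_def)
    next
      case (Suc j)
      then have "j < m i" by simp
      from not_less_Least[OF this[unfolded m_def]] show ?thesis using Suc by (simp add: m_def)
    qed
  qed
  have ineq: "i' < j'" if "i \<in> X" "j \<in> X" "i < j" "i' = \<lceil>P i\<rceil>" "j' = \<lceil>P j\<rceil>" for i j i' j'
    using X[OF that(1)] X[OF that(2)] Pmono[of "Suc i" j] that by linarith
  have "inj_on m X"
  proof (rule linorder_inj_onI')
    fix i j assume ij: "i \<in> X" "j \<in> X" "i < j"
    have "\<lceil>P i\<rceil> < \<lceil>P j\<rceil>" using ineq[OF ij] by simp
    then have 1: "real_of_int \<lceil>P i\<rceil> + 1 \<le> real_of_int \<lceil>P j\<rceil>" by linarith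
    have 2: "Q (Suc (m i)) \<le> Q (m i) + 1"
      using col[of "m i"] m[OF ij(1)] by (simp add: Q_def c_def)
    show "m i \<noteq> m j"
    proof
      assume "m i = m j"
      then show False using m[OF ij(1)] m[OF ij(2)] 1 2 by simp
    qed
  qed
  moreover have "log_close D (h i) (k (m i))" if i: "i \<in> X" for i
  proof -
    define j where "j = m i"
    have "P (Suc i) = P i + r i" by (simp add: P_def)
    then have "0 < r i" using X[OF i] by linarith
    then obtain j1 where "j1 < n" "W i j1 > 0"
      unfolding r_def using ex_pos_of_sum_pos by blast
    then have hi: "h i > 0" using cl[of i j1] X[OF i] by (simp add: log_close_def)
    have "Q (Suc j) = Q j + c j" by (simp add: Q_def)
    then have "0 < c j" using m[OF i] unfolding j_def by linarith
    then obtain i1 where "i1 < n" "W i1 j > 0"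
      unfolding c_def using ex_pos_of_sum_pos by blast
    then have kj: "k j > 0" using cl[of i1 j] m[OF i] by (simp add: log_close_def j_def)
    \<comment> \<open>If this fails, then by monotonicity rows up to \<open>i\<close> have no weight
      in columns from \<open>j\<close> on. All their weight lies in columns below \<open>j\<close>,
      so \<open>P (Suc i) \<le> Q j\<close>, although the two intervals share an integer. The
      reverse inequality follows with the roles exchanged.\<close>
    have "ln (h i) \<le> ln (k j) + D"
    proof (rule ccontr)
      assume a: "\<not> ?thesis"
      have z: "W i' j' = 0" if "i' \<le> i" "j' < n" "\<not> j' < j" for i' j'
      proof (rule ccontr)
        assume "W i' j' \<noteq> 0"
        then have "W i' j' > 0" using W[of i' j'] by simp
        then have "log_close D (h i') (k j')" using cl that X[OF i] by simp
        then have b: "0 < h i'" "0 < k j'" "ln (h i') \<le> ln (k j') + D" by (auto simp: log_close_def)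
        moreover have "ln (h i) \<le> ln (h i')" using h(2)[of i' i] hi X[OF i] that by simp
        moreover have "ln (k j') \<le> ln (k j)" using k[of j j'] that b by simp
        ultimately show False using a by linarith
      qed
      have "P (Suc i) = (\<Sum>i'<Suc i. \<Sum>j'<j. W i' j')"
        unfolding P_def r_def
        by (intro sum.cong refl sum.mono_neutral_right) (use z m[OF i] j_def in auto)
      also have "\<dots> = (\<Sum>j'<j. \<Sum>i'<Suc i. W i' j')" by (rule sum.swap)
      also have "\<dots> \<le> Q j"
        unfolding Q_def c_def by (intro sum_mono sum_mono2) (use X[OF i] W in auto)
      finally show False using X[OF i] m[OF i] unfolding j_def by linarith
    qed
    moreover have "ln (k j) \<le> ln (h i) + D"
    proof (rule ccontr)
      assume a: "\<not> ?thesis"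
      have z: "W i' j' = 0" if "j' \<le> j" "i' < n" "\<not> i' < i" for i' j'
      proof (rule ccontr)
        assume "W i' j' \<noteq> 0"
        then have "W i' j' > 0" using W[of i' j'] by simp
        then have "log_close D (h i') (k j')" using cl that m[OF i] j_def by simp
        then have b: "0 < h i'" "0 < k j'" "ln (k j') \<le> ln (h i') + D" by (auto simp: log_close_def)
        moreover have "ln (k j) \<le> ln (k j')" using k[of j' j] kj m[OF i] j_def that by simp
        moreover have "ln (h i') \<le> ln (h i)" using h(2)[of i i'] that b by simp
        ultimately show False using a by linarith
      qed
      have "Q (Suc j) = (\<Sum>j'<Suc j. \<Sum>i'<i. W i' j')"
        unfolding Q_def c_def
        by (intro sum.cong refl sum.mono_neutral_right) (use z X[OF i] in auto)
      also have "\<dots> = (\<Sum>i'<i. \<Sum>j'<Suc j. W i' j')" by (rule sum.swap)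
      also have "\<dots> \<le> P i"
        unfolding P_def r_def by (intro sum_mono sum_mono2) (use m[OF i] j_def W in auto)
      finally show False using X[OF i] m[OF i] unfolding j_def by linarith
    qed
    ultimately show ?thesis using hi kj by (auto simp: log_close_def j_def)
  qed
  moreover have "(\<Sum>i<n. \<Sum>j<n. W i j * h i) \<le> (\<Sum>i\<in>X. h i)"
  proof -
    have "(\<Sum>i<n. \<Sum>j<n. W i j * h i) = (\<Sum>i<n. r i * h i)"
      by (simp add: r_def sum_distrib_right)
    also have "\<dots> \<le> (\<Sum>i\<in>X. h i)"
      unfolding X_def P_def
      by (rule sum_crossing_ge) (use r0 row h in \<open>auto simp: r_def\<close>)
    finally show ?thesis .
  qed
  ultimately show thesis using that[of X m] m(1) X(1) by auto
qed

text \<open>Rows are enumerated by decreasing \<open>h\<close> and columns by decreasing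
  \<open>k\<close>, independently of each other; \<open>F\<close> inverts the row enumeration and
  carries the matching of indices back to \<open>A\<close>.\<close>

lemma fractional_matching_rounding:
  fixes w :: "nat \<Rightarrow> nat \<Rightarrow> real" and h k :: "nat \<Rightarrow> real"
  assumes fin: "finite A" and w: "\<And>x y. 0 \<le> w x y"
    and row: "\<And>x. x \<in> A \<Longrightarrow> (\<Sum>y\<in>A. w x y) \<le> 1"
    and col: "\<And>y. y \<in> A \<Longrightarrow> (\<Sum>x\<in>A. w x y) \<le> 1"
    and cl: "\<And>x y. x \<in> A \<Longrightarrow> y \<in> A \<Longrightarrow> 0 < w x y \<Longrightarrow> log_close D (h x) (k y)"
    and h: "\<And>x. x \<in> A \<Longrightarrow> 0 \<le> h x"
  obtains X m where "X \<subseteq> A" "inj_on m X" "m ` X \<subseteq> A"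
    "\<And>x. x \<in> X \<Longrightarrow> log_close D (h x) (k (m x))"
    "(\<Sum>x\<in>A. \<Sum>y\<in>A. w x y * h x) \<le> (\<Sum>x\<in>X. h x)"
proof -
  obtain f where f: "bij_betw f {..<card A} A"
    "\<And>i j. i \<le> j \<Longrightarrow> j < card A \<Longrightarrow> h (f j) \<le> h (f i)"
    using ex_decreasing_enumeration[OF fin] by blast
  obtain g where g: "bij_betw g {..<card A} A"
    "\<And>i j. i \<le> j \<Longrightarrow> j < card A \<Longrightarrow> k (g j) \<le> k (g i)"
    using ex_decreasing_enumeration[OF fin] by blast
  have fA: "f i \<in> A" and gA: "g i \<in> A" if "i < card A" for i
    using f(1) g(1) that by (auto simp: bij_betw_def)
  have sf: "(\<Sum>i<card A. u (f i)) = (\<Sum>x\<in>A. u x)" for u :: "nat \<Rightarrow> real"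
    by (rule sum.reindex_bij_betw[OF f(1)])
  have sg: "(\<Sum>i<card A. u (g i)) = (\<Sum>x\<in>A. u x)" for u :: "nat \<Rightarrow> real"
    by (rule sum.reindex_bij_betw[OF g(1)])
  obtain X m where Xm: "X \<subseteq> {..<card A}" "inj_on m X" "m ` X \<subseteq> {..<card A}"
    "\<And>i. i \<in> X \<Longrightarrow> log_close D (h (f i)) (k (g (m i)))"
    "(\<Sum>i<card A. \<Sum>j<card A. w (f i) (g j) * h (f i)) \<le> (\<Sum>i\<in>X. h (f i))"
  proof (rule fractional_matching_rounding_sorted[of "\<lambda>i j. w (f i) (g j)" "card A" D "h \<circ> f" "k \<circ> g"])
    show "(\<Sum>j<card A. w (f i) (g j)) \<le> 1" if "i < card A" for i
      using sg[of "\<lambda>y. w (f i) y"] row fA that by simp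
    show "(\<Sum>i<card A. w (f i) (g j)) \<le> 1" if "j < card A" for j
      using sf[of "\<lambda>x. w x (g j)"] col gA that by simp
  qed (use w cl h fA gA f(2) g(2) in auto)
  define F where "F = inv_into {..<card A} f"
  have F: "F (f i) = i" if "i < card A" for i
    using f(1) that by (auto simp: F_def bij_betw_def)
  have injf: "inj_on f X" using f(1) Xm(1) by (auto simp: bij_betw_def intro: inj_on_subset)
  show thesis
  proof (rule that[of "f ` X" "g \<circ> m \<circ> F"])
    show "f ` X \<subseteq> A" using Xm(1) fA by auto
    have eq: "(g \<circ> m \<circ> F) (f i) = g (m i)" if "i \<in> X" for i using F Xm(1) that by auto
    have "inj_on g (m ` X)" using g(1) Xm(3) by (auto simp: bij_betw_def intro: inj_on_subset)
    with Xm(2) have gm: "inj_on (g \<circ> m) X" by (rule comp_inj_on)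
    have "inj_on F (f ` X)"
      using F Xm(1) by (auto simp: inj_on_def subset_iff)
    moreover have "F ` f ` X = X"
      using F Xm(1) by (simp add: image_image subset_iff)
    ultimately show "inj_on (g \<circ> m \<circ> F) (f ` X)"
      using comp_inj_on[of F "f ` X" "g \<circ> m"] gm by simp
    show "(g \<circ> m \<circ> F) ` f ` X \<subseteq> A"
    proof safe
      fix i assume "i \<in> X"
      then have "m i < card A" using Xm(3) by auto
      then show "(g \<circ> m \<circ> F) (f i) \<in> A" unfolding eq[OF \<open>i \<in> X\<close>] by (rule gA)
    qed
    show "log_close D (h x) (k ((g \<circ> m \<circ> F) x))" if "x \<in> f ` X" for x
    proof -
      from that obtain i where "i \<in> X" "x = f i" by blast
      then show ?thesis unfolding \<open>x = f i\<close> eq[OF \<open>i \<in> X\<close>] by (intro Xm(4))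
    qed
    have "(\<Sum>i<card A. \<Sum>j<card A. w (f i) (g j) * h (f i)) = (\<Sum>x\<in>A. \<Sum>y\<in>A. w x y * h x)"
      by (subst sf[symmetric], subst sg[symmetric]) simp
    then show "(\<Sum>x\<in>A. \<Sum>y\<in>A. w x y * h x) \<le> sum h (f ` X)"
      using Xm(5) by (simp add: sum.reindex[OF injf])
  qed
qed

lemma ex_permutes_extending:
  assumes "finite A" "X \<subseteq> A" "inj_on m X" "m ` X \<subseteq> A"
  obtains \<pi> where "\<pi> permutes A" "\<And>x. x \<in> X \<Longrightarrow> \<pi> x = m x"
proof -
  have "card (A - X) = card (A - m ` X)"
    using assms by (simp add: card_Diff_subset card_image finite_subset)
  then obtain g where g: "bij_betw g (A - X) (A - m ` X)"
    using finite_same_card_bij[of "A - X" "A - m ` X"] assms(1) by auto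
  define \<pi> where "\<pi> x = (if x \<in> X then m x else if x \<in> A then g x else x)" for x
  have 1: "bij_betw \<pi> X (m ` X)"
    using assms(3) by (auto simp: bij_betw_def inj_on_def \<pi>_def)
  have 2: "bij_betw \<pi> (A - X) (A - m ` X)"
    using g by (subst bij_betw_cong[of _ _ g]) (auto simp: \<pi>_def)
  have "bij_betw \<pi> (X \<union> (A - X)) (m ` X \<union> (A - m ` X))"
    by (rule bij_betw_combine[OF 1 2]) auto
  then have "bij_betw \<pi> A A" using assms by (simp add: Un_absorb1)
  then have "\<pi> permutes A"
    by (rule bij_imp_permutes) (use assms in \<open>auto simp: \<pi>_def\<close>)
  then show thesis using that by (simp add: \<pi>_def)
qed

text \<open>Dividing row \<open>x\<close> of the coupling by \<open>pmf \<mu> x\<close> gives row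
  sums at most 1. Column sums are then at most \<open>exp D\<close>, because closeness allows
  \<open>pmf \<mu> x\<close> to be exchanged for \<open>pmf \<tau> y\<close>. The factor
  \<open>exp (- D)\<close> in \<open>w\<close> brings them down to 1 and costs mass at most
  \<open>D\<close>, whence \<open>D + \<eta> \<le> \<epsilon>\<close>; the hypothesis
  \<open>2 * D \<le> \<epsilon>\<close> turns closeness of logarithms into the interval of
  \<open>hist_mismatch\<close>.\<close>

lemma hist_div_le_of_coupling:
  fixes \<gamma> :: "nat \<Rightarrow> nat \<Rightarrow> real"
  assumes fin: "finite \<Omega>" and sup: "set_pmf \<mu> \<subseteq> \<Omega>" and \<gamma>: "\<And>x y. 0 \<le> \<gamma> x y"
    and row: "\<And>x. x \<in> \<Omega> \<Longrightarrow> (\<Sum>y\<in>\<Omega>. \<gamma> x y) \<le> pmf \<mu> x"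
    and col: "\<And>y. y \<in> \<Omega> \<Longrightarrow> (\<Sum>x\<in>\<Omega>. \<gamma> x y) \<le> pmf \<tau> y"
    and cl: "\<And>x y. x \<in> \<Omega> \<Longrightarrow> y \<in> \<Omega> \<Longrightarrow> 0 < \<gamma> x y \<Longrightarrow> log_close D (pmf \<mu> x) (pmf \<tau> y)"
    and tot: "1 - \<eta> \<le> (\<Sum>x\<in>\<Omega>. \<Sum>y\<in>\<Omega>. \<gamma> x y)"
    and D: "0 \<le> D" "0 \<le> \<eta>" "D + \<eta> \<le> \<epsilon>" "2 * D \<le> \<epsilon>" "\<epsilon> \<le> 1"
  shows "hist_div \<Omega> \<mu> \<tau> \<le> \<epsilon>"
proof -
  define w where "w x y = exp (- D) * (\<gamma> x y / pmf \<mu> x)" for x y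
  obtain X m where Xm: "X \<subseteq> \<Omega>" "inj_on m X" "m ` X \<subseteq> \<Omega>"
    "\<And>x. x \<in> X \<Longrightarrow> log_close D (pmf \<mu> x) (pmf \<tau> (m x))"
    "(\<Sum>x\<in>\<Omega>. \<Sum>y\<in>\<Omega>. w x y * pmf \<mu> x) \<le> (\<Sum>x\<in>X. pmf \<mu> x)"
  proof (rule fractional_matching_rounding[of \<Omega> w D "pmf \<mu>" "pmf \<tau>"])
    show "0 \<le> w x y" for x y using \<gamma> by (simp add: w_def)
    show "(\<Sum>y\<in>\<Omega>. w x y) \<le> 1" if "x \<in> \<Omega>" for x
    proof -
      have "(\<Sum>y\<in>\<Omega>. w x y) = exp (- D) * ((\<Sum>y\<in>\<Omega>. \<gamma> x y) / pmf \<mu> x)"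
        by (simp add: w_def sum_distrib_left sum_divide_distrib)
      also have "\<dots> \<le> 1 * 1"
        using D \<gamma>
        by (intro mult_mono quotient_le_one row[OF that] divide_nonneg_nonneg sum_nonneg) auto
      finally show ?thesis by simp
    qed
    show "(\<Sum>x\<in>\<Omega>. w x y) \<le> 1" if y: "y \<in> \<Omega>" for y
    proof -
      have "(\<Sum>x\<in>\<Omega>. w x y) \<le> (\<Sum>x\<in>\<Omega>. \<gamma> x y / pmf \<tau> y)"
      proof (rule sum_mono)
        fix x assume x: "x \<in> \<Omega>"
        show "w x y \<le> \<gamma> x y / pmf \<tau> y"
        proof (cases "\<gamma> x y > 0")
          case True
          with cl[OF x y] have c: "log_close D (pmf \<tau> y) (pmf \<mu> x)" by (blast intro: log_close_sym)
          then have p: "pmf \<mu> x > 0" "pmf \<tau> y > 0" by (auto simp: log_close_def)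
          have "pmf \<tau> y * exp (- D) \<le> pmf \<mu> x"
            using log_close_upper[OF c] by (simp add: exp_minus field_simps)
          then have "\<gamma> x y * (pmf \<tau> y * exp (- D)) \<le> \<gamma> x y * pmf \<mu> x"
            using True by (intro mult_left_mono) auto
          then show ?thesis using p by (simp add: w_def field_simps)
        next
          case False
          then have "\<gamma> x y = 0" using \<gamma>[of x y] by simp
          then show ?thesis by (simp add: w_def)
        qed
      qed
      also have "\<dots> = (\<Sum>x\<in>\<Omega>. \<gamma> x y) / pmf \<tau> y" by (simp add: sum_divide_distrib)
      also have "\<dots> \<le> 1"
        using \<gamma> by (intro quotient_le_one col[OF y] sum_nonneg) auto
      finally show ?thesis .
    qed
    show "log_close D (pmf \<mu> x) (pmf \<tau> y)" if "x \<in> \<Omega>" "y \<in> \<Omega>" "0 < w x y" for x y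
    proof -
      have "\<gamma> x y \<noteq> 0" using that(3) by (auto simp: w_def)
      then show ?thesis using cl that \<gamma>[of x y] by auto
    qed
  qed (use fin in auto)
  obtain \<pi> where \<pi>: "\<pi> permutes \<Omega>" "\<And>x. x \<in> X \<Longrightarrow> \<pi> x = m x"
    using ex_permutes_extending[OF fin Xm(1,2,3)] by blast
  have "exp (- D) * (1 - \<eta>) \<le> exp (- D) * (\<Sum>x\<in>\<Omega>. \<Sum>y\<in>\<Omega>. \<gamma> x y)"
    using tot by simp
  also have "\<dots> = (\<Sum>x\<in>\<Omega>. \<Sum>y\<in>\<Omega>. w x y * pmf \<mu> x)"
  proof -
    have "w x y * pmf \<mu> x = exp (- D) * \<gamma> x y" if "x \<in> \<Omega>" "y \<in> \<Omega>" for x y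
    proof (cases "pmf \<mu> x = 0")
      case True
      then have "\<gamma> x y \<le> 0" using row[OF that(1)] member_le_sum[of y \<Omega> "\<gamma> x"] that fin \<gamma> by simp
      then show ?thesis using \<gamma>[of x y] True by simp
    qed (simp add: w_def)
    then show ?thesis by (simp add: sum_distrib_left)
  qed
  also have "\<dots> \<le> (\<Sum>x\<in>X. pmf \<mu> x)" by (rule Xm(5))
  also have "\<dots> = measure_pmf.prob \<mu> X"
    using fin Xm(1) by (simp add: measure_measure_pmf_finite finite_subset)
  finally have PX: "exp (- D) * (1 - \<eta>) \<le> measure_pmf.prob \<mu> X" .
  have "(1 - D) * (1 - \<eta>) \<le> exp (- D) * (1 - \<eta>)"
    using exp_ge_add_one_self[of "- D"] D by (intro mult_right_mono) auto
  moreover have "1 - (D + \<eta>) \<le> (1 - D) * (1 - \<eta>)" using D by (simp add: algebra_simps)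
  ultimately have PX: "1 - \<epsilon> \<le> measure_pmf.prob \<mu> X" using PX D by linarith
  have "hist_mismatch \<mu> \<tau> \<pi> \<epsilon> \<le> measure_pmf.prob \<mu> (- X)"
    unfolding hist_mismatch_def
  proof (rule measure_pmf.finite_measure_mono; safe?)
    fix x assume "x \<in> X" and n: "pmf \<mu> x \<notin> {(1 - \<epsilon>) * pmf \<tau> (\<pi> x)..(1 + \<epsilon>) * pmf \<tau> (\<pi> x)}"
    then have c: "log_close D (pmf \<mu> x) (pmf \<tau> (\<pi> x))" using Xm(4) \<pi>(2) by simp
    then have p: "pmf \<tau> (\<pi> x) > 0" by (simp add: log_close_def)
    have "D \<le> 1 / 2" using D by linarith
    then have "exp D \<le> 1 + 2 * D" using exp_bound_half[of D] D(1) exp_bound_lemma[of D] by simp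
    then have "exp D * pmf \<tau> (\<pi> x) \<le> (1 + \<epsilon>) * pmf \<tau> (\<pi> x)" using D p by (intro mult_right_mono) auto
    moreover have "(1 - \<epsilon>) * pmf \<tau> (\<pi> x) \<le> exp (- D) * pmf \<tau> (\<pi> x)"
      using exp_ge_add_one_self[of "- D"] D p by (intro mult_right_mono) auto
    moreover have "exp (- D) * pmf \<tau> (\<pi> x) \<le> pmf \<mu> x"
      using log_close_upper[OF log_close_sym[OF c]] by (simp add: exp_minus field_simps)
    ultimately show False using n log_close_upper[OF c] by auto
  qed auto
  also have "\<dots> = 1 - measure_pmf.prob \<mu> X"
    using measure_pmf.prob_compl[of X \<mu>] by (simp add: Compl_eq_Diff_UNIV)
  finally have "hist_mismatch \<mu> \<tau> \<pi> \<epsilon> \<le> \<epsilon>" using PX by linarith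
  then have "\<epsilon> \<in> hist_div_set \<Omega> \<mu> \<tau>"
    using \<pi>(1) D by (auto simp: hist_div_set_iff[OF fin])
  then show ?thesis by (rule hist_div_attained(2)[OF fin sup])
qed

text \<open>
  \<open>\<beta>\<close> is read as a subdistribution on scales, \<open>v k\<close> being the value that scale \<open>k\<close> stands for.
\<close>

definition fits_scales ::
  "nat set \<Rightarrow> nat set \<Rightarrow> (nat \<Rightarrow> real) \<Rightarrow> real \<Rightarrow> real \<Rightarrow> nat pmf \<Rightarrow> (nat \<Rightarrow> real) \<Rightarrow> bool" where
  "fits_scales \<Omega> I v D \<eta> \<tau> \<beta> \<longleftrightarrow> (\<exists>g. (\<forall>x k. 0 \<le> g x k) \<and>
     (\<forall>x\<in>\<Omega>. (\<Sum>k\<in>I. g x k) \<le> pmf \<tau> x) \<and> (\<forall>k\<in>I. (\<Sum>x\<in>\<Omega>. g x k) \<le> \<beta> k) \<and>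
     (\<forall>x\<in>\<Omega>. \<forall>k\<in>I. 0 < g x k \<longrightarrow> log_close D (pmf \<tau> x) (v k)) \<and>
     1 - \<eta> \<le> (\<Sum>x\<in>\<Omega>. \<Sum>k\<in>I. g x k))"

text \<open>Couplings of \<mu> and of \<tau> with the same scale law are glued at the scales: given
  the scale, the two elements are drawn independently. Distances add up to \<open>2 * D\<close> and
  lost masses to \<open>2 * \<eta>\<close>.\<close>

lemma hist_div_le_of_fits_scales:
  assumes fin: "finite \<Omega>" "finite I" and sup: "set_pmf \<mu> \<subseteq> \<Omega>"
    and \<beta>: "(\<Sum>k\<in>I. \<beta> k) \<le> 1"
    and f\<mu>: "fits_scales \<Omega> I v D \<eta> \<mu> \<beta>" and f\<tau>: "fits_scales \<Omega> I v D \<eta> \<tau> \<beta>"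
    and D: "0 \<le> D" "0 \<le> \<eta>" "2 * D + 2 * \<eta> \<le> \<epsilon>" "4 * D \<le> \<epsilon>" "\<epsilon> \<le> 1"
  shows "hist_div \<Omega> \<mu> \<tau> \<le> \<epsilon>"
proof -
  obtain g where g: "\<And>x k. 0 \<le> g x k" "\<And>x. x \<in> \<Omega> \<Longrightarrow> (\<Sum>k\<in>I. g x k) \<le> pmf \<mu> x"
    "\<And>k. k \<in> I \<Longrightarrow> (\<Sum>x\<in>\<Omega>. g x k) \<le> \<beta> k"
    "\<And>x k. x \<in> \<Omega> \<Longrightarrow> k \<in> I \<Longrightarrow> 0 < g x k \<Longrightarrow> log_close D (pmf \<mu> x) (v k)"
    "1 - \<eta> \<le> (\<Sum>x\<in>\<Omega>. \<Sum>k\<in>I. g x k)"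
    using f\<mu> unfolding fits_scales_def by blast
  obtain h where h: "\<And>x k. 0 \<le> h x k" "\<And>x. x \<in> \<Omega> \<Longrightarrow> (\<Sum>k\<in>I. h x k) \<le> pmf \<tau> x"
    "\<And>k. k \<in> I \<Longrightarrow> (\<Sum>x\<in>\<Omega>. h x k) \<le> \<beta> k"
    "\<And>x k. x \<in> \<Omega> \<Longrightarrow> k \<in> I \<Longrightarrow> 0 < h x k \<Longrightarrow> log_close D (pmf \<tau> x) (v k)"
    "1 - \<eta> \<le> (\<Sum>x\<in>\<Omega>. \<Sum>k\<in>I. h x k)"
    using f\<tau> unfolding fits_scales_def by blast
  define G where "G k = (\<Sum>x\<in>\<Omega>. g x k)" for k
  define H where "H k = (\<Sum>x\<in>\<Omega>. h x k)" for k
  have G: "0 \<le> G k" and H: "0 \<le> H k" for k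
    by (auto simp: G_def H_def g h sum_nonneg)
  have GB: "G k \<le> \<beta> k" "H k \<le> \<beta> k" if "k \<in> I" for k using g(3) h(3) that by (auto simp: G_def H_def)
  have \<beta>0: "0 \<le> \<beta> k" if "k \<in> I" for k using G[of k] GB[OF that] by linarith
  \<comment> \<open>For \<open>\<beta> k = 0\<close> the quotient is 0 by convention, which is
    harmless since column \<open>k\<close> of \<open>g\<close> and of \<open>h\<close> then has sum
    0.\<close>
  define \<gamma> where "\<gamma> x y = (\<Sum>k\<in>I. g x k * h y k / \<beta> k)" for x y
  have div1: "a * (b / \<beta> k) \<le> a" if "0 \<le> a" "b \<le> \<beta> k" "k \<in> I" for a b k
    using that \<beta>0[OF that(3)] mult_left_mono[of "b / \<beta> k" 1 a]
    by (cases "\<beta> k = 0") (auto simp: divide_le_eq_1)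
  have rowsum: "(\<Sum>y\<in>\<Omega>. \<gamma> x y) = (\<Sum>k\<in>I. g x k * (H k / \<beta> k))" for x
    unfolding \<gamma>_def H_def by (subst sum.swap) (simp add: sum_distrib_left sum_divide_distrib)
  show ?thesis
  proof (rule hist_div_le_of_coupling[OF fin(1) sup, of \<gamma> \<tau> "2 * D" "2 * \<eta>"])
    show "0 \<le> \<gamma> x y" for x y unfolding \<gamma>_def by (intro sum_nonneg divide_nonneg_nonneg mult_nonneg_nonneg g h \<beta>0)
    show "(\<Sum>y\<in>\<Omega>. \<gamma> x y) \<le> pmf \<mu> x" if "x \<in> \<Omega>" for x
    proof -
      have "(\<Sum>y\<in>\<Omega>. \<gamma> x y) \<le> (\<Sum>k\<in>I. g x k)"
        unfolding rowsum by (intro sum_mono div1 g GB)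
      then show ?thesis using g(2)[OF that] by simp
    qed
    show "(\<Sum>x\<in>\<Omega>. \<gamma> x y) \<le> pmf \<tau> y" if "y \<in> \<Omega>" for y
    proof -
      have "(\<Sum>x\<in>\<Omega>. \<gamma> x y) = (\<Sum>k\<in>I. h y k * (G k / \<beta> k))"
        unfolding \<gamma>_def G_def
        by (subst sum.swap) (simp add: sum_distrib_left sum_divide_distrib mult.commute)
      also have "\<dots> \<le> (\<Sum>k\<in>I. h y k)" by (intro sum_mono div1 h GB)
      finally show ?thesis using h(2)[OF that] by simp
    qed
    show "log_close (2 * D) (pmf \<mu> x) (pmf \<tau> y)" if "x \<in> \<Omega>" "y \<in> \<Omega>" "0 < \<gamma> x y" for x y
    proof -
      from that(3) obtain k where k: "k \<in> I" "g x k * h y k / \<beta> k > 0"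
        unfolding \<gamma>_def using ex_pos_of_sum_pos by blast
      have "g x k \<noteq> 0" "h y k \<noteq> 0" using k(2) by auto
      then have "0 < g x k" "0 < h y k" using g(1)[of x k] h(1)[of y k] by auto
      then show ?thesis
        using log_close_trans[OF g(4)[OF that(1) k(1)] log_close_sym[OF h(4)[OF that(2) k(1)]]] by simp
    qed
    have tot: "(\<Sum>x\<in>\<Omega>. \<Sum>y\<in>\<Omega>. \<gamma> x y) = (\<Sum>k\<in>I. G k * H k / \<beta> k)"
    proof -
      have "(\<Sum>x\<in>\<Omega>. \<Sum>y\<in>\<Omega>. \<gamma> x y) = (\<Sum>x\<in>\<Omega>. \<Sum>k\<in>I. g x k * (H k / \<beta> k))"
        unfolding rowsum ..
      also have "\<dots> = (\<Sum>k\<in>I. G k * H k / \<beta> k)"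
        unfolding G_def by (subst sum.swap) (simp add: sum_distrib_right sum_divide_distrib)
      finally show ?thesis .
    qed
    have "(\<Sum>k\<in>I. G k + H k - \<beta> k) \<le> (\<Sum>k\<in>I. G k * H k / \<beta> k)"
    proof (rule sum_mono)
      fix k assume k: "k \<in> I"
      \<comment> \<open>Expanding this product bounds the glued mass at scale \<open>k\<close> from
        below by \<open>\<beta> k\<close> minus the two deficits \<open>\<beta> k - G k\<close> and
        \<open>\<beta> k - H k\<close>.\<close>
      have "0 \<le> (\<beta> k - G k) * (\<beta> k - H k)" using GB[OF k] by simp
      then have "(G k + H k - \<beta> k) * \<beta> k \<le> G k * H k" by (simp add: algebra_simps)
      then show "G k + H k - \<beta> k \<le> G k * H k / \<beta> k"
        using \<beta>0[OF k] G[of k] H[of k] GB[OF k] by (cases "\<beta> k = 0") (auto simp: pos_le_divide_eq)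
    qed
    moreover have "(\<Sum>k\<in>I. G k) \<ge> 1 - \<eta>"
      using g(5) sum.swap[of g I \<Omega>] unfolding G_def by simp
    moreover have "(\<Sum>k\<in>I. H k) \<ge> 1 - \<eta>"
      using h(5) sum.swap[of h I \<Omega>] unfolding H_def by simp
    ultimately show "1 - 2 * \<eta> \<le> (\<Sum>x\<in>\<Omega>. \<Sum>y\<in>\<Omega>. \<gamma> x y)"
      using \<beta> by (simp add: tot sum.distrib sum_subtractf)
  qed (use D in auto)
qed

section \<open>Oracle algorithms and sampling\<close>

primrec bind_alg :: "'a cond_alg \<Rightarrow> ('a \<Rightarrow> 'b cond_alg) \<Rightarrow> 'b cond_alg" where
  "bind_alg (Output r) g = g r"
| "bind_alg (Query A f) g = Query A (\<lambda>x. bind_alg (f x) g)"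
| "bind_alg (Toss D f) g = Toss D (\<lambda>i. bind_alg (f i) g)"

primrec repeat_alg :: "nat \<Rightarrow> 'a cond_alg \<Rightarrow> 'a list cond_alg" where
  "repeat_alg 0 a = Output []"
| "repeat_alg (Suc n) a = bind_alg a (\<lambda>x. bind_alg (repeat_alg n a) (\<lambda>xs. Output (x # xs)))"

primrec truncate_alg :: "'r \<Rightarrow> 'r cond_alg \<Rightarrow> nat \<Rightarrow> 'r cond_alg" where
  "truncate_alg d (Output r) n = Output r"
| "truncate_alg d (Query A f) n =
     (if n = 0 then Output d else Query A (\<lambda>x. truncate_alg d (f x) (n - 1)))"
| "truncate_alg d (Toss D f) n = Toss D (\<lambda>i. truncate_alg d (f i) n)"

text \<open>Values in \<open>ennreal\<close> make the expectation meaningful for every tree and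
  oracle, without integrability conditions.\<close>

primrec expected_queries :: "(nat set \<Rightarrow> nat pmf) \<Rightarrow> 'r cond_alg \<Rightarrow> ennreal" where
  "expected_queries orc (Output r) = 0"
| "expected_queries orc (Query A f) = 1 + (\<integral>\<^sup>+x. expected_queries orc (f x) \<partial>orc A)"
| "expected_queries orc (Toss D f) = (\<integral>\<^sup>+i. expected_queries orc (f i) \<partial>D)"

lemma run_bind_alg: "run orc (bind_alg a g) = bind_pmf (run orc a) (\<lambda>r. run orc (g r))"
  by (induction a) (auto simp: bind_return_pmf bind_assoc_pmf)

lemma run_repeat_alg: "run orc (repeat_alg n a) = replicate_pmf n (run orc a)"
  by (induction n) (auto simp: run_bind_alg)

lemma queries_within_bind_alg:
  "queries_within \<Omega> a \<Longrightarrow> (\<And>r. queries_within \<Omega> (g r)) \<Longrightarrow> queries_within \<Omega> (bind_alg a g)"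
  by (induction a) auto

lemma queries_within_repeat_alg: "queries_within \<Omega> a \<Longrightarrow> queries_within \<Omega> (repeat_alg n a)"
  by (induction n) (auto intro!: queries_within_bind_alg)

lemma queries_within_truncate_alg: "queries_within \<Omega> a \<Longrightarrow> queries_within \<Omega> (truncate_alg d a n)"
  by (induction a arbitrary: n) auto

lemma queries_at_most_mono: "queries_at_most a n \<Longrightarrow> n \<le> n' \<Longrightarrow> queries_at_most a n'"
proof (induction a arbitrary: n n')
  case (Query A f)
  have "queries_at_most (f x) (n' - 1)" if "x \<in> A" for x
    using Query.IH[of "f x" "n - 1" "n' - 1"] Query.prems that by auto
  then show ?case using Query.prems by simp
qed auto

lemma queries_at_most_bind_alg:
  "queries_at_most a n \<Longrightarrow> (\<And>r. queries_at_most (g r) k) \<Longrightarrow> queries_at_most (bind_alg a g) (n + k)"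
proof (induction a arbitrary: n)
  case (Output r)
  then show ?case using queries_at_most_mono[OF Output.prems(2)[of r] le_add2] by simp
next
  case (Query A f)
  have "queries_at_most (bind_alg (f x) g) (n - 1 + k)" if "x \<in> A" for x
    using Query.IH[of "f x" "n - 1"] Query.prems that by auto
  then show ?case using Query.prems by simp
qed auto

lemma queries_at_most_repeat_alg:
  "queries_at_most a n \<Longrightarrow> queries_at_most (repeat_alg k a) (k * n)"
proof (induction k)
  case (Suc k)
  have "queries_at_most (repeat_alg (Suc k) a) (n + (k * n + 0))"
    unfolding repeat_alg.simps by (intro queries_at_most_bind_alg Suc) auto
  then show ?case by simp
qed simp

lemma queries_at_most_truncate_alg: "queries_at_most (truncate_alg d a n) n"
  by (induction a arbitrary: n) auto

lemma expected_queries_bind_alg: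
  "expected_queries orc (bind_alg a g) =
     expected_queries orc a + (\<integral>\<^sup>+r. expected_queries orc (g r) \<partial>run orc a)"
  by (induction a) (auto simp: nn_integral_add add.assoc)

lemma expected_queries_repeat_alg:
  "expected_queries orc (repeat_alg n a) = of_nat n * expected_queries orc a"
  by (induction n) (auto simp: expected_queries_bind_alg distrib_right)

text \<open>The induction step at a query of the truncation bound below: cost \<open>c\<close> and
  budget \<open>n\<close> both grow by one. For \<open>c < n\<close> the quotient does not decrease;
  for \<open>c \<ge> n\<close> the right-hand side is at least 1.\<close>

lemma ennreal_min_div_le:
  fixes c p :: ennreal
  assumes "p \<le> 1" "p \<le> t + c / of_nat n" "0 < n"
  shows "p \<le> t + (1 + c) / of_nat (Suc n)"
proof (cases "of_nat n \<le> c")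
  case True
  have "1 = (of_nat (Suc n) :: ennreal) / of_nat (Suc n)"
    by (rule ennreal_divide_self[symmetric]) (simp_all add: of_nat_less_top del: of_nat_Suc)
  also have "\<dots> \<le> (1 + c) / of_nat (Suc n)"
    using True by (intro divide_right_mono_ennreal) (simp add: add_left_mono)
  also have "\<dots> \<le> t + (1 + c) / of_nat (Suc n)" by simp
  finally show ?thesis using assms(1) by (rule order_trans[rotated])
next
  case False
  then obtain r where r: "c = ennreal r" "0 \<le> r" "r < real n"
    by (cases c rule: ennreal_cases) (auto simp: ennreal_of_nat_eq_real_of_nat ennreal_less_iff not_le)
  have "r / real n \<le> (1 + r) / real (Suc n)"
    using r assms(3) by (simp add: field_simps)
  then have "c / of_nat n \<le> (1 + c) / of_nat (Suc n)"
    using r assms(3)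
    by (simp add: ennreal_of_nat_eq_real_of_nat divide_ennreal ennreal_plus[symmetric] ennreal_1[symmetric]
        del: ennreal_plus ennreal_1 of_nat_Suc)
  then show ?thesis using assms(2) by (meson add_left_mono order_trans)
qed

text \<open>Markov's inequality for the number of queries: truncation alters only runs with at least
  \<open>Suc n\<close> of them. As \<open>run\<close> does not record this number, the bound is
  proved by induction over the tree.\<close>

lemma emeasure_run_le_truncate_alg:
  "emeasure (run orc a) E \<le>
     emeasure (run orc (truncate_alg d a n)) E + expected_queries orc a / of_nat (Suc n)"
proof (induction a arbitrary: n)
  case (Output r)
  then show ?case by simp
next
  case (Toss D f)
  have "emeasure (run orc (Toss D f)) E \<le>
      (\<integral>\<^sup>+i. emeasure (run orc (truncate_alg d (f i) n)) E
        + expected_queries orc (f i) / of_nat (Suc n) \<partial>D)"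
    unfolding run.simps emeasure_bind_pmf by (intro nn_integral_mono Toss) auto
  then show ?case by (simp add: nn_integral_add nn_integral_divide del: of_nat_Suc)
next
  case (Query A f)
  show ?case
  proof (cases n)
    case 0
    have "emeasure (run orc (Query A f)) E \<le> 1" by (rule measure_pmf.emeasure_le_1)
    also have "\<dots> \<le> expected_queries orc (Query A f) / of_nat (Suc n)"
      using 0 by (simp add: divide_ennreal_def)
    finally show ?thesis by (meson add_increasing order_trans zero_le)
  next
    case (Suc n')
    have "emeasure (run orc (Query A f)) E \<le>
      (\<integral>\<^sup>+x. emeasure (run orc (truncate_alg d (f x) (n - 1))) E
        + (1 + expected_queries orc (f x)) / of_nat (Suc n) \<partial>orc A)"
      unfolding run.simps emeasure_bind_pmf
    proof (intro nn_integral_mono ennreal_min_div_le)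
      fix x
      show "emeasure (run orc (f x)) E \<le> emeasure (run orc (truncate_alg d (f x) (n - 1))) E
          + expected_queries orc (f x) / of_nat n"
        using Query.IH[of "f x" "n - 1"] Suc by auto
    qed (auto simp: Suc measure_pmf.emeasure_le_1)
    also have "\<dots> = emeasure (run orc (truncate_alg d (Query A f) n)) E
        + expected_queries orc (Query A f) / of_nat (Suc n)"
      by (simp add: Suc nn_integral_add nn_integral_divide del: of_nat_Suc)
    finally show ?thesis .
  qed
qed

section \<open>Moments and tail bounds for finitely supported distributions\<close>

abbreviation expec :: "'a pmf \<Rightarrow> ('a \<Rightarrow> real) \<Rightarrow> real" where
  "expec \<equiv> \<lambda>p. measure_pmf.expectation p"

lemma integrable_finite_pmf:
  fixes f :: "'a \<Rightarrow> real"
  shows "finite (set_pmf p) \<Longrightarrow> integrable (measure_pmf p) f"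
  by (rule integrable_measure_pmf_finite)

lemma expec_bind:
  assumes "finite (set_pmf p)" "\<And>x. x \<in> set_pmf p \<Longrightarrow> finite (set_pmf (f x))"
  shows "expec (bind_pmf p f) h = expec p (\<lambda>x. expec (f x) h)"
  using assms by (subst pmf_expectation_bind[of "set_pmf p"]) (auto simp: integral_measure_pmf[of "set_pmf p"])

lemma expec_mono:
  assumes "finite (set_pmf p)" "\<And>x. x \<in> set_pmf p \<Longrightarrow> f x \<le> g x"
  shows "expec p f \<le> expec p g"
  using assms by (intro integral_mono_AE integrable_finite_pmf) (auto simp: AE_measure_pmf_iff)

lemma expec_cong:
  assumes "\<And>x. x \<in> set_pmf p \<Longrightarrow> f x = g x"
  shows "expec p f = expec p g"
  using assms by (intro integral_cong_AE) (auto simp: AE_measure_pmf_iff)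

lemma prob_ge_le_expec_div:
  assumes "finite (set_pmf p)" "\<And>x. x \<in> set_pmf p \<Longrightarrow> 0 \<le> u x" "0 < c"
  shows "measure_pmf.prob p {x. c \<le> u x} \<le> expec p u / c"
  using integral_Markov_inequality_measure[of p u "{}" c] assms
  by (auto simp: integrable_finite_pmf AE_measure_pmf_iff)

lemma chebyshev_second_moment:
  assumes fin: "finite (set_pmf p)" and v: "expec p (\<lambda>x. (u x - a)\<^sup>2) \<le> v" and c: "0 < c"
  shows "measure_pmf.prob p {x. c < \<bar>u x - a\<bar>} \<le> v / c\<^sup>2"
proof -
  have "measure_pmf.prob p {x. c < \<bar>u x - a\<bar>} \<le> measure_pmf.prob p {x. c\<^sup>2 \<le> (u x - a)\<^sup>2}"
    using c by (intro measure_pmf.finite_measure_mono) (auto simp: abs_le_square_iff[symmetric])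
  also have "\<dots> \<le> expec p (\<lambda>x. (u x - a)\<^sup>2) / c\<^sup>2"
    using c by (intro prob_ge_le_expec_div fin) auto
  also have "\<dots> \<le> v / c\<^sup>2" using v by (intro divide_right_mono) auto
  finally show ?thesis .
qed

text \<open>Union bound over two stages, with \<open>B\<close> the bad outcomes of the first one.
  Failure probabilities of composed algorithms are added up through it.\<close>

lemma prob_bind_pmf_le:
  assumes "measure_pmf.prob p B \<le> r" "0 \<le> r'"
    and "\<And>x. x \<in> set_pmf p \<Longrightarrow> x \<notin> B \<Longrightarrow> measure_pmf.prob (f x) E \<le> r'"
  shows "measure_pmf.prob (bind_pmf p f) E \<le> r + r'"
proof -
  have r: "0 \<le> r" using assms(1) measure_nonneg order_trans by blast
  have "emeasure (bind_pmf p f) E \<le> (\<integral>\<^sup>+x. indicator B x + ennreal r' \<partial>p)"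
    unfolding emeasure_bind_pmf
  proof (intro nn_integral_mono_AE AE_pmfI)
    fix x assume "x \<in> set_pmf p"
    with assms(2) assms(3)[of x] show "emeasure (f x) E \<le> indicator B x + ennreal r'"
      using measure_pmf.emeasure_le_1[of "f x" E]
      by (cases "x \<in> B") (auto simp: measure_pmf.emeasure_eq_measure ennreal_leI add_increasing2)
  qed
  also have "\<dots> = ennreal (measure_pmf.prob p B) + ennreal r'"
    by (simp add: nn_integral_add measure_pmf.emeasure_eq_measure)
  also have "\<dots> \<le> ennreal (r + r')"
    using assms(1,2) r by (simp add: ennreal_plus[symmetric] ennreal_leI del: ennreal_plus)
  finally show ?thesis
    using r assms(2) unfolding measure_pmf.emeasure_eq_measure by (subst (asm) ennreal_le_iff) auto
qed

lemma finite_set_replicate_pmf: "finite (set_pmf p) \<Longrightarrow> finite (set_pmf (replicate_pmf n p))"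
  by (induction n) auto

lemma expec_replicate_sum:
  assumes "finite (set_pmf p)"
  shows "expec (replicate_pmf n p) (\<lambda>xs. sum_list (map f xs)) = real n * expec p f"
proof (induction n)
  case (Suc n)
  have fin: "finite (set_pmf (replicate_pmf n p))" using assms by (rule finite_set_replicate_pmf)
  show ?case
    using assms fin Suc
    by (simp add: expec_bind integrable_finite_pmf algebra_simps)
qed simp

lemma expec_replicate_variance:
  assumes fin: "finite (set_pmf p)"
  shows "expec (replicate_pmf n p) (\<lambda>xs. (sum_list (map f xs) - real n * expec p f)\<^sup>2) =
    real n * expec p (\<lambda>x. (f x - expec p f)\<^sup>2)"
proof (induction n)
  case (Suc n)
  have finr: "finite (set_pmf (replicate_pmf n p))" using assms by (rule finite_set_replicate_pmf)
  note int = integrable_finite_pmf[OF fin] integrable_finite_pmf[OF finr]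
  define a where "a = expec p f"
  define S where "S xs = sum_list (map f xs) - real n * a" for xs
  have S: "expec (replicate_pmf n p) S = 0"
    unfolding S_def using int by (simp add: expec_replicate_sum[OF fin] a_def)
  have z: "expec p (\<lambda>x. f x - a) = 0" using int by (simp add: a_def)
  \<comment> \<open>The cross term vanishes, because \<open>S\<close> is centred and independent of
    the first sample.\<close>
  have "expec (replicate_pmf (Suc n) p) (\<lambda>xs. (sum_list (map f xs) - real (Suc n) * a)\<^sup>2)
    = expec p (\<lambda>x. expec (replicate_pmf n p) (\<lambda>xs. (f x - a)\<^sup>2 + 2 * (f x - a) * S xs + (S xs)\<^sup>2))"
    using fin finr by (simp add: expec_bind S_def power2_eq_square algebra_simps)
  also have "\<dots> = expec p (\<lambda>x. (f x - a)\<^sup>2 + expec (replicate_pmf n p) (\<lambda>xs. (S xs)\<^sup>2))"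
    using int S by simp
  also have "\<dots> = expec p (\<lambda>x. (f x - a)\<^sup>2) + expec (replicate_pmf n p) (\<lambda>xs. (S xs)\<^sup>2)"
    using int by simp
  also have "expec (replicate_pmf n p) (\<lambda>xs. (S xs)\<^sup>2) = real n * expec p (\<lambda>x. (f x - a)\<^sup>2)"
    using Suc by (simp add: S_def a_def)
  finally show ?case by (simp add: a_def algebra_simps)
qed simp

lemma expec_variance_le_second_moment:
  assumes fin: "finite (set_pmf p)"
  shows "expec p (\<lambda>x. (f x - expec p f)\<^sup>2) \<le> expec p (\<lambda>x. (f x)\<^sup>2)"
proof -
  define a where "a = expec p f"
  note int = integrable_finite_pmf[OF fin]
  have "expec p (\<lambda>x. (f x - a)\<^sup>2) = expec p (\<lambda>x. (f x)\<^sup>2 - 2 * a * f x + a\<^sup>2)"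
    by (simp add: power2_eq_square algebra_simps)
  also have "\<dots> = expec p (\<lambda>x. (f x)\<^sup>2) - 2 * a * a + a\<^sup>2"
    using int by (simp add: a_def)
  finally show ?thesis by (simp add: a_def power2_eq_square)
qed

lemma replicate_mean_deviation:
  assumes fin: "finite (set_pmf p)" and v: "expec p (\<lambda>x. (f x)\<^sup>2) \<le> v" and c: "0 < c" and n: "0 < n"
  shows "measure_pmf.prob (replicate_pmf n p)
    {xs. c < \<bar>sum_list (map f xs) / real n - expec p f\<bar>} \<le> v / (real n * c\<^sup>2)"
proof -
  have "{xs. c < \<bar>sum_list (map f xs) / real n - expec p f\<bar>}
    = {xs. real n * c < \<bar>sum_list (map f xs) - real n * expec p f\<bar>}"
  proof (intro Collect_cong)
    fix xs
    have "sum_list (map f xs) - real n * expec p f = real n * (sum_list (map f xs) / real n - expec p f)"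
      using n by (simp add: algebra_simps)
    then show "c < \<bar>sum_list (map f xs) / real n - expec p f\<bar> \<longleftrightarrow>
        real n * c < \<bar>sum_list (map f xs) - real n * expec p f\<bar>"
      using n by (simp add: abs_mult)
  qed
  also have "measure_pmf.prob (replicate_pmf n p) \<dots> \<le> (real n * v) / (real n * c)\<^sup>2"
  proof (rule chebyshev_second_moment)
    show "expec (replicate_pmf n p) (\<lambda>xs. (sum_list (map f xs) - real n * expec p f)\<^sup>2) \<le> real n * v"
      unfolding expec_replicate_variance[OF fin]
      using expec_variance_le_second_moment[OF fin, of f] v by (intro mult_left_mono) auto
  qed (use fin c n finite_set_replicate_pmf in auto)
  also have "\<dots> = v / (real n * c\<^sup>2)" using n by (simp add: power2_eq_square)
  finally show ?thesis .
qed

lemma replicate_pmf_Suc_map: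
  "replicate_pmf (Suc n) p = bind_pmf p (\<lambda>x. map_pmf (Cons x) (replicate_pmf n p))"
  by (simp add: map_pmf_def)

text \<open>Union bound over the \<open>n choose k\<close> sets of \<open>k\<close> positions, each
  of which is entirely bad with probability at most \<open>r ^ k\<close>. Pascal's rule carries it
  through the induction.\<close>

lemma emeasure_replicate_count_ge:
  assumes "emeasure (measure_pmf p) {x. B x} \<le> r"
  shows "emeasure (replicate_pmf n p) {xs. k \<le> length (filter B xs)} \<le> of_nat (n choose k) * r ^ k"
proof (induction n arbitrary: k)
  case 0
  then show ?case by (cases k) auto
next
  case (Suc n)
  show ?case
  proof (cases k)
    case 0
    then show ?thesis by (simp add: measure_pmf.emeasure_space_1[simplified])
  next
    case (Suc k')
    have "emeasure (replicate_pmf (Suc n) p) {xs. k \<le> length (filter B xs)}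
      = (\<integral>\<^sup>+x. emeasure (replicate_pmf n p) {xs. k \<le> length (filter B (x # xs))} \<partial>p)"
      by (simp only: replicate_pmf_Suc_map emeasure_bind_pmf emeasure_map_pmf vimage_def mem_Collect_eq)
    also have "\<dots> \<le> (\<integral>\<^sup>+x. indicator {x. B x} x * (of_nat (n choose k') * r ^ k') + of_nat (n choose k) * r ^ k \<partial>p)"
    proof (rule nn_integral_mono)
      fix x
      show "emeasure (replicate_pmf n p) {xs. k \<le> length (filter B (x # xs))}
        \<le> indicator {x. B x} x * (of_nat (n choose k') * r ^ k') + of_nat (n choose k) * r ^ k"
        using Suc.IH[of k] Suc.IH[of k'] Suc by (cases "B x") (auto intro: order_trans)
    qed
    also have "\<dots> = emeasure p {x. B x} * (of_nat (n choose k') * r ^ k') + of_nat (n choose k) * r ^ k"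
      by (simp add: nn_integral_add nn_integral_multc)
    also have "\<dots> \<le> r * (of_nat (n choose k') * r ^ k') + of_nat (n choose k) * r ^ k"
      by (intro add_right_mono mult_right_mono assms) auto
    also have "\<dots> = of_nat (Suc n choose k) * r ^ k" by (simp add: Suc algebra_simps)
    finally show ?thesis .
  qed
qed

text \<open>An exponential tail without moment generating functions: there are at most
  \<open>4 ^ s\<close> choices of the \<open>s\<close> bad positions.\<close>

lemma prob_replicate_half_le:
  assumes "measure_pmf.prob p {x. B x} \<le> r"
  shows "measure_pmf.prob (replicate_pmf (2 * s) p) {xs. s \<le> length (filter B xs)} \<le> (4 * r) ^ s"
proof -
  have r: "0 \<le> r" using assms measure_nonneg order_trans by blast
  have "emeasure (measure_pmf p) {x. B x} \<le> ennreal r"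
    using assms by (simp add: measure_pmf.emeasure_eq_measure ennreal_leI)
  from emeasure_replicate_count_ge[OF this, of "2 * s" s]
  have "ennreal (measure_pmf.prob (replicate_pmf (2 * s) p) {xs. s \<le> length (filter B xs)})
    \<le> ennreal (real (2 * s choose s) * r ^ s)"
    using r by (simp add: measure_pmf.emeasure_eq_measure ennreal_of_nat_eq_real_of_nat ennreal_power ennreal_mult)
  then have "measure_pmf.prob (replicate_pmf (2 * s) p) {xs. s \<le> length (filter B xs)}
    \<le> real (2 * s choose s) * r ^ s" using r by simp
  also have "\<dots> \<le> 4 ^ s * r ^ s"
  proof (rule mult_right_mono)
    have "2 * s choose s \<le> 4 ^ s" using binomial_le_pow2[of "2 * s" s] by (simp add: power_mult)
    then have "real (2 * s choose s) \<le> real (4 ^ s)" unfolding of_nat_le_iff .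
    then show "real (2 * s choose s) \<le> 4 ^ s" by simp
  qed (use r in simp)
  finally show ?thesis by (simp add: power_mult_distrib)
qed

lemma count_list_eq_sum_list: "real (count_list xs k) = sum_list (map (\<lambda>x. of_bool (x = k)) xs)"
  by (induction xs) auto

text \<open>The Cauchy-Schwarz inequality bounds the squared \<open>l1\<close> distance by
  \<open>card I\<close> times the sum of the squared errors. Each error has variance at most
  \<open>pmf p k / n\<close>; these add up to \<open>1 / n\<close>, and Markov's inequality
  finishes.\<close>

lemma empirical_l1_deviation:
  fixes p :: "nat pmf"
  assumes sup: "set_pmf p \<subseteq> I" and I: "finite I" and c: "0 < c" and n: "0 < n"
  shows "measure_pmf.prob (replicate_pmf n p)
    {xs. c < (\<Sum>k\<in>I. \<bar>real (count_list xs k) / real n - pmf p k\<bar>)} \<le> real (card I) / (real n * c\<^sup>2)"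
proof -
  have fin: "finite (set_pmf p)" using sup I finite_subset by blast
  have finr: "finite (set_pmf (replicate_pmf n p))" using fin by (rule finite_set_replicate_pmf)
  define d where "d k xs = real (count_list xs k) / real n - pmf p k" for k xs
  have p: "expec p (\<lambda>x. of_bool (x = k)) = pmf p k" for k
    using integral_measure_pmf[of "{k}" p "\<lambda>x. of_bool (x = k) :: real"] by simp
  have p2: "expec p (\<lambda>x. (of_bool (x = k))\<^sup>2) = pmf p k" for k
    unfolding p[of k, symmetric] by (rule expec_cong) (simp add: of_bool_def)
  have "expec (replicate_pmf n p) (\<lambda>xs. (d k xs)\<^sup>2) \<le> pmf p k / real n" for k
  proof -
    have "expec (replicate_pmf n p) (\<lambda>xs. (d k xs)\<^sup>2)
      = expec (replicate_pmf n p) (\<lambda>xs. (sum_list (map (\<lambda>x. of_bool (x = k)) xs) - real n * pmf p k)\<^sup>2 / (real n)\<^sup>2)"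
      using n by (intro expec_cong) (simp add: d_def count_list_eq_sum_list power_divide[symmetric] diff_divide_distrib)
    also have "\<dots> = real n * expec p (\<lambda>x. (of_bool (x = k) - pmf p k)\<^sup>2) / (real n)\<^sup>2"
      using expec_replicate_variance[OF fin, of n "\<lambda>x. of_bool (x = k)"] by (simp add: p)
    also have "\<dots> \<le> real n * pmf p k / (real n)\<^sup>2"
      using expec_variance_le_second_moment[OF fin, of "\<lambda>x. of_bool (x = k)"]
      by (intro divide_right_mono mult_left_mono) (auto simp: p p2)
    also have "\<dots> = pmf p k / real n" using n by (simp add: power2_eq_square)
    finally show ?thesis .
  qed
  then have sq: "(\<Sum>k\<in>I. expec (replicate_pmf n p) (\<lambda>xs. (d k xs)\<^sup>2)) \<le> (\<Sum>k\<in>I. pmf p k / real n)"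
    by (intro sum_mono) auto
  have "(\<Sum>k\<in>I. pmf p k) = 1" using sup I by (rule sum_pmf_eq_1[rotated])
  have "measure_pmf.prob (replicate_pmf n p) {xs. c < (\<Sum>k\<in>I. \<bar>d k xs\<bar>)}
    \<le> measure_pmf.prob (replicate_pmf n p) {xs. c\<^sup>2 \<le> real (card I) * (\<Sum>k\<in>I. (d k xs)\<^sup>2)}"
  proof (intro measure_pmf.finite_measure_mono subsetI; clarsimp)
    fix xs assume "c < (\<Sum>k\<in>I. \<bar>d k xs\<bar>)"
    then have "c\<^sup>2 \<le> (\<Sum>k\<in>I. \<bar>d k xs\<bar>)\<^sup>2" using c by (intro power_mono) auto
    also have "\<dots> \<le> (\<Sum>k\<in>I. \<bar>d k xs\<bar>\<^sup>2) * real (card I)"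
      by (rule sum_squared_le_sum_of_squares)
    finally show "c\<^sup>2 \<le> real (card I) * (\<Sum>k\<in>I. (d k xs)\<^sup>2)" by (simp add: mult.commute)
  qed
  also have "\<dots> \<le> expec (replicate_pmf n p) (\<lambda>xs. real (card I) * (\<Sum>k\<in>I. (d k xs)\<^sup>2)) / c\<^sup>2"
    using c by (intro prob_ge_le_expec_div finr) (auto intro!: mult_nonneg_nonneg sum_nonneg)
  also have "expec (replicate_pmf n p) (\<lambda>xs. real (card I) * (\<Sum>k\<in>I. (d k xs)\<^sup>2))
    = real (card I) * (\<Sum>k\<in>I. expec (replicate_pmf n p) (\<lambda>xs. (d k xs)\<^sup>2))"
    using integrable_finite_pmf[OF finr] by simp
  also have "\<dots> / c\<^sup>2 \<le> real (card I) * (1 / real n) / c\<^sup>2"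
    using sq \<open>(\<Sum>k\<in>I. pmf p k) = 1\<close>
    by (intro divide_right_mono mult_left_mono) (auto simp: sum_divide_distrib[symmetric])
  finally show ?thesis by (simp add: d_def)
qed

section \<open>Random subsets of given density\<close>

primrec random_subset :: "real \<Rightarrow> nat \<Rightarrow> nat set pmf" where
  "random_subset \<rho> 0 = return_pmf {}"
| "random_subset \<rho> (Suc n) = bind_pmf (bernoulli_pmf \<rho>)
     (\<lambda>b. map_pmf (\<lambda>A. if b then insert (Suc n) A else A) (random_subset \<rho> n))"

lemma set_random_subset: "set_pmf (random_subset \<rho> n) \<subseteq> Pow {1..n}"
proof (induction n)
  case (Suc n)
  then have "A \<subseteq> {1..Suc n}" if "A \<in> set_pmf (random_subset \<rho> n)" for A
    using that by force
  then show ?case by (auto split: if_splits)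
qed simp

lemma finite_set_random_subset: "finite (set_pmf (random_subset \<rho> n))"
  by (rule finite_subset[OF set_random_subset]) simp

lemma expec_random_subset_Suc:
  assumes "0 \<le> \<rho>" "\<rho> \<le> 1"
  shows "expec (random_subset \<rho> (Suc n)) F =
    \<rho> * expec (random_subset \<rho> n) (\<lambda>A. F (insert (Suc n) A)) + (1 - \<rho>) * expec (random_subset \<rho> n) F"
  using assms finite_set_random_subset[of \<rho> n]
  by (simp add: expec_bind)

lemma expec_random_subset_sum:
  assumes \<rho>: "0 \<le> \<rho>" "\<rho> \<le> 1"
  shows "expec (random_subset \<rho> n) (\<lambda>A. sum g A) = \<rho> * sum g {1..n}"
proof (induction n)
  case (Suc n)
  note int = integrable_finite_pmf[OF finite_set_random_subset]
  have "expec (random_subset \<rho> n) (\<lambda>A. sum g (insert (Suc n) A))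
    = expec (random_subset \<rho> n) (\<lambda>A. g (Suc n) + sum g A)"
  proof (rule expec_cong)
    fix A assume "A \<in> set_pmf (random_subset \<rho> n)"
    then have "A \<subseteq> {1..n}" using set_random_subset by blast
    then have "finite A" "Suc n \<notin> A" by (auto intro: finite_subset)
    then show "sum g (insert (Suc n) A) = g (Suc n) + sum g A" by simp
  qed
  then show ?case using Suc \<rho> int[of \<rho> n]
    by (simp add: expec_random_subset_Suc algebra_simps del: random_subset.simps)
qed simp

text \<open>The variance of the sum is \<open>\<rho> * (1 - \<rho>)\<close> times the sum of
  squares; the induction gives away the factor \<open>1 - \<rho>\<close>.\<close>

lemma expec_random_subset_sum_square:
  assumes \<rho>: "0 \<le> \<rho>" "\<rho> \<le> 1"
  shows "expec (random_subset \<rho> n) (\<lambda>A. (sum g A)\<^sup>2)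
    \<le> (\<rho> * sum g {1..n})\<^sup>2 + \<rho> * (\<Sum>y\<in>{1..n}. (g y)\<^sup>2)"
proof (induction n)
  case (Suc n)
  note int = integrable_finite_pmf[OF finite_set_random_subset]
  have "expec (random_subset \<rho> n) (\<lambda>A. (sum g (insert (Suc n) A))\<^sup>2)
    = expec (random_subset \<rho> n) (\<lambda>A. (g (Suc n))\<^sup>2 + 2 * g (Suc n) * sum g A + (sum g A)\<^sup>2)"
  proof (rule expec_cong)
    fix A assume "A \<in> set_pmf (random_subset \<rho> n)"
    then have "A \<subseteq> {1..n}" using set_random_subset by blast
    then have "finite A" "Suc n \<notin> A" by (auto intro: finite_subset)
    then show "(sum g (insert (Suc n) A))\<^sup>2 = (g (Suc n))\<^sup>2 + 2 * g (Suc n) * sum g A + (sum g A)\<^sup>2"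
      by (simp add: power2_eq_square algebra_simps)
  qed
  also have "\<dots> = (g (Suc n))\<^sup>2 + 2 * g (Suc n) * (\<rho> * sum g {1..n})
      + expec (random_subset \<rho> n) (\<lambda>A. (sum g A)\<^sup>2)"
    using int[of \<rho> n] by (simp add: expec_random_subset_sum[OF \<rho>])
  finally have "expec (random_subset \<rho> (Suc n)) (\<lambda>A. (sum g A)\<^sup>2)
    = \<rho> * (g (Suc n))\<^sup>2 + 2 * (\<rho> * g (Suc n)) * (\<rho> * sum g {1..n}) + expec (random_subset \<rho> n) (\<lambda>A. (sum g A)\<^sup>2)"
    by (simp add: expec_random_subset_Suc[OF \<rho>] algebra_simps del: random_subset.simps)
  also have "\<dots> \<le> (\<rho> * g (Suc n))\<^sup>2 + \<rho> * (g (Suc n))\<^sup>2 + 2 * (\<rho> * g (Suc n)) * (\<rho> * sum g {1..n})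
    + ((\<rho> * sum g {1..n})\<^sup>2 + \<rho> * (\<Sum>y\<in>{1..n}. (g y)\<^sup>2))"
    using Suc zero_le_power2[of "\<rho> * g (Suc n)"] by linarith
  also have "\<dots> = (\<rho> * sum g {1..Suc n})\<^sup>2 + \<rho> * (\<Sum>y\<in>{1..Suc n}. (g y)\<^sup>2)"
    by (simp add: power2_eq_square algebra_simps)
  finally show ?case .
qed simp

primrec random_subset_alg :: "real \<Rightarrow> nat \<Rightarrow> nat set cond_alg" where
  "random_subset_alg \<rho> 0 = Output {}"
| "random_subset_alg \<rho> (Suc n) = Toss (map_pmf of_bool (bernoulli_pmf \<rho>))
     (\<lambda>i. bind_alg (random_subset_alg \<rho> n) (\<lambda>A. Output (if i = 1 then insert (Suc n) A else A)))"

lemma run_random_subset_alg: "run orc (random_subset_alg \<rho> n) = random_subset \<rho> n"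
proof (induction n)
  case (Suc n)
  have "of_bool b = Suc 0 \<longleftrightarrow> b" for b by simp
  with Suc show ?case by (simp add: run_bind_alg map_pmf_def bind_assoc_pmf bind_return_pmf)
qed simp

lemma queries_within_random_subset_alg: "queries_within \<Omega> (random_subset_alg \<rho> n)"
  by (induction n) (auto intro: queries_within_bind_alg)

lemma queries_at_most_random_subset_alg: "queries_at_most (random_subset_alg \<rho> n) 0"
proof (induction n)
  case (Suc n)
  then show ?case by (auto intro!: queries_at_most_bind_alg[where n = 0 and k = 0, simplified])
qed simp

lemma expected_queries_random_subset_alg: "expected_queries orc (random_subset_alg \<rho> n) = 0"
  by (induction n) (auto simp: expected_queries_bind_alg)

section \<open>Estimators for the mass of an element\<close>

definition step_alg :: "nat \<Rightarrow> nat \<Rightarrow> nat set \<Rightarrow> nat cond_alg" where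
  "step_alg N x A = Query (insert x (A \<inter> {1..N})) (\<lambda>y. if y = x then Output 0
     else Query {x, y} (\<lambda>z. Output (if z = x then 1 else 2)))"

text \<open>
  Outcome \<open>0\<close> of a step ends the sampling, \<open>1\<close> is counted, and \<open>2\<close> is ignored. The fuel \<open>f\<close> only makes
  the loop finite and is later taken to be huge. The number of queries is bounded by truncation at a
  multiple of their expected number.
\<close>

primrec odds_alg :: "nat \<Rightarrow> nat \<Rightarrow> nat set \<Rightarrow> nat \<Rightarrow> nat cond_alg" where
  "odds_alg N x A 0 = Output 0"
| "odds_alg N x A (Suc f) = bind_alg (step_alg N x A) (\<lambda>o'. if o' = 0 then Output 0
     else bind_alg (odds_alg N x A f) (\<lambda>k. Output (if o' = 1 then Suc k else k)))"

text \<open>The answer \<open>x\<close> ends the sampling and is never counted, so the summand 1 of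
  \<open>x\<close> in \<open>G\<close> is added by hand whenever \<open>x\<close> lies in the random
  set.\<close>

definition ratio_alg :: "nat \<Rightarrow> nat \<Rightarrow> real \<Rightarrow> nat \<Rightarrow> nat cond_alg" where
  "ratio_alg N x \<rho> f = bind_alg (random_subset_alg \<rho> N)
     (\<lambda>A. bind_alg (odds_alg N x A f) (\<lambda>k. Output (k + of_bool (x \<in> A))))"

text \<open>If the sample is \<open>x\<close> itself, the second query set is \<open>{x}\<close> and
  \<open>x\<close> wins, in accordance with the summand 1 of \<open>x\<close> in
  \<open>G\<close>.\<close>

definition light_alg :: "nat \<Rightarrow> nat \<Rightarrow> nat cond_alg" where
  "light_alg N x = Query {1..N} (\<lambda>y. Query {x, y} (\<lambda>z. Output (of_bool (z = x))))"

text \<open>\<open>True\<close> suggests that a set of density \<open>\<rho>\<close> is too light to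
  compete with \<open>x\<close>.\<close>

definition probe_alg :: "nat \<Rightarrow> nat \<Rightarrow> real \<Rightarrow> bool cond_alg" where
  "probe_alg N x \<rho> = bind_alg (random_subset_alg \<rho> N)
     (\<lambda>A. Query (insert x (A \<inter> {1..N})) (\<lambda>y. Output (y = x)))"

lemma queries_within_step_alg: "x \<in> {1..N} \<Longrightarrow> queries_within {1..N} (step_alg N x A)"
  by (auto simp: step_alg_def)

lemma queries_within_odds_alg: "x \<in> {1..N} \<Longrightarrow> queries_within {1..N} (odds_alg N x A f)"
  by (induction f)
    (auto intro!: queries_within_bind_alg queries_within_step_alg simp del: One_nat_def)

lemma queries_within_ratio_alg: "x \<in> {1..N} \<Longrightarrow> queries_within {1..N} (ratio_alg N x \<rho> f)"
  unfolding ratio_alg_def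
  by (intro queries_within_bind_alg queries_within_odds_alg queries_within_random_subset_alg) auto

lemma queries_within_light_alg: "x \<in> {1..N} \<Longrightarrow> queries_within {1..N} (light_alg N x)"
  by (auto simp: light_alg_def)

lemma queries_within_probe_alg: "x \<in> {1..N} \<Longrightarrow> queries_within {1..N} (probe_alg N x \<rho>)"
  unfolding probe_alg_def
  by (intro queries_within_bind_alg queries_within_random_subset_alg) auto

lemma queries_at_most_probe_alg: "queries_at_most (probe_alg N x \<rho>) 1"
  unfolding probe_alg_def
  by (rule queries_at_most_bind_alg[where n = 0 and k = 1, unfolded add_0])
    (auto intro: queries_at_most_random_subset_alg)

section \<open>Means, second moments and costs of the estimators for a fixed element\<close>

lemma expec_finite_support:
  fixes h :: "'a \<Rightarrow> real"
  assumes "finite A" "set_pmf p \<subseteq> A" shows "expec p h = (\<Sum>a\<in>A. pmf p a * h a)"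
  using assms by (subst integral_measure_pmf[of A]) auto

text \<open>With \<open>x\<close> in the support, every query set that contains \<open>x\<close> has
  positive mass, so the unspecified behaviour of the oracle on null sets cannot interfere with the
  estimators.\<close>

locale cond_sampling =
  fixes N :: nat and \<mu> :: "nat pmf" and orc :: "nat set \<Rightarrow> nat pmf" and x :: nat
  assumes supp: "set_pmf \<mu> \<subseteq> {1..N}" and orc: "cond_oracle {1..N} \<mu> orc" and x: "x \<in> set_pmf \<mu>"
begin

abbreviation (input) mass :: "nat set \<Rightarrow> real" where "mass A \<equiv> sum (pmf \<mu>) A"

lemma x_in: "x \<in> {1..N}" using supp x by blast

lemma px: "0 < pmf \<mu> x" using x by (simp add: pmf_positive)

lemma mass_Omega: "mass {1..N} = 1"
  using supp by (intro sum_pmf_eq_1) auto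

lemma orc_eq: "B \<subseteq> {1..N} \<Longrightarrow> x \<in> B \<Longrightarrow> orc B = cond_pmf \<mu> B"
  using orc x unfolding cond_oracle_def by blast

lemma mass_pos: "B \<subseteq> {1..N} \<Longrightarrow> x \<in> B \<Longrightarrow> 0 < mass B"
proof -
  assume "B \<subseteq> {1..N}" "x \<in> B"
  then have "pmf \<mu> x \<le> mass B" by (intro member_le_sum) (auto intro: finite_subset)
  then show ?thesis using px by simp
qed

lemma mass_le_1: "B \<subseteq> {1..N} \<Longrightarrow> mass B \<le> 1"
  using sum_mono2[of "{1..N}" B "pmf \<mu>"] mass_Omega by simp

lemma expec_orc:
  assumes B: "B \<subseteq> {1..N}" "x \<in> B"
  shows "expec (orc B) h = (\<Sum>y\<in>B. pmf \<mu> y * h y) / mass B"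
proof -
  have fin: "finite B" using B finite_subset by blast
  have ne: "set_pmf \<mu> \<inter> B \<noteq> {}" using B x by blast
  have "expec (cond_pmf \<mu> B) h = (\<Sum>y\<in>B. pmf (cond_pmf \<mu> B) y * h y)"
    using fin by (intro expec_finite_support) (auto simp: set_cond_pmf[OF ne])
  also have "\<dots> = (\<Sum>y\<in>B. pmf \<mu> y * h y / mass B)"
    using fin by (intro sum.cong) (auto simp: pmf_cond[OF ne] measure_measure_pmf_finite)
  finally show ?thesis using orc_eq[OF B] by (simp add: sum_divide_distrib)
qed

lemma finite_orc: "B \<subseteq> {1..N} \<Longrightarrow> B \<noteq> {} \<Longrightarrow> finite (set_pmf (orc B))"
  using orc unfolding cond_oracle_def by (meson finite_atLeastAtMost finite_subset)

text \<open>For \<open>y \<noteq> x\<close> this is the probability that \<open>y\<close> wins a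
  query to \<open>{x, y}\<close>. Values stay between 0 and 1 however heavy \<open>y\<close> is, so
  squares are dominated by first powers.\<close>

definition g :: "nat \<Rightarrow> real" where
  "g y = (if y = x then 1 else pmf \<mu> y / (pmf \<mu> x + pmf \<mu> y))"

lemma g_bounds: "0 \<le> g y" "g y \<le> 1"
  using px by (auto simp: g_def intro!: quotient_le_one)

lemma g_le: "pmf \<mu> x * g y \<le> pmf \<mu> y"
proof (cases "y = x")
  case False
  have "pmf \<mu> x * pmf \<mu> y \<le> pmf \<mu> y * (pmf \<mu> x + pmf \<mu> y)" by (simp add: algebra_simps)
  then show ?thesis using False px pmf_nonneg[of \<mu> y]
    by (simp add: g_def pos_divide_le_eq add_pos_nonneg)
qed (simp add: g_def)

abbreviation G :: real where "G \<equiv> sum g {1..N}"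

lemma G_ge_1: "1 \<le> G"
  using member_le_sum[of x "{1..N}" g] x_in g_bounds by (simp add: g_def)

lemma M_le_1: "pmf \<mu> x * G \<le> 1"
proof -
  have "pmf \<mu> x * G \<le> mass {1..N}" unfolding sum_distrib_left by (intro sum_mono g_le)
  then show ?thesis using mass_Omega by simp
qed

definition B :: "nat set \<Rightarrow> nat set" where "B A = insert x (A \<inter> {1..N})"

lemma B: "B A \<subseteq> {1..N}" "x \<in> B A" "B A \<noteq> {}" "finite (B A)"
  using x_in by (auto simp: B_def)

text \<open>The odds of outcome \<open>1\<close> against outcome \<open>0\<close> in one round of
  \<open>step_alg\<close>, hence the mean count before the stop.\<close>

definition od :: "nat set \<Rightarrow> real" where "od A = sum g (B A - {x})"

definition q :: "nat set \<Rightarrow> real" where "q A = pmf \<mu> x / mass (B A)"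

lemma od_nonneg: "0 \<le> od A" by (simp add: od_def sum_nonneg g_bounds)

lemma q_bounds: "pmf \<mu> x \<le> q A" "0 < q A" "q A \<le> 1"
proof -
  have m: "0 < mass (B A)" "mass (B A) \<le> 1" using mass_pos mass_le_1 B by auto
  then show "pmf \<mu> x \<le> q A" using px by (simp add: q_def pos_le_divide_eq mult_left_le)
  then show "0 < q A" using px by simp
  have "pmf \<mu> x \<le> mass (B A)" using B by (intro member_le_sum) auto
  then show "q A \<le> 1" using m by (simp add: q_def)
qed

lemma od_of_bool: "A \<subseteq> {1..N} \<Longrightarrow> od A + of_bool (x \<in> A) = sum g A"
proof -
  assume A: "A \<subseteq> {1..N}"
  then have fin: "finite A" by (rule finite_subset) simp
  have "B A - {x} = A - {x}" using A by (auto simp: B_def)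
  moreover have "g x = 1" by (simp add: g_def)
  ultimately show ?thesis using sum.remove[OF fin, of x g] by (cases "x \<in> A") (simp_all add: od_def)
qed

lemma pair_expec:
  assumes "y \<in> {1..N}" "y \<noteq> x"
  shows "expec (orc {x, y}) h = (pmf \<mu> x * h x + pmf \<mu> y * h y) / (pmf \<mu> x + pmf \<mu> y)"
  using assms x_in expec_orc[of "{x, y}" h] by simp

text \<open>A given \<open>y\<close> is drawn and then counted with probability
  \<open>pmf \<mu> y * pmf \<mu> x / (pmf \<mu> x + pmf \<mu> y)\<close> divided by the mass of
  \<open>B A\<close>, which is \<open>q A * g y\<close>. Stopping has probability
  \<open>q A\<close>, so the unknown mass of the set cancels in the odds.\<close>

lemma expec_step:
  "expec (run orc (step_alg N x A)) h = q A * (h 0 + od A * h 1)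
     + (\<Sum>y\<in>B A - {x}. pmf \<mu> y * (1 - pmf \<mu> x / (pmf \<mu> x + pmf \<mu> y))) / mass (B A) * h 2"
proof -
  have "expec (run orc (step_alg N x A)) h
    = expec (orc (B A)) (\<lambda>y. if y = x then h 0 else
        (pmf \<mu> x * h 1 + pmf \<mu> y * h 2) / (pmf \<mu> x + pmf \<mu> y))"
  proof -
    have "expec (run orc (step_alg N x A)) h = expec (orc (B A)) (\<lambda>y.
      expec (run orc (if y = x then Output 0 else Query {x, y} (\<lambda>z. Output (if z = x then 1 else 2)))) h)"
      unfolding step_alg_def B_def[symmetric] run.simps
    proof (rule expec_bind)
      show "finite (set_pmf (orc (B A)))" using B finite_orc by blast
      fix y assume "y \<in> set_pmf (orc (B A))"
      then have "y \<in> {1..N}" using B orc unfolding cond_oracle_def by blast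
      then show "finite (set_pmf (run orc (if y = x then Output 0 else
          Query {x, y} (\<lambda>z. Output (if z = x then 1 else 2)))))"
        using finite_orc[of "{x, y}"] x_in by auto
    qed
    also have "\<dots> = expec (orc (B A)) (\<lambda>y. if y = x then h 0 else
        (pmf \<mu> x * h 1 + pmf \<mu> y * h 2) / (pmf \<mu> x + pmf \<mu> y))"
    proof (rule expec_cong)
      fix y assume "y \<in> set_pmf (orc (B A))"
      then have y: "y \<in> {1..N}" using B orc unfolding cond_oracle_def by blast
      show "expec (run orc (if y = x then Output 0 else Query {x, y} (\<lambda>z. Output (if z = x then 1 else 2)))) h
        = (if y = x then h 0 else (pmf \<mu> x * h 1 + pmf \<mu> y * h 2) / (pmf \<mu> x + pmf \<mu> y))"
        using pair_expec[OF y, of "\<lambda>z. h (if z = x then 1 else 2)"] y x_in finite_orc[of "{x, y}"]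
        by (auto simp: expec_bind)
    qed
    finally show ?thesis .
  qed
  also have "\<dots> = (pmf \<mu> x * h 0 + (\<Sum>y\<in>B A - {x}. pmf \<mu> y *
      ((pmf \<mu> x * h 1 + pmf \<mu> y * h 2) / (pmf \<mu> x + pmf \<mu> y)))) / mass (B A)"
    unfolding expec_orc[OF B(1,2)] using B by (subst sum.remove[of "B A" x]) auto
  also have "(\<Sum>y\<in>B A - {x}. pmf \<mu> y * ((pmf \<mu> x * h 1 + pmf \<mu> y * h 2) / (pmf \<mu> x + pmf \<mu> y)))
    = (\<Sum>y\<in>B A - {x}. pmf \<mu> x * (g y * h 1)
        + pmf \<mu> y * (1 - pmf \<mu> x / (pmf \<mu> x + pmf \<mu> y)) * h 2)"
  proof (rule sum.cong[OF refl])
    fix y assume y: "y \<in> B A - {x}"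
    have p: "0 < pmf \<mu> x + pmf \<mu> y" using px pmf_nonneg[of \<mu> y] by linarith
    then have "1 - pmf \<mu> x / (pmf \<mu> x + pmf \<mu> y) = pmf \<mu> y / (pmf \<mu> x + pmf \<mu> y)"
      by (simp add: field_simps)
    then show "pmf \<mu> y * ((pmf \<mu> x * h 1 + pmf \<mu> y * h 2) / (pmf \<mu> x + pmf \<mu> y))
      = pmf \<mu> x * (g y * h 1) + pmf \<mu> y * (1 - pmf \<mu> x / (pmf \<mu> x + pmf \<mu> y)) * h 2"
      using y by (simp add: g_def add_divide_distrib distrib_left mult.commute mult.left_commute)
  qed
  also have "\<dots> = pmf \<mu> x * (od A * h 1)
     + (\<Sum>y\<in>B A - {x}. pmf \<mu> y * (1 - pmf \<mu> x / (pmf \<mu> x + pmf \<mu> y))) * h 2"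
    by (simp add: sum.distrib od_def sum_distrib_left sum_distrib_right)
  finally show ?thesis
    by (simp add: q_def add_divide_distrib distrib_left)
qed

lemma expec_step_eq:
  "expec (run orc (step_alg N x A)) h = q A * h 0 + q A * od A * h 1 + (1 - q A - q A * od A) * h 2"
proof -
  \<comment> \<open>The coefficient of \<open>h 2\<close> need not be computed: the constant
    function 1 shows that the three coefficients add up to 1.\<close>
  have "1 = q A * (1 + od A)
     + (\<Sum>y\<in>B A - {x}. pmf \<mu> y * (1 - pmf \<mu> x / (pmf \<mu> x + pmf \<mu> y))) / mass (B A)"
    using expec_step[of A "\<lambda>_. 1"] by simp
  then have eq: "(\<Sum>y\<in>B A - {x}. pmf \<mu> y * (1 - pmf \<mu> x / (pmf \<mu> x + pmf \<mu> y))) / mass (B A)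
    = 1 - q A - q A * od A" by (simp add: distrib_left)
  show ?thesis unfolding expec_step eq by (simp add: algebra_simps)
qed

lemma finite_step: "finite (set_pmf (run orc (step_alg N x A)))"
proof (rule finite_subset)
  show "set_pmf (run orc (step_alg N x A)) \<subseteq> {0, 1, 2}"
    by (auto simp: step_alg_def split: if_splits)
qed simp

lemma finite_odds: "finite (set_pmf (run orc (odds_alg N x A f)))"
  by (induction f) (auto simp: run_bind_alg finite_step)

lemma expec_odds_Suc:
  "expec (run orc (odds_alg N x A (Suc f))) h = q A * h 0
     + q A * od A * expec (run orc (odds_alg N x A f)) (\<lambda>k. h (Suc k))
     + (1 - q A - q A * od A) * expec (run orc (odds_alg N x A f)) h"
proof -
  have "expec (run orc (odds_alg N x A (Suc f))) h
    = expec (run orc (step_alg N x A)) (\<lambda>o'. expec (run orc (if o' = 0 then Output 0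
     else bind_alg (odds_alg N x A f) (\<lambda>k. Output (if o' = 1 then Suc k else k)))) h)"
    unfolding odds_alg.simps run_bind_alg
    by (rule expec_bind) (auto simp: finite_step finite_odds run_bind_alg)
  also have "\<dots> = q A * h 0
     + q A * od A * expec (run orc (odds_alg N x A f)) (\<lambda>k. h (Suc k))
     + (1 - q A - q A * od A) * expec (run orc (odds_alg N x A f)) h"
    by (simp add: expec_step_eq run_bind_alg expec_bind finite_odds)
  finally show ?thesis .
qed

text \<open>Each unit of fuel contracts the distance to the fixed point \<open>od A\<close> of the
  recursion by the factor \<open>1 - q A\<close>.\<close>

lemma expec_odds:
  "expec (run orc (odds_alg N x A f)) real = od A * (1 - (1 - q A) ^ f)"
proof (induction f)
  case (Suc f)
  have eq: "expec (run orc (odds_alg N x A f)) (\<lambda>k. real (Suc k))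
    = 1 + expec (run orc (odds_alg N x A f)) real"
    using integrable_finite_pmf[OF finite_odds] by simp
  show ?case unfolding expec_odds_Suc eq Suc by (simp add: algebra_simps)
qed simp

text \<open>Without the fuel limit the count is geometric with mean \<open>od A\<close>, and its
  second moment is the right-hand side. This value is a fixed point of the recursion, so it persists
  as an upper bound.\<close>

lemma expec_odds_square:
  "expec (run orc (odds_alg N x A f)) (\<lambda>k. (real k)\<^sup>2) \<le> od A + 2 * (od A)\<^sup>2"
proof (induction f)
  case 0
  then show ?case using od_nonneg[of A] by simp
next
  case (Suc f)
  let ?p = "run orc (odds_alg N x A f)"
  let ?E = "expec ?p (\<lambda>k. (real k)\<^sup>2)"
  have "expec ?p real \<le> od A * 1"
    unfolding expec_odds using q_bounds[of A] od_nonneg[of A] by (intro mult_left_mono) auto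
  then have E1: "q A * od A * (2 * expec ?p real) \<le> q A * od A * (2 * od A)"
    using q_bounds[of A] od_nonneg[of A] by (intro mult_left_mono) auto
  have "(\<lambda>k. (real (Suc k))\<^sup>2) = (\<lambda>k. 1 + 2 * real k + (real k)\<^sup>2)"
    by (auto simp: power2_eq_square algebra_simps)
  then have "expec ?p (\<lambda>k. (real (Suc k))\<^sup>2) = 1 + 2 * expec ?p real + ?E"
    using integrable_finite_pmf[OF finite_odds, of A f] by simp
  then have "expec (run orc (odds_alg N x A (Suc f))) (\<lambda>k. (real k)\<^sup>2)
    = q A * od A * (1 + 2 * expec ?p real) + (1 - q A) * ?E"
    by (simp add: expec_odds_Suc algebra_simps del: odds_alg.simps of_nat_Suc)
  also have "\<dots> \<le> q A * od A * (1 + 2 * od A) + (1 - q A) * (od A + 2 * (od A)\<^sup>2)"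
  proof (rule add_mono)
    show "q A * od A * (1 + 2 * expec ?p real) \<le> q A * od A * (1 + 2 * od A)"
      using E1 unfolding distrib_left by (rule add_left_mono)
    show "(1 - q A) * ?E \<le> (1 - q A) * (od A + 2 * (od A)\<^sup>2)"
      using Suc q_bounds[of A] by (intro mult_left_mono) auto
  qed
  also have "\<dots> = od A + 2 * (od A)\<^sup>2" by (simp add: power2_eq_square algebra_simps)
  finally show ?case .
qed

text \<open>A round makes at most two queries and is the last one with probability
  \<open>q A\<close>; \<open>2 / q A\<close> solves \<open>c = 2 + (1 - q A) * c\<close>.\<close>

lemma expected_queries_odds: "expected_queries orc (odds_alg N x A f) \<le> ennreal (2 / q A)"
proof (induction f)
  case (Suc f)
  let ?c = "expected_queries orc (odds_alg N x A f)"
  let ?p = "run orc (step_alg N x A)"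
  have "expected_queries orc (step_alg N x A) \<le> 1 + (\<integral>\<^sup>+y. 1 \<partial>orc (insert x (A \<inter> {1..N})))"
    unfolding step_alg_def expected_queries.simps by (intro add_left_mono nn_integral_mono) auto
  then have 1: "expected_queries orc (step_alg N x A) \<le> ennreal 2" by simp
  have "(\<integral>\<^sup>+o'. expected_queries orc (if o' = 0 then Output 0
     else bind_alg (odds_alg N x A f) (\<lambda>k. Output (if o' = 1 then Suc k else k))) \<partial>?p)
    \<le> (\<integral>\<^sup>+o'. ennreal (of_bool (o' \<noteq> 0) * (2 / q A)) \<partial>?p)"
    using Suc by (intro nn_integral_mono) (auto simp: expected_queries_bind_alg)
  also have "\<dots> = ennreal (expec ?p (\<lambda>o'. of_bool (o' \<noteq> 0) * (2 / q A)))"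
    using q_bounds[of A] by (intro nn_integral_eq_integral integrable_finite_pmf finite_step) auto
  also have "\<dots> = ennreal ((1 - q A) * (2 / q A))" by (simp add: expec_step_eq algebra_simps)
  finally have "expected_queries orc (odds_alg N x A (Suc f)) \<le> ennreal 2 + ennreal ((1 - q A) * (2 / q A))"
    using 1 by (auto simp: expected_queries_bind_alg intro!: add_mono)
  also have "\<dots> = ennreal (2 / q A)"
    using q_bounds[of A] by (subst ennreal_plus[symmetric]) (auto simp: field_simps)
  finally show ?case .
qed simp

lemma finite_ratio: "finite (set_pmf (run orc (ratio_alg N x \<rho> f)))"
  by (auto simp: ratio_alg_def run_bind_alg run_random_subset_alg finite_set_random_subset finite_odds)

lemma expec_ratio:
  "expec (run orc (ratio_alg N x \<rho> f)) h = expec (random_subset \<rho> N)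
     (\<lambda>A. expec (run orc (odds_alg N x A f)) (\<lambda>k. h (k + of_bool (x \<in> A))))"
  unfolding ratio_alg_def run_bind_alg run_random_subset_alg
  by (simp add: expec_bind finite_set_random_subset finite_odds)

context
  fixes \<rho> :: real assumes \<rho>: "0 < \<rho>" "\<rho> \<le> 1"
begin

lemma subset_sum_moments:
  "expec (random_subset \<rho> N) (sum g) = \<rho> * G"
  "expec (random_subset \<rho> N) (\<lambda>A. (sum g A)\<^sup>2) \<le> (\<rho> * G)\<^sup>2 + \<rho> * G"
proof -
  show "expec (random_subset \<rho> N) (sum g) = \<rho> * G"
    using expec_random_subset_sum[of \<rho> N g] \<rho> by simp
  have "(g y)\<^sup>2 \<le> g y" for y
    using mult_left_le[of "g y" "g y"] g_bounds[of y] by (simp add: power2_eq_square)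
  then have "\<rho> * (\<Sum>y\<in>{1..N}. (g y)\<^sup>2) \<le> \<rho> * G"
    using \<rho> by (intro mult_left_mono sum_mono) auto
  then show "expec (random_subset \<rho> N) (\<lambda>A. (sum g A)\<^sup>2) \<le> (\<rho> * G)\<^sup>2 + \<rho> * G"
    using expec_random_subset_sum_square[of \<rho> N g] \<rho> by linarith
qed

lemma random_subset_within: "A \<in> set_pmf (random_subset \<rho> N) \<Longrightarrow> A \<subseteq> {1..N}"
  using set_random_subset by blast

text \<open>Every round stops with probability at least \<open>pmf \<mu> x\<close>, whatever
  \<open>A\<close> is, so the loss due to the fuel is uniform in \<open>A\<close>. Apart from this
  loss the conditional mean is \<open>sum g A\<close>.\<close>

lemma expec_ratio_mean:
  "expec (run orc (ratio_alg N x \<rho> f)) real \<le> \<rho> * G"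
  "(1 - (1 - pmf \<mu> x) ^ f) * (\<rho> * G) \<le> expec (run orc (ratio_alg N x \<rho> f)) real"
proof -
  have eq: "expec (run orc (odds_alg N x A f)) (\<lambda>k. real (k + of_bool (x \<in> A)))
    = od A * (1 - (1 - q A) ^ f) + of_bool (x \<in> A)" for A
    using integrable_finite_pmf[OF finite_odds, of A f] by (simp add: expec_odds)
  show "expec (run orc (ratio_alg N x \<rho> f)) real \<le> \<rho> * G"
    unfolding expec_ratio eq subset_sum_moments(1)[symmetric]
  proof (rule expec_mono[OF finite_set_random_subset])
    fix A assume "A \<in> set_pmf (random_subset \<rho> N)"
    then have A: "A \<subseteq> {1..N}" by (rule random_subset_within)
    have "od A * (1 - (1 - q A) ^ f) \<le> od A * 1"
      using q_bounds[of A] od_nonneg[of A] by (intro mult_left_mono) auto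
    then show "od A * (1 - (1 - q A) ^ f) + of_bool (x \<in> A) \<le> sum g A"
      using od_of_bool[OF A] by simp
  qed
  have "(1 - (1 - pmf \<mu> x) ^ f) * (\<rho> * G)
    = expec (random_subset \<rho> N) (\<lambda>A. (1 - (1 - pmf \<mu> x) ^ f) * sum g A)"
    by (simp add: subset_sum_moments(1))
  also have "\<dots> \<le> expec (run orc (ratio_alg N x \<rho> f)) real"
    unfolding expec_ratio eq
  proof (rule expec_mono[OF finite_set_random_subset])
    fix A assume "A \<in> set_pmf (random_subset \<rho> N)"
    then have A: "A \<subseteq> {1..N}" by (rule random_subset_within)
    have "(1 - (1 - pmf \<mu> x) ^ f) * od A \<le> (1 - (1 - q A) ^ f) * od A"
      using q_bounds[of A] od_nonneg[of A] by (intro mult_right_mono diff_left_mono power_mono) auto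
    moreover have "(1 - (1 - pmf \<mu> x) ^ f) * of_bool (x \<in> A) \<le> 1 * of_bool (x \<in> A)"
      using pmf_le_1[of \<mu> x] by (intro mult_right_mono) auto
    ultimately show "(1 - (1 - pmf \<mu> x) ^ f) * sum g A \<le> od A * (1 - (1 - q A) ^ f) + of_bool (x \<in> A)"
      unfolding od_of_bool[OF A, symmetric] by (simp add: distrib_left mult.commute)
  qed
  finally show "(1 - (1 - pmf \<mu> x) ^ f) * (\<rho> * G) \<le> expec (run orc (ratio_alg N x \<rho> f)) real" .
qed

text \<open>Given \<open>A\<close>, the second moment is at most \<open>s + 2 * s\<^sup>2\<close>
  with \<open>s = sum g A\<close>. The coefficient 3 collects one \<open>\<rho> * G\<close> from the
  mean of \<open>s\<close> and two from its variance.\<close>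

lemma expec_ratio_square:
  "expec (run orc (ratio_alg N x \<rho> f)) (\<lambda>k. (real k)\<^sup>2) \<le> 3 * (\<rho> * G) + 2 * (\<rho> * G)\<^sup>2"
proof -
  have "expec (run orc (ratio_alg N x \<rho> f)) (\<lambda>k. (real k)\<^sup>2)
    \<le> expec (random_subset \<rho> N) (\<lambda>A. sum g A + 2 * (sum g A)\<^sup>2)"
    unfolding expec_ratio
  proof (rule expec_mono[OF finite_set_random_subset])
    fix A assume "A \<in> set_pmf (random_subset \<rho> N)"
    then have A: "A \<subseteq> {1..N}" by (rule random_subset_within)
    let ?b = "of_bool (x \<in> A) :: real"
    let ?p = "run orc (odds_alg N x A f)"
    have "(real (k + of_bool (x \<in> A)))\<^sup>2 = (real k)\<^sup>2 + 2 * ?b * real k + ?b" for k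
      by (auto simp: power2_eq_square algebra_simps)
    then have "expec ?p (\<lambda>k. (real (k + of_bool (x \<in> A)))\<^sup>2)
      = expec ?p (\<lambda>k. (real k)\<^sup>2) + 2 * ?b * expec ?p real + ?b"
      using integrable_finite_pmf[OF finite_odds, of A f] by simp
    also have "\<dots> \<le> (od A + 2 * (od A)\<^sup>2) + 2 * ?b * od A + ?b"
    proof -
      have "od A * (1 - (1 - q A) ^ f) \<le> od A * 1"
        using q_bounds[of A] od_nonneg[of A] by (intro mult_left_mono) auto
      then show ?thesis using expec_odds_square[of A f] unfolding expec_odds
        by (intro add_mono mult_left_mono) auto
    qed
    also have "\<dots> \<le> (od A + ?b) + 2 * (od A + ?b)\<^sup>2"
      using od_nonneg[of A] by (auto simp: power2_eq_square algebra_simps)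
    finally show "expec ?p (\<lambda>k. (real (k + of_bool (x \<in> A)))\<^sup>2) \<le> sum g A + 2 * (sum g A)\<^sup>2"
      unfolding od_of_bool[OF A] .
  qed
  also have "\<dots> = \<rho> * G + 2 * expec (random_subset \<rho> N) (\<lambda>A. (sum g A)\<^sup>2)"
    using integrable_finite_pmf[OF finite_set_random_subset, of \<rho> N] by (simp add: subset_sum_moments(1))
  finally show ?thesis using subset_sum_moments(2) by simp
qed

lemma mass_B_le: "A \<subseteq> {1..N} \<Longrightarrow> mass (B A) \<le> pmf \<mu> x + mass A"
proof -
  assume A: "A \<subseteq> {1..N}"
  then have "B A = insert x A" "finite A" using finite_subset by (auto simp: B_def)
  then show ?thesis by (cases "x \<in> A") (auto simp: insert_absorb sum_nonneg)
qed

text \<open>\<open>1 / q A\<close> is at most \<open>1 + mass A / pmf \<mu> x\<close>, and a random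
  set has expected mass \<open>\<rho>\<close>. Unlike the estimated quantity, the cost depends on
  the uncapped masses.\<close>

lemma expected_queries_ratio:
  "expected_queries orc (ratio_alg N x \<rho> f) \<le> ennreal (2 * (1 + \<rho> / pmf \<mu> x))"
proof -
  have "expected_queries orc (ratio_alg N x \<rho> f)
    = (\<integral>\<^sup>+A. expected_queries orc (odds_alg N x A f) \<partial>random_subset \<rho> N)"
    by (simp add: ratio_alg_def expected_queries_bind_alg expected_queries_random_subset_alg run_random_subset_alg)
  also have "\<dots> \<le> (\<integral>\<^sup>+A. ennreal (2 * (1 + mass A / pmf \<mu> x)) \<partial>random_subset \<rho> N)"
  proof (intro nn_integral_mono_AE AE_pmfI)
    fix A assume "A \<in> set_pmf (random_subset \<rho> N)"
    then have A: "A \<subseteq> {1..N}" by (rule random_subset_within)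
    have "2 / q A \<le> 2 * (1 + mass A / pmf \<mu> x)"
      using mass_B_le[OF A] px by (simp add: q_def field_simps)
    then show "expected_queries orc (odds_alg N x A f) \<le> ennreal (2 * (1 + mass A / pmf \<mu> x))"
      using expected_queries_odds[of A f] by (meson ennreal_leI order_trans)
  qed
  also have "\<dots> = ennreal (expec (random_subset \<rho> N) (\<lambda>A. 2 * (1 + mass A / pmf \<mu> x)))"
    using px by (intro nn_integral_eq_integral integrable_finite_pmf finite_set_random_subset)
      (auto intro!: AE_I2 mult_nonneg_nonneg add_nonneg_nonneg divide_nonneg_nonneg sum_nonneg)
  also have "expec (random_subset \<rho> N) (\<lambda>A. 2 * (1 + mass A / pmf \<mu> x)) = 2 * (1 + \<rho> / pmf \<mu> x)"
    using integrable_finite_pmf[OF finite_set_random_subset, of \<rho> N] expec_random_subset_sum[of \<rho> N "pmf \<mu>"]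
      \<rho> mass_Omega by simp
  finally show ?thesis .
qed

lemma prob_probe:
  "measure_pmf.prob (run orc (probe_alg N x \<rho>)) {b. P b} =
     expec (random_subset \<rho> N) (\<lambda>A. if P True then (if P False then 1 else q A) else if P False then 1 - q A else 0)"
proof -
  have fin: "finite (set_pmf (run orc (Query (B A) (\<lambda>y. Output (y = x)))))" for A by simp
  have pr: "expec (run orc (Query (B A) (\<lambda>y. Output (y = x)))) (indicator {b. P b})
    = (if P True then (if P False then 1 else q A) else if P False then 1 - q A else 0)" for A
  proof -
    have m: "mass (B A) > 0" using mass_pos B by auto
    have "expec (run orc (Query (B A) (\<lambda>y. Output (y = x)))) (indicator {b. P b})
      = expec (orc (B A)) (\<lambda>y. indicator {b. P b} (y = x))"
      unfolding run.simps using B finite_orc by (subst expec_bind) auto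
    also have "\<dots> = (pmf \<mu> x * of_bool (P True) + (\<Sum>y\<in>B A - {x}. pmf \<mu> y * of_bool (P False))) / mass (B A)"
      unfolding expec_orc[OF B(1,2)] using B
      by (subst sum.remove[of "B A" x]) (auto simp: indicator_def intro!: sum.cong)
    also have "(\<Sum>y\<in>B A - {x}. pmf \<mu> y * of_bool (P False)) = (mass (B A) - pmf \<mu> x) * of_bool (P False)"
      using B by (simp add: sum_distrib_right[symmetric] sum_diff1)
    finally show ?thesis using m by (auto simp: q_def field_simps)
  qed
  have "measure_pmf.prob (run orc (probe_alg N x \<rho>)) {b. P b}
    = expec (run orc (probe_alg N x \<rho>)) (indicator {b. P b})" by simp
  also have "\<dots> = expec (random_subset \<rho> N) (\<lambda>A. expec (run orc (Query (B A) (\<lambda>y. Output (y = x)))) (indicator {b. P b}))"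
    unfolding probe_alg_def run_bind_alg run_random_subset_alg B_def[symmetric]
    by (rule expec_bind) (use finite_set_random_subset fin in auto)
  finally show ?thesis unfolding pr .
qed

lemma prob_probe_lose:
  "measure_pmf.prob (run orc (probe_alg N x \<rho>)) {b. \<not> b} \<le> \<rho> / pmf \<mu> x"
proof -
  have "measure_pmf.prob (run orc (probe_alg N x \<rho>)) {b. \<not> b} = expec (random_subset \<rho> N) (\<lambda>A. 1 - q A)"
    by (simp add: prob_probe)
  also have "\<dots> \<le> expec (random_subset \<rho> N) (\<lambda>A. mass A / pmf \<mu> x)"
  proof (rule expec_mono[OF finite_set_random_subset])
    fix A assume "A \<in> set_pmf (random_subset \<rho> N)"
    then have A: "A \<subseteq> {1..N}" by (rule random_subset_within)
    have m: "pmf \<mu> x \<le> mass (B A)" using B by (intro member_le_sum) auto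
    have "1 - q A = (mass (B A) - pmf \<mu> x) / mass (B A)"
      using m px by (simp add: q_def field_simps)
    also have "\<dots> \<le> mass A / pmf \<mu> x"
      using m px mass_B_le[OF A] by (intro frac_le) (auto simp: sum_nonneg)
    finally show "1 - q A \<le> mass A / pmf \<mu> x" .
  qed
  also have "\<dots> = \<rho> / pmf \<mu> x"
    using expec_random_subset_sum[of \<rho> N "pmf \<mu>"] \<rho> mass_Omega by simp
  finally show ?thesis .
qed

text \<open>If \<open>sum g A\<close> is at least half its mean \<open>l\<close>, then
  \<open>q A \<le> 2 / l\<close>, since \<open>pmf \<mu> x * g y \<le> pmf \<mu> y\<close>. The
  opposite case is paid for by Chebyshev's inequality, where the variance bound \<open>l\<close>
  contributes \<open>4 / l\<close>; both cases enter as one pointwise bound.\<close>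

lemma prob_probe_win:
  "measure_pmf.prob (run orc (probe_alg N x \<rho>)) {b. b} \<le> 6 / (\<rho> * G)"
proof -
  define l where "l = \<rho> * G"
  have l: "0 < l" using \<rho> G_ge_1 by (simp add: l_def)
  note int = integrable_finite_pmf[OF finite_set_random_subset, of \<rho> N]
  have "measure_pmf.prob (run orc (probe_alg N x \<rho>)) {b. b} = expec (random_subset \<rho> N) q"
    by (simp add: prob_probe)
  also have "\<dots> \<le> expec (random_subset \<rho> N) (\<lambda>A. 2 / l + 4 * (sum g A - l)\<^sup>2 / l\<^sup>2)"
  proof (rule expec_mono[OF finite_set_random_subset])
    fix A assume "A \<in> set_pmf (random_subset \<rho> N)"
    then have A: "A \<subseteq> {1..N}" by (rule random_subset_within)
    show "q A \<le> 2 / l + 4 * (sum g A - l)\<^sup>2 / l\<^sup>2"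
    proof (cases "l / 2 \<le> sum g A")
      case True
      have "pmf \<mu> x * (1 + od A) = pmf \<mu> x + (\<Sum>y\<in>B A - {x}. pmf \<mu> x * g y)"
        by (simp add: od_def sum_distrib_left distrib_left)
      also have "\<dots> \<le> pmf \<mu> x + mass (B A - {x})" by (intro add_left_mono sum_mono g_le)
      also have "\<dots> = mass (B A)" using B by (simp add: sum_diff1)
      finally have "q A * (1 + od A) \<le> 1" using px mass_pos[OF B(1,2), of A] by (simp add: q_def)
      moreover have "q A * sum g A \<le> q A * (1 + od A)"
        using od_of_bool[OF A] q_bounds[of A] by (intro mult_left_mono; cases "x \<in> A") auto
      moreover have "q A * (l / 2) \<le> q A * sum g A" using True q_bounds[of A] by (intro mult_left_mono) auto
      ultimately have "q A * (l / 2) \<le> 1" by linarith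
      then have "q A \<le> 2 / l" using l by (simp add: field_simps)
      then show ?thesis by (simp add: add_increasing2)
    next
      case False
      then have "(l / 2)\<^sup>2 \<le> (l - sum g A)\<^sup>2" using l by (intro power_mono) auto
      then have "1 \<le> 4 * (sum g A - l)\<^sup>2 / l\<^sup>2"
        using l by (simp add: power2_commute[of l] power_divide field_simps)
      moreover have "0 \<le> 2 / l" using l by simp
      ultimately show ?thesis using q_bounds(3)[of A] by linarith
    qed
  qed
  also have "\<dots> = 2 / l + 4 * expec (random_subset \<rho> N) (\<lambda>A. (sum g A - l)\<^sup>2) / l\<^sup>2"
    using int by simp
  also have "expec (random_subset \<rho> N) (\<lambda>A. (sum g A - l)\<^sup>2)
    = expec (random_subset \<rho> N) (\<lambda>A. (sum g A)\<^sup>2 - 2 * l * sum g A + l\<^sup>2)"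
    by (simp add: power2_eq_square algebra_simps)
  also have "\<dots> = expec (random_subset \<rho> N) (\<lambda>A. (sum g A)\<^sup>2) - 2 * l * l + l\<^sup>2"
    using int subset_sum_moments(1) by (simp add: l_def)
  also have "2 / l + 4 * \<dots> / l\<^sup>2 \<le> 2 / l + 4 * l / l\<^sup>2"
    using subset_sum_moments(2) l unfolding l_def[symmetric]
    by (intro add_left_mono divide_right_mono) (auto simp: power2_eq_square)
  also have "\<dots> = 6 / l" using l by (simp add: power2_eq_square)
  finally show ?thesis by (simp add: l_def)
qed

end

lemma expec_light: "expec (run orc (light_alg N x)) h = (1 - pmf \<mu> x * G) * h 0 + pmf \<mu> x * G * h 1"
proof -
  have O: "{1..N} \<subseteq> {1..N}" "{1..N} \<noteq> {}" using x_in by auto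
  have "expec (run orc (light_alg N x)) h = expec (orc {1..N})
    (\<lambda>y. expec (run orc (Query {x, y} (\<lambda>z. Output (of_bool (z = x))))) h)"
    unfolding light_alg_def run.simps(2)[of _ "{1..N}"]
  proof (rule expec_bind)
    fix y assume "y \<in> set_pmf (orc {1..N})"
    then have "y \<in> {1..N}" using O orc unfolding cond_oracle_def by blast
    then show "finite (set_pmf (run orc (Query {x, y} (\<lambda>z. Output (of_bool (z = x))))))"
      using finite_orc[of "{x, y}"] x_in by auto
  qed (rule finite_orc[OF O])
  also have "\<dots> = expec (orc {1..N}) (\<lambda>y. if y = x then h 1
      else (pmf \<mu> x * h 1 + pmf \<mu> y * h 0) / (pmf \<mu> x + pmf \<mu> y))"
  proof (rule expec_cong)
    fix y assume "y \<in> set_pmf (orc {1..N})"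
    then have y: "y \<in> {1..N}" using O orc unfolding cond_oracle_def by blast
    have "expec (run orc (Query {x, y} (\<lambda>z. Output (of_bool (z = x))))) h
      = expec (orc {x, y}) (\<lambda>z. h (of_bool (z = x)))"
      using finite_orc[of "{x, y}"] x_in y by (simp add: expec_bind)
    then show "expec (run orc (Query {x, y} (\<lambda>z. Output (of_bool (z = x))))) h
      = (if y = x then h 1 else (pmf \<mu> x * h 1 + pmf \<mu> y * h 0) / (pmf \<mu> x + pmf \<mu> y))"
      using pair_expec[OF y, of "\<lambda>z. h (of_bool (z = x))"] expec_orc[of "{x}" "\<lambda>z. h (of_bool (z = x))"] x_in px
      by auto
  qed
  also have "\<dots> = (\<Sum>y\<in>{1..N}. pmf \<mu> y * (if y = x then h 1
      else (pmf \<mu> x * h 1 + pmf \<mu> y * h 0) / (pmf \<mu> x + pmf \<mu> y)))"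
    unfolding expec_orc[OF O(1) x_in] mass_Omega by simp
  also have "\<dots> = (\<Sum>y\<in>{1..N}. pmf \<mu> x * g y * h 1 + (pmf \<mu> y - pmf \<mu> x * g y) * h 0)"
  proof (rule sum.cong[OF refl])
    fix y assume y: "y \<in> {1..N}"
    define u where "u = pmf \<mu> y / (pmf \<mu> x + pmf \<mu> y)"
    have "0 < pmf \<mu> x + pmf \<mu> y" using px pmf_nonneg[of \<mu> y] by linarith
    then have "pmf \<mu> y = (pmf \<mu> x + pmf \<mu> y) * u" by (simp add: u_def)
    then have "pmf \<mu> y - pmf \<mu> x * u = pmf \<mu> y * u" by (simp add: distrib_right)
    moreover have "pmf \<mu> y * ((pmf \<mu> x * h 1 + pmf \<mu> y * h 0) / (pmf \<mu> x + pmf \<mu> y))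
      = pmf \<mu> x * u * h 1 + pmf \<mu> y * u * h 0"
      by (simp add: u_def add_divide_distrib distrib_left mult.commute mult.left_commute)
    ultimately show "pmf \<mu> y * (if y = x then h 1 else (pmf \<mu> x * h 1 + pmf \<mu> y * h 0) / (pmf \<mu> x + pmf \<mu> y))
      = pmf \<mu> x * g y * h 1 + (pmf \<mu> y - pmf \<mu> x * g y) * h 0"
      by (simp add: g_def u_def[symmetric])
  qed
  also have "\<dots> = (1 - pmf \<mu> x * G) * h 0 + pmf \<mu> x * G * h 1"
    by (simp add: sum.distrib sum_subtractf sum_distrib_left[symmetric] sum_distrib_right[symmetric] mass_Omega del: One_nat_def)
  finally show ?thesis .
qed

lemma finite_light: "finite (set_pmf (run orc (light_alg N x)))"
proof (rule finite_subset)
  show "set_pmf (run orc (light_alg N x)) \<subseteq> {0, 1}" by (auto simp: light_alg_def)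
qed simp

lemma expected_queries_light: "expected_queries orc (light_alg N x) = 2"
  by (simp add: light_alg_def)

end

section \<open>Locating the scale of an element\<close>

lemma le_add_of_ennreal:
  assumes "ennreal a \<le> ennreal b + ennreal c" "0 \<le> b" "0 \<le> c" shows "a \<le> b + c"
proof -
  have "ennreal a \<le> ennreal (b + c)" using assms by simp
  then show ?thesis using assms by (subst (asm) ennreal_le_iff) auto
qed

lemma sum_half_powers_le:
  fixes b :: real
  assumes "finite J" "0 \<le> b" "\<And>j. j \<in> J \<Longrightarrow> (1 / 2) ^ j \<le> b"
  shows "(\<Sum>j\<in>J. (1 / 2) ^ j) \<le> 2 * b"
proof (cases "J = {}")
  case False
  define k where "k = Min J"
  have k: "k \<in> J" "\<And>j. j \<in> J \<Longrightarrow> k \<le> j" using assms(1) False by (auto simp: k_def)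
  have geo: "(\<Sum>j\<in>{k..<k + n}. (1 / 2 :: real) ^ j) = 2 * (1 / 2) ^ k - 2 * (1 / 2) ^ (k + n)" for n
    by (induction n) auto
  have "J \<subseteq> {k..<k + Suc (Max J)}" using k Max_ge[OF assms(1)] by (force simp: less_Suc_eq_le trans_le_add2)
  then have "(\<Sum>j\<in>J. (1 / 2 :: real) ^ j) \<le> (\<Sum>j\<in>{k..<k + Suc (Max J)}. (1 / 2) ^ j)"
    by (intro sum_mono2) auto
  also have "\<dots> \<le> 2 * (1 / 2) ^ k" unfolding geo by simp
  finally show ?thesis using assms(3)[OF k(1)] by simp
qed (use assms in auto)

lemma sum_two_powers_le:
  fixes b :: real
  assumes "finite J" "0 \<le> b" "\<And>j. j \<in> J \<Longrightarrow> 2 ^ j \<le> b"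
  shows "(\<Sum>j\<in>J. 2 ^ j) \<le> 2 * b"
proof (cases "J = {}")
  case False
  have geo: "(\<Sum>j\<le>n. 2 ^ j) \<le> (2 * 2 ^ n :: real)" for n by (induction n) auto
  have "(\<Sum>j\<in>J. 2 ^ j :: real) \<le> (\<Sum>j\<le>Max J. 2 ^ j)"
    using assms(1) by (intro sum_mono2) auto
  also have "\<dots> \<le> 2 * 2 ^ Max J" by (rule geo)
  also have "\<dots> \<le> 2 * b" using assms(3)[OF Max_in[OF assms(1) False]] by simp
  finally show ?thesis .
qed (use assms in auto)

text \<open>The candidates start at \<open>lo\<close> and number \<open>2 ^ d\<close>;
  \<open>True\<close> moves to the left half. Below, position \<open>j\<close> stands for the
  density \<open>(1 / 2) ^ j\<close>, so the left is the side of larger densities.\<close>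

primrec search_alg :: "(nat \<Rightarrow> bool cond_alg) \<Rightarrow> nat \<Rightarrow> nat \<Rightarrow> nat cond_alg" where
  "search_alg pr 0 lo = Output lo"
| "search_alg pr (Suc d) lo = bind_alg (pr (lo + 2 ^ d))
     (\<lambda>b. if b then search_alg pr d lo else search_alg pr d (lo + 2 ^ d))"

lemma queries_within_search_alg:
  "(\<And>j. queries_within \<Omega> (pr j)) \<Longrightarrow> queries_within \<Omega> (search_alg pr d lo)"
  by (induction d arbitrary: lo) (auto intro!: queries_within_bind_alg)

lemma queries_at_most_search_alg:
  assumes "\<And>j. queries_at_most (pr j) n"
  shows "queries_at_most (search_alg pr d lo) (d * n)"
proof (induction d arbitrary: lo)
  case (Suc d)
  have "queries_at_most (search_alg pr (Suc d) lo) (n + d * n)"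
    unfolding search_alg.simps using Suc by (intro queries_at_most_bind_alg assms) auto
  then show ?case by simp
qed simp

text \<open>
  Bisection probes every position at most once. When the error probabilities of the probes are
  summable, a union bound therefore replaces any repetition of probes.
\<close>

lemma prob_search_alg_le:
  assumes low: "\<And>j. Low j \<Longrightarrow> measure_pmf.prob (run orc (pr j)) {b. \<not> b} \<le> err j"
    and high: "\<And>j. High j \<Longrightarrow> measure_pmf.prob (run orc (pr j)) {b. b} \<le> err j"
    and excl: "\<And>j. \<not> (Low j \<and> High j)" and err: "\<And>j. 0 \<le> err j"
    and "\<not> Low lo" "\<not> High (lo + 2 ^ d)"
  shows "measure_pmf.prob (run orc (search_alg pr d lo)) {j. Low j \<or> High (Suc j)}
    \<le> (\<Sum>j\<in>{lo<..<lo + 2 ^ d}. err j)"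
  using assms(5,6)
proof (induction d arbitrary: lo)
  case 0
  then show ?case by (simp add: sum_nonneg err)
next
  case (Suc d)
  define mid where "mid = lo + 2 ^ d"
  define S where "S a b = (\<Sum>j\<in>{a<..<b}. err j)" for a b
  have S0: "0 \<le> S a b" for a b by (simp add: S_def sum_nonneg err)
  have hi: "lo + 2 ^ Suc d = mid + 2 ^ d" by (simp add: mid_def)
  have lt: "lo < mid" "mid < mid + 2 ^ d" by (auto simp: mid_def)
  have S1: "err mid + S lo mid \<le> S lo (mid + 2 ^ d)"
  proof -
    have "err mid + S lo mid = (\<Sum>j\<in>insert mid {lo<..<mid}. err j)" by (simp add: S_def)
    also have "\<dots> \<le> S lo (mid + 2 ^ d)" unfolding S_def using lt err by (intro sum_mono2) auto
    finally show ?thesis .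
  qed
  have S2: "err mid + S mid (mid + 2 ^ d) \<le> S lo (mid + 2 ^ d)"
  proof -
    have "err mid + S mid (mid + 2 ^ d) = (\<Sum>j\<in>insert mid {mid<..<mid + 2 ^ d}. err j)" by (simp add: S_def)
    also have "\<dots> \<le> S lo (mid + 2 ^ d)" unfolding S_def using lt err by (intro sum_mono2) auto
    finally show ?thesis .
  qed
  have IH1: "measure_pmf.prob (run orc (search_alg pr d lo)) {j. Low j \<or> High (Suc j)} \<le> S lo mid"
    if "\<not> High mid"
    using Suc.IH[OF Suc.prems(1)] that by (simp add: S_def mid_def)
  have IH2: "measure_pmf.prob (run orc (search_alg pr d mid)) {j. Low j \<or> High (Suc j)} \<le> S mid (mid + 2 ^ d)"
    if "\<not> Low mid"
    using Suc.IH[OF that Suc.prems(2)[unfolded hi]] by (simp add: S_def)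
  have "measure_pmf.prob (run orc (search_alg pr (Suc d) lo)) {j. Low j \<or> High (Suc j)}
    \<le> S lo (mid + 2 ^ d)"
    unfolding search_alg.simps run_bind_alg mid_def[symmetric]
  proof -
    \<comment> \<open>The invariant is that the left end is not \<open>Low\<close> and the right end
      is not \<open>High\<close>. Only the wrong answer at a \<open>Low\<close> or
      \<open>High\<close> position breaks it; elsewhere both answers keep it and no error is
      charged.\<close>
    consider "Low mid" "\<not> High mid" | "High mid" "\<not> Low mid" | "\<not> Low mid" "\<not> High mid"
      using excl by blast
    then show "measure_pmf.prob (run orc (pr mid) \<bind>
        (\<lambda>r. run orc (if r then search_alg pr d lo else search_alg pr d mid))) {j. Low j \<or> High (Suc j)}
      \<le> S lo (mid + 2 ^ d)"
    proof cases
      case 1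
      show ?thesis
        by (rule order_trans[OF prob_bind_pmf_le[OF low[OF 1(1)] S0[of lo mid]] S1])
          (use IH1[OF 1(2)] in auto)
    next
      case 2
      show ?thesis
        by (rule order_trans[OF prob_bind_pmf_le[OF high[OF 2(1)] S0[of mid "mid + 2 ^ d"]] S2])
          (use IH2[OF 2(2)] in auto)
    next
      case 3
      have "measure_pmf.prob (run orc (pr mid) \<bind>
        (\<lambda>r. run orc (if r then search_alg pr d lo else search_alg pr d mid))) {j. Low j \<or> High (Suc j)}
        \<le> 0 + S lo (mid + 2 ^ d)"
        by (rule prob_bind_pmf_le[where B = "{}"])
          (use IH1[OF 3(2)] IH2[OF 3(1)] S1 S2 S0 err[of mid] in auto)
      then show ?thesis by simp
    qed
  qed
  then show ?case unfolding hi S_def .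
qed

text \<open>Ties count as \<open>True\<close>. Either kind of error then requires at least
  \<open>s\<close> wrong answers among \<open>2 * s\<close>, so both have the same bound.\<close>

definition majority_alg :: "nat \<Rightarrow> bool cond_alg \<Rightarrow> bool cond_alg" where
  "majority_alg s a = bind_alg (repeat_alg (2 * s) a) (\<lambda>bs. Output (s \<le> length (filter id bs)))"

lemma prob_majority_alg_true:
  assumes "measure_pmf.prob (run orc a) {b. b} \<le> r"
  shows "measure_pmf.prob (run orc (majority_alg s a)) {b. b} \<le> (4 * r) ^ s"
proof -
  have eq: "run orc (majority_alg s a)
    = map_pmf (\<lambda>bs. s \<le> length (filter id bs)) (replicate_pmf (2 * s) (run orc a))"
    by (simp add: majority_alg_def run_bind_alg run_repeat_alg map_pmf_def)
  show ?thesis unfolding eq measure_map_pmf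
    using prob_replicate_half_le[of "run orc a" id r s] assms by (simp add: vimage_def)
qed

lemma prob_majority_alg_false:
  assumes "measure_pmf.prob (run orc a) {b. \<not> b} \<le> r"
  shows "measure_pmf.prob (run orc (majority_alg s a)) {b. \<not> b} \<le> (4 * r) ^ s"
proof -
  have eq: "run orc (majority_alg s a)
    = map_pmf (\<lambda>bs. s \<le> length (filter id bs)) (replicate_pmf (2 * s) (run orc a))"
    by (simp add: majority_alg_def run_bind_alg run_repeat_alg map_pmf_def)
  have "measure_pmf.prob (run orc (majority_alg s a)) {b. \<not> b}
    \<le> measure_pmf.prob (replicate_pmf (2 * s) (run orc a)) {bs. s \<le> length (filter Not bs)}"
    unfolding eq measure_map_pmf
  proof (intro measure_pmf.finite_measure_mono_AE AE_pmfI impI)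
    fix bs assume bs: "bs \<in> set_pmf (replicate_pmf (2 * s) (run orc a))"
      "bs \<in> (\<lambda>bs. s \<le> length (filter id bs)) -` {b. \<not> b}"
    have "length (filter id bs) + length (filter Not bs) = length bs"
      using sum_length_filter_compl[of id bs] by simp
    then show "bs \<in> {bs. s \<le> length (filter Not bs)}" using bs by (auto simp: set_replicate_pmf)
  qed simp
  also have "\<dots> \<le> (4 * r) ^ s" by (rule prob_replicate_half_le[OF assms])
  finally show ?thesis .
qed

definition mass_alg :: "nat \<Rightarrow> nat \<Rightarrow> real \<Rightarrow> nat \<Rightarrow> nat \<Rightarrow> real cond_alg" where
  "mass_alg N x \<rho> f n = bind_alg (repeat_alg n (light_alg N x)) (\<lambda>ls.
     bind_alg (repeat_alg n (ratio_alg N x \<rho> f)) (\<lambda>ks.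
       Output (\<rho> * (sum_list (map real ls) / real n) / (sum_list (map real ks) / real n))))"

text \<open>A substitute for the median: any scale with which more than half of the
  \<open>2 * s\<close> estimates agree. The tolerance \<open>5 * e\<close> is the accuracy
  \<open>4 * e\<close> of an estimate plus \<open>e\<close> for rounding to a scale. The default
  \<open>0\<close> keeps the output in range.\<close>

definition pick_scale :: "real \<Rightarrow> nat \<Rightarrow> nat \<Rightarrow> real list \<Rightarrow> nat" where
  "pick_scale e K s es = (let P = (\<lambda>k. k \<le> K \<and>
       s < length (filter (\<lambda>v. log_close (5 * e) v (exp (- (real k * e)))) es))
     in if \<exists>k. P k then SOME k. P k else 0)"

text \<open>With \<open>e = (1 / 2) ^ m\<close>, the exponent \<open>17 + 3 * m\<close> gives
  \<open>131072 / e ^ 3\<close> repetitions, and \<open>37 + 4 * m\<close> gives a budget of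
  \<open>2 ^ 20 / e\<close> queries for each of them. A truncated estimate is \<open>0\<close>,
  which is \<open>log_close\<close> to nothing and thus supports no scale.\<close>

definition scale_alg :: "nat \<Rightarrow> nat \<Rightarrow> nat \<Rightarrow> nat \<Rightarrow> nat \<Rightarrow> nat \<Rightarrow> nat cond_alg" where
  "scale_alg N m d K f x =
     bind_alg (search_alg (\<lambda>j. majority_alg m (probe_alg N x ((1 / 2) ^ j))) d 0) (\<lambda>j.
       bind_alg (repeat_alg (2 * m)
           (truncate_alg 0 (mass_alg N x ((1 / 2) ^ j) f (2 ^ (17 + 3 * m))) (2 ^ (37 + 4 * m))))
         (\<lambda>es. Output (pick_scale ((1 / 2) ^ m) K m es)))"

lemma filter_overlap:
  assumes "length xs < length (filter P xs) + length (filter Q xs)"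
  shows "\<exists>v\<in>set xs. P v \<and> Q v"
  using assms by (induction xs) (auto split: if_splits)

lemma pick_scale_le: "pick_scale e K s es \<le> K"
proof -
  define P where "P k \<longleftrightarrow> k \<le> K \<and>
    s < length (filter (\<lambda>v. log_close (5 * e) v (exp (- (real k * e)))) es)" for k
  have "pick_scale e K s es = (if \<exists>k. P k then SOME k. P k else 0)"
    unfolding pick_scale_def P_def Let_def by (rule refl)
  moreover have "P (SOME k. P k)" if "\<exists>k. P k" using that by (rule someI_ex)
  ultimately show ?thesis by (auto simp: P_def)
qed

text \<open>The rounded value \<open>k\<close> of \<open>- ln p / e\<close> is supported by all good
  estimates, so some scale is chosen. The supporters of the chosen scale and the good estimates are
  both strict majorities and share an element, whence \<open>4 * e + 5 * e\<close>.\<close>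

lemma pick_scale_close:
  assumes e: "0 < e" and p: "0 < p" "p \<le> 1" and K: "- ln p \<le> real K * e"
    and len: "length es = 2 * s" and good: "s < length (filter (\<lambda>v. log_close (4 * e) v p) es)"
  shows "log_close (9 * e) p (exp (- (real (pick_scale e K s es) * e)))"
proof -
  define P where "P k \<longleftrightarrow> k \<le> K \<and>
    s < length (filter (\<lambda>v. log_close (5 * e) v (exp (- (real k * e)))) es)" for k
  define k where "k = nat \<lfloor>- ln p / e\<rfloor>"
  have k: "real k \<le> - ln p / e" "- ln p / e < real k + 1"
    using e p by (auto simp: k_def divide_le_0_iff zero_le_divide_iff)
  then have k': "real k * e \<le> - ln p" "- ln p < real k * e + e" using e by (auto simp: field_simps)
  then have "real k * e \<le> real K * e" using K by linarith
  then have "k \<le> K" using e by simp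
  moreover have "log_close (5 * e) v (exp (- (real k * e)))" if "log_close (4 * e) v p" for v
  proof -
    have "log_close e p (exp (- (real k * e)))" using p k' by (auto simp: log_close_def)
    then show ?thesis using log_close_trans[OF that] by fastforce
  qed
  then have "length (filter (\<lambda>v. log_close (4 * e) v p) es)
    \<le> length (filter (\<lambda>v. log_close (5 * e) v (exp (- (real k * e)))) es)"
    by (induction es) auto
  ultimately have "P k" using good by (auto simp: P_def)
  then have "P (SOME k. P k)" by (rule someI)
  moreover have "pick_scale e K s es = (SOME k. P k)"
    using \<open>P k\<close> by (auto simp: pick_scale_def P_def Let_def)
  ultimately have "P (pick_scale e K s es)" by simp
  then have "length es < length (filter (\<lambda>v. log_close (4 * e) v p) es)
    + length (filter (\<lambda>v. log_close (5 * e) v (exp (- (real (pick_scale e K s es) * e)))) es)"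
    using good len by (simp add: P_def)
  from filter_overlap[OF this] obtain v where
    "log_close (4 * e) v p" "log_close (5 * e) v (exp (- (real (pick_scale e K s es) * e)))" by blast
  then show ?thesis using log_close_trans[OF log_close_sym] by fastforce
qed

lemma queries_within_scale_alg:
  "x \<in> {1..N} \<Longrightarrow> queries_within {1..N} (scale_alg N m d K f x)"
  unfolding scale_alg_def mass_alg_def majority_alg_def
  by (intro queries_within_bind_alg queries_within_search_alg queries_within_repeat_alg
      queries_within_truncate_alg queries_within_probe_alg queries_within_light_alg
      queries_within_ratio_alg) auto

lemma queries_at_most_scale_alg:
  "queries_at_most (scale_alg N m d K f x) (d * (2 * m) + 2 * m * 2 ^ (37 + 4 * m))"
proof -
  have "queries_at_most (majority_alg m (probe_alg N x ((1 / 2) ^ j))) (2 * m * 1 + 0)" for j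
    unfolding majority_alg_def
    by (intro queries_at_most_bind_alg queries_at_most_repeat_alg queries_at_most_probe_alg) auto
  then have "queries_at_most (search_alg (\<lambda>j. majority_alg m (probe_alg N x ((1 / 2) ^ j))) d 0) (d * (2 * m))"
    by (intro queries_at_most_search_alg) simp
  then have "queries_at_most (scale_alg N m d K f x) (d * (2 * m) + (2 * m * 2 ^ (37 + 4 * m) + 0))"
    unfolding scale_alg_def
    by (intro queries_at_most_bind_alg queries_at_most_repeat_alg queries_at_most_truncate_alg) auto
  then show ?thesis by simp
qed

lemma set_run_scale_alg: "set_pmf (run orc (scale_alg N m d K f x)) \<subseteq> {..K}"
  by (auto simp: scale_alg_def run_bind_alg pick_scale_le)

section \<open>Error probability and cost of the scale estimate\<close>

context cond_sampling
begin

lemma prob_search_scale: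
  assumes s: "1 \<le> s" and d: "(1 / 2) ^ (2 ^ d) \<le> pmf \<mu> x"
  shows "measure_pmf.prob (run orc (search_alg (\<lambda>j. majority_alg s (probe_alg N x ((1 / 2) ^ j))) d 0))
    {j. \<not> (pmf \<mu> x / 64 < (1 / 2) ^ j \<and> (1 / 2) ^ j * G < 768)} \<le> 4 * (1 / 16) ^ s"
proof -
  \<comment> \<open>The thresholds 64 and 384 are those at which the bounds
    \<open>\<rho> / pmf \<mu> x\<close> and \<open>6 / (\<rho> * G)\<close> for a single probe,
    multiplied by the 4 of the majority vote, reach 1/16. No position is both, as
    \<open>pmf \<mu> x * G \<le> 1\<close>. The 768 in the claim is \<open>High\<close> at
    \<open>Suc j\<close>.\<close>
  define Low where "Low j \<longleftrightarrow> (1 / 2) ^ j \<le> pmf \<mu> x / 64" for j :: nat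
  define High where "High j \<longleftrightarrow> 384 \<le> (1 / 2) ^ j * G" for j :: nat
  define u where "u j = (if Low j then 4 * (1 / 2) ^ j / pmf \<mu> x else 0)
    + (if High j then 24 * 2 ^ j / G else 0)" for j :: nat
  define err where "err j = (1 / 16) ^ (s - 1) * u j" for j
  have G: "0 < G" using G_ge_1 by linarith
  have u0: "0 \<le> u j" for j using px G by (simp add: u_def)
  \<comment> \<open>One of the \<open>s\<close> factors is kept: it decays geometrically with the
    distance from the threshold, and the others supply the small constant.\<close>
  have pow: "r ^ s \<le> (1 / 16) ^ (s - 1) * r" if "0 \<le> r" "r \<le> 1 / 16" for r :: real
  proof -
    have "r ^ s = r ^ (s - 1) * r" using s by (cases s) auto
    also have "\<dots> \<le> (1 / 16) ^ (s - 1) * r" using that by (intro mult_right_mono power_mono) auto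
    finally show ?thesis .
  qed
  have r1: "0 < (1 / 2 :: real) ^ j" "(1 / 2 :: real) ^ j \<le> 1" for j :: nat by (auto simp: power_le_one)
  have excl: "\<not> (Low j \<and> High j)" for j
  proof
    assume "Low j \<and> High j"
    then have l: "(1 / 2) ^ j \<le> pmf \<mu> x / 64" and h: "384 \<le> (1 / 2) ^ j * G"
      by (auto simp: Low_def High_def)
    have "(1 / 2) ^ j * G \<le> pmf \<mu> x / 64 * G" using l G by (intro mult_right_mono) auto
    with h have "384 \<le> pmf \<mu> x / 64 * G" by linarith
    then show False using M_le_1 by simp
  qed
  have "measure_pmf.prob (run orc (search_alg (\<lambda>j. majority_alg s (probe_alg N x ((1 / 2) ^ j))) d 0))
    {j. Low j \<or> High (Suc j)} \<le> (\<Sum>j\<in>{0<..<0 + 2 ^ d}. err j)"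
  proof (rule prob_search_alg_le)
    fix j assume l: "Low j"
    have "measure_pmf.prob (run orc (majority_alg s (probe_alg N x ((1 / 2) ^ j)))) {b. \<not> b}
      \<le> (4 * ((1 / 2) ^ j / pmf \<mu> x)) ^ s"
      by (rule prob_majority_alg_false[OF prob_probe_lose[OF r1]])
    also have "\<dots> \<le> (1 / 16) ^ (s - 1) * (4 * ((1 / 2) ^ j / pmf \<mu> x))"
      using l px by (intro pow) (auto simp: Low_def field_simps)
    also have "\<dots> = err j" using l excl by (auto simp: err_def u_def)
    finally show "measure_pmf.prob (run orc (majority_alg s (probe_alg N x ((1 / 2) ^ j)))) {b. \<not> b} \<le> err j" .
  next
    fix j assume h: "High j"
    have "measure_pmf.prob (run orc (majority_alg s (probe_alg N x ((1 / 2) ^ j)))) {b. b}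
      \<le> (4 * (6 / ((1 / 2) ^ j * G))) ^ s"
      by (rule prob_majority_alg_true[OF prob_probe_win[OF r1]])
    also have "\<dots> \<le> (1 / 16) ^ (s - 1) * (4 * (6 / ((1 / 2) ^ j * G)))"
    proof (rule pow)
      have "24 / ((1 / 2) ^ j * G) \<le> 24 / 384" using h by (intro divide_left_mono) (auto simp: High_def)
      then show "4 * (6 / ((1 / 2) ^ j * G)) \<le> 1 / 16" by simp
    qed (use G in simp)
    also have "\<dots> = err j" using h excl by (auto simp: err_def u_def power_one_over field_simps)
    finally show "measure_pmf.prob (run orc (majority_alg s (probe_alg N x ((1 / 2) ^ j)))) {b. b} \<le> err j" .
  next
    show "\<not> (Low j \<and> High j)" for j by (rule excl)
    show "0 \<le> err j" for j using u0 by (simp add: err_def)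
    \<comment> \<open>Position 0 has density 1, and position \<open>2 ^ d\<close> has density at
      most \<open>pmf \<mu> x\<close>, so bisection starts with a valid interval.\<close>
    show "\<not> Low 0" using pmf_le_1[of \<mu> x] by (simp add: Low_def)
    have "(1 / 2) ^ (2 ^ d) * G \<le> pmf \<mu> x * G" using d G by (intro mult_right_mono) auto
    then show "\<not> High (0 + 2 ^ d)" using M_le_1 by (simp add: High_def)
  qed
  also have "\<dots> = (1 / 16) ^ (s - 1) * (\<Sum>j\<in>{0<..<2 ^ d}. u j)"
    by (simp add: err_def sum_distrib_left)
  also have "\<dots> \<le> (1 / 16) ^ (s - 1) * (1 / 4)"
  proof (rule mult_left_mono)
    define J1 where "J1 = {j \<in> {0<..<2 ^ d}. Low j}"
    define J2 where "J2 = {j \<in> {0<..<2 ^ d}. High j}"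
    have "(\<Sum>j\<in>{0<..<2 ^ d}. u j) = (\<Sum>j\<in>J1. 4 * (1 / 2) ^ j / pmf \<mu> x) + (\<Sum>j\<in>J2. 24 * 2 ^ j / G)"
      unfolding u_def J1_def J2_def sum.distrib
      by (simp only: sum.inter_filter[OF finite_greaterThanLessThan])
    also have "\<dots> = 4 / pmf \<mu> x * (\<Sum>j\<in>J1. (1 / 2) ^ j) + 24 / G * (\<Sum>j\<in>J2. 2 ^ j)"
      by (simp add: sum_distrib_left)
    \<comment> \<open>Geometric sums are at most twice their largest term; each of the two
      contributes 1/8.\<close>
    also have "\<dots> \<le> 4 / pmf \<mu> x * (2 * (pmf \<mu> x / 64)) + 24 / G * (2 * (G / 384))"
    proof (intro add_mono mult_left_mono sum_half_powers_le sum_two_powers_le)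
      show "(1 / 2) ^ j \<le> pmf \<mu> x / 64" if "j \<in> J1" for j using that by (simp add: J1_def Low_def)
      show "2 ^ j \<le> G / 384" if "j \<in> J2" for j
        using that by (simp add: J2_def High_def power_one_over field_simps)
    qed (use px G in \<open>auto simp: J1_def J2_def\<close>)
    also have "\<dots> = 1 / 4" using px G by simp
    finally show "(\<Sum>j\<in>{0<..<2 ^ d}. u j) \<le> 1 / 4" .
  qed simp
  also have "\<dots> = 4 * (1 / 16) ^ s" using s by (cases s) auto
  also have "{j. Low j \<or> High (Suc j)} = {j. \<not> (pmf \<mu> x / 64 < (1 / 2) ^ j \<and> (1 / 2) ^ j * G < 768)}"
    by (auto simp: Low_def High_def)
  finally show ?thesis .
qed

text \<open>\<open>L\<close> estimates \<open>l'\<close>, which the fuel limit may keep below the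
  intended \<open>l\<close>; the two errors add up to the factor \<open>1 - 2 * e\<close>. Numerator
  and denominator each have relative error with logarithm between \<open>- 3 * e\<close> and
  \<open>e\<close>, so the quotient is off by at most \<open>4 * e\<close>.\<close>

lemma log_close_ratio:
  assumes e: "0 < e" "e \<le> 1 / 8" and pos: "0 < a" "0 < l" "0 < \<rho>"
    and A: "\<bar>A - a\<bar> \<le> e * a" and L: "\<bar>L - l'\<bar> \<le> e * l" "(1 - e) * l \<le> l'" "l' \<le> l"
  shows "log_close (4 * e) (\<rho> * A / L) (\<rho> * a / l)"
proof -
  define r where "r = A / a"
  define t where "t = L / l"
  have Ab: "(1 - e) * a \<le> A" "A \<le> (1 + e) * a" using A by (auto simp: algebra_simps abs_le_iff)
  have Lb: "(1 - 2 * e) * l \<le> L" "L \<le> (1 + e) * l" using L by (auto simp: algebra_simps abs_le_iff)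
  have r: "1 - e \<le> r" "r \<le> 1 + e" using Ab pos by (auto simp: r_def pos_le_divide_eq pos_divide_le_eq)
  have t: "1 - 2 * e \<le> t" "t \<le> 1 + e" using Lb pos by (auto simp: t_def pos_le_divide_eq pos_divide_le_eq)
  have r0: "0 < r" and t0: "0 < t" using r t e by linarith+
  have "A = r * a" "L = t * l" using pos by (auto simp: r_def t_def)
  then have lnq: "ln (\<rho> * A / L) - ln (\<rho> * a / l) = ln r - ln t"
    using pos r0 t0 by (simp add: ln_mult ln_div)
  have up: "ln r \<le> e" "ln t \<le> e"
    using ln_le_minus_one[OF r0] ln_le_minus_one[OF t0] r t by linarith+
  have "- ln r \<le> 1 / r - 1" using ln_le_minus_one[of "1 / r"] r0 by (simp add: ln_div)
  also have "1 / r - 1 \<le> 3 * e"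
  proof -
    have "1 \<le> (1 + 3 * e) * (1 - e)"
      using mult_left_mono[of e "1 / 8" e] e by (simp add: algebra_simps)
    also have "\<dots> \<le> (1 + 3 * e) * r" using r e by (intro mult_left_mono) auto
    finally show ?thesis using r0 by (simp add: field_simps)
  qed
  finally have dr: "- ln r \<le> 3 * e" .
  have "- ln t \<le> 1 / t - 1" using ln_le_minus_one[of "1 / t"] t0 by (simp add: ln_div)
  also have "1 / t - 1 \<le> 3 * e"
  proof -
    have "1 \<le> (1 + 3 * e) * (1 - 2 * e)"
      using mult_left_mono[of e "1 / 8" e] e by (simp add: algebra_simps)
    also have "\<dots> \<le> (1 + 3 * e) * t" using t e by (intro mult_left_mono) auto
    finally show ?thesis using t0 by (simp add: field_simps)
  qed
  finally have dt: "- ln t \<le> 3 * e" .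
  have "0 < A" "0 < L" using \<open>A = r * a\<close> \<open>L = t * l\<close> r0 t0 pos by auto
  then show ?thesis using lnq up dr dt pos by (auto simp: log_close_def)
qed

context
  fixes e \<rho> :: real and f n :: nat
  assumes e: "0 < e" "e \<le> 1 / 8" and M: "e / 2 \<le> pmf \<mu> x * G"
    and \<rho>: "pmf \<mu> x / 64 < \<rho>" "\<rho> * G < 768" "\<rho> \<le> 1"
    and f: "(1 - pmf \<mu> x) ^ f \<le> e" and n: "131072 / e ^ 3 \<le> real n"
begin

lemma rho_pos: "0 < \<rho>" using \<rho>(1) px by linarith

lemma n_pos: "0 < real n" using n e by (meson less_le_trans zero_less_divide_iff zero_less_numeral zero_less_power)

text \<open>Chebyshev's inequality at relative error \<open>e\<close> costs
  \<open>1 / (n * e\<^sup>2 * m)\<close> for the success frequency and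
  \<open>(3 / l + 2) / (n * e\<^sup>2)\<close> for the counts. As \<open>m \<ge> e / 2\<close>, and
  \<open>\<rho> > pmf \<mu> x / 64\<close> gives \<open>l \<ge> e / 128\<close>, a third factor
  \<open>1 / e\<close> appears. The two errors sum to \<open>387 / 131072\<close>, below
  \<open>1 / 256\<close>.\<close>

lemma prob_mass_alg:
  "measure_pmf.prob (run orc (mass_alg N x \<rho> f n)) {v. \<not> log_close (4 * e) v (pmf \<mu> x)} \<le> 1 / 256"
proof -
  define m where "m = pmf \<mu> x * G"
  define l where "l = \<rho> * G"
  define l' where "l' = expec (run orc (ratio_alg N x \<rho> f)) real"
  have G: "0 < G" using G_ge_1 by linarith
  have m: "0 < m" "e / 2 \<le> m" using px G M by (auto simp: m_def)
  have l: "0 < l" using rho_pos G by (simp add: l_def)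
  have lm: "m / 64 \<le> l" using mult_right_mono[of "pmf \<mu> x / 64" \<rho> G] \<rho>(1) G by (simp add: m_def l_def)
  have l': "(1 - e) * l \<le> l'" "l' \<le> l"
  proof -
    have "(1 - e) * l \<le> (1 - (1 - pmf \<mu> x) ^ f) * l" using f l by (intro mult_right_mono) auto
    then show "(1 - e) * l \<le> l'" "l' \<le> l"
      using expec_ratio_mean[OF rho_pos \<rho>(3), of f] by (auto simp: l_def l'_def)
  qed
  have npos: "0 < n" using n_pos by simp
  have mean_l: "expec (run orc (light_alg N x)) real = m" by (simp add: expec_light m_def)
  have sq_l: "expec (run orc (light_alg N x)) (\<lambda>k. (real k)\<^sup>2) \<le> m" by (simp add: expec_light m_def)
  have n3: "131072 \<le> real n * e ^ 3" using n e by (simp add: pos_divide_le_eq)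
  have P1: "measure_pmf.prob (replicate_pmf n (run orc (light_alg N x)))
      {ls. e * m < \<bar>sum_list (map real ls) / real n - m\<bar>} \<le> 2 / 131072"
  proof -
    have "measure_pmf.prob (replicate_pmf n (run orc (light_alg N x)))
      {ls. e * m < \<bar>sum_list (map real ls) / real n - m\<bar>} \<le> m / (real n * (e * m)\<^sup>2)"
      using replicate_mean_deviation[OF finite_light sq_l, of "e * m" n] e m npos
      by (simp add: mean_l)
    also have "\<dots> = 1 / (real n * e\<^sup>2 * m)" using m by (simp add: power2_eq_square)
    also have "\<dots> \<le> 1 / (real n * e\<^sup>2 * (e / 2))"
      using m e n_pos by (intro divide_left_mono mult_left_mono) auto
    also have "\<dots> = 2 / (real n * e ^ 3)" by (simp add: power2_eq_square power3_eq_cube)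
    also have "\<dots> \<le> 2 / 131072" using n3 by (intro divide_left_mono) auto
    finally show ?thesis .
  qed
  have P2: "measure_pmf.prob (replicate_pmf n (run orc (ratio_alg N x \<rho> f)))
      {ks. e * l < \<bar>sum_list (map real ks) / real n - l'\<bar>} \<le> 385 / 131072"
  proof -
    have "measure_pmf.prob (replicate_pmf n (run orc (ratio_alg N x \<rho> f)))
      {ks. e * l < \<bar>sum_list (map real ks) / real n - l'\<bar>} \<le> (3 * l + 2 * l\<^sup>2) / (real n * (e * l)\<^sup>2)"
      using replicate_mean_deviation[OF finite_ratio expec_ratio_square[OF rho_pos \<rho>(3)], of "e * l" n f] e l npos
      by (simp add: l'_def l_def)
    also have "\<dots> = (3 / l + 2) / (real n * e\<^sup>2)"
      using l e n_pos by (simp add: power2_eq_square field_simps)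
    also have "\<dots> \<le> (385 / e) / (real n * e\<^sup>2)"
    proof (rule divide_right_mono)
      have "e / 128 \<le> l" using lm m by linarith
      then have "3 / l \<le> 3 / (e / 128)" using e l by (intro divide_left_mono) auto
      moreover have "2 \<le> 1 / e" using e by (simp add: field_simps)
      ultimately show "3 / l + 2 \<le> 385 / e" by simp
    qed (use n_pos in simp)
    also have "\<dots> = 385 / (real n * e ^ 3)" by (simp add: power2_eq_square power3_eq_cube)
    also have "\<dots> \<le> 385 / 131072" using n3 by (intro divide_left_mono) auto
    finally show ?thesis .
  qed
  have px_eq: "\<rho> * m / l = pmf \<mu> x" using rho_pos G by (simp add: m_def l_def)
  have "measure_pmf.prob (run orc (mass_alg N x \<rho> f n)) {v. \<not> log_close (4 * e) v (pmf \<mu> x)}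
    \<le> 2 / 131072 + (385 / 131072 + 0)"
    unfolding mass_alg_def run_bind_alg run_repeat_alg
  proof (rule prob_bind_pmf_le[OF P1])
    fix ls assume ls: "ls \<notin> {ls. e * m < \<bar>sum_list (map real ls) / real n - m\<bar>}"
    show "measure_pmf.prob (replicate_pmf n (run orc (ratio_alg N x \<rho> f)) \<bind>
       (\<lambda>ks. run orc (Output (\<rho> * (sum_list (map real ls) / real n) / (sum_list (map real ks) / real n)))))
       {v. \<not> log_close (4 * e) v (pmf \<mu> x)} \<le> 385 / 131072 + 0"
    proof (rule prob_bind_pmf_le[OF P2])
      fix ks assume ks: "ks \<notin> {ks. e * l < \<bar>sum_list (map real ks) / real n - l'\<bar>}"
      have "log_close (4 * e) (\<rho> * (sum_list (map real ls) / real n) / (sum_list (map real ks) / real n)) (\<rho> * m / l)"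
        using ls ks by (intro log_close_ratio[OF e m(1) l rho_pos _ _ l']) auto
      then show "measure_pmf.prob (run orc (Output (\<rho> * (sum_list (map real ls) / real n) /
        (sum_list (map real ks) / real n)))) {v. \<not> log_close (4 * e) v (pmf \<mu> x)} \<le> 0"
        unfolding px_eq by simp
    qed simp
  qed simp
  then show ?thesis by simp
qed

text \<open>The lower bound on \<open>\<rho>\<close> served the variance; the upper bound serves the
  cost: \<open>\<rho> / pmf \<mu> x\<close> is the quotient of \<open>\<rho> * G < 768\<close> and
  \<open>pmf \<mu> x * G \<ge> e / 2\<close>.\<close>

lemma expected_queries_mass_alg:
  "expected_queries orc (mass_alg N x \<rho> f n) \<le> ennreal (3074 * real n / e)"
proof -
  have G: "0 < G" using G_ge_1 by linarith
  have "expected_queries orc (mass_alg N x \<rho> f n)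
    = of_nat n * 2 + of_nat n * expected_queries orc (ratio_alg N x \<rho> f)"
    by (simp add: mass_alg_def expected_queries_bind_alg expected_queries_repeat_alg expected_queries_light)
  also have "\<dots> \<le> of_nat n * 2 + of_nat n * ennreal (2 * (1 + \<rho> / pmf \<mu> x))"
    by (intro add_left_mono mult_left_mono expected_queries_ratio rho_pos \<rho>) auto
  also have "\<dots> = ennreal (real n * 2 + real n * (2 * (1 + \<rho> / pmf \<mu> x)))"
    using rho_pos px
    by (simp add: ennreal_of_nat_eq_real_of_nat ennreal_mult[symmetric] ennreal_plus[symmetric]
        ennreal_numeral[symmetric] del: ennreal_plus ennreal_numeral)
  also have "\<dots> \<le> ennreal (3074 * real n / e)"
  proof (rule ennreal_leI)
    have "\<rho> / pmf \<mu> x = (\<rho> * G) / (pmf \<mu> x * G)" using G by simp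
    also have "\<dots> \<le> 768 / (e / 2)" using \<rho> M e rho_pos G by (intro frac_le) auto
    finally have "2 + 2 * (1 + \<rho> / pmf \<mu> x) \<le> 4 + 3072 / e" by simp
    also have "\<dots> \<le> 3074 / e" using e by (simp add: field_simps)
    finally have "real n * (2 + 2 * (1 + \<rho> / pmf \<mu> x)) \<le> real n * (3074 / e)"
      by (intro mult_left_mono) auto
    then show "real n * 2 + real n * (2 * (1 + \<rho> / pmf \<mu> x)) \<le> 3074 * real n / e"
      by (simp add: distrib_left mult.commute)
  qed
  finally show ?thesis .
qed

text \<open>The budget is more than 128 times the expected cost, so truncation adds at most
  \<open>1 / 128\<close> to the error \<open>1 / 256\<close>.\<close>

lemma prob_truncated_mass_alg:
  assumes Q: "1048576 * real n / e \<le> real Q"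
  shows "measure_pmf.prob (run orc (truncate_alg 0 (mass_alg N x \<rho> f n) Q))
    {v. \<not> log_close (4 * e) v (pmf \<mu> x)} \<le> 1 / 64"
proof -
  let ?E = "{v. log_close (4 * e) v (pmf \<mu> x)}"
  let ?p = "run orc (mass_alg N x \<rho> f n)" and ?t = "run orc (truncate_alg 0 (mass_alg N x \<rho> f n) Q)"
  have c: "measure_pmf.prob p {v. \<not> log_close (4 * e) v (pmf \<mu> x)} = 1 - measure_pmf.prob p ?E" for p
    using measure_pmf.prob_compl[of ?E p] by (simp add: Compl_eq_Diff_UNIV[symmetric] Collect_neg_eq)
  have "3074 * real n / e / real (Suc Q) \<le> 1 / 128"
  proof -
    have le: "a / real (Suc Q) \<le> 1 / 128" if "128 * a \<le> real (Suc Q)" for a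
      using that by (simp add: pos_divide_le_eq)
    have "128 * (3074 * real n / e) \<le> 1048576 * real n / e"
      using n_pos e by (simp add: field_simps)
    then have "128 * (3074 * real n / e) \<le> real (Suc Q)" using Q by simp
    then show ?thesis by (rule le)
  qed
  moreover have "ennreal (measure_pmf.prob ?p ?E) \<le> ennreal (measure_pmf.prob ?t ?E) + ennreal (3074 * real n / e / real (Suc Q))"
  proof -
    have "expected_queries orc (mass_alg N x \<rho> f n) / of_nat (Suc Q) \<le> ennreal (3074 * real n / e) / of_nat (Suc Q)"
      by (rule divide_right_mono_ennreal[OF expected_queries_mass_alg])
    also have "\<dots> = ennreal (3074 * real n / e / real (Suc Q))"
      using n_pos e by (simp add: ennreal_of_nat_eq_real_of_nat divide_ennreal del: of_nat_Suc)
    finally show ?thesis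
      using emeasure_run_le_truncate_alg[of orc "mass_alg N x \<rho> f n" ?E 0 Q]
      by (auto simp: measure_pmf.emeasure_eq_measure intro: order_trans add_left_mono)
  qed
  then have "measure_pmf.prob ?p ?E \<le> measure_pmf.prob ?t ?E + 3074 * real n / e / real (Suc Q)"
    using e n_pos by (intro le_add_of_ennreal) (simp_all del: of_nat_Suc)
  moreover have "1 - 1 / 256 \<le> measure_pmf.prob ?p ?E" using prob_mass_alg unfolding c by linarith
  ultimately show ?thesis unfolding c by linarith
qed

end

text \<open>Error \<open>1 / 64\<close> of an estimate makes half of \<open>2 * m\<close> estimates
  fail with probability at most \<open>(4 / 64) ^ m\<close>. With the bisection error this gives
  \<open>5 * (1 / 16) ^ m\<close>.\<close>

lemma prob_scale_alg:
  assumes m: "3 \<le> m" and M: "(1 / 2) ^ m / 2 \<le> pmf \<mu> x * G"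
    and d: "(1 / 2) ^ (2 ^ d) \<le> pmf \<mu> x" and K: "- ln (pmf \<mu> x) \<le> real K * (1 / 2) ^ m"
    and f: "(1 - pmf \<mu> x) ^ f \<le> (1 / 2) ^ m"
  shows "measure_pmf.prob (run orc (scale_alg N m d K f x))
    {k. \<not> log_close (9 * (1 / 2) ^ m) (pmf \<mu> x) (exp (- (real k * (1 / 2) ^ m)))} \<le> (1 / 2) ^ m"
proof -
  define e :: real where "e = (1 / 2) ^ m"
  have "(1 / 2 :: real) ^ m \<le> (1 / 2) ^ 3" using m by (intro power_decreasing) auto
  then have e: "0 < e" "e \<le> 1 / 8" by (auto simp: e_def power3_eq_cube)
  have two: "2 ^ m = 1 / e" by (simp add: e_def power_one_over)
  have n: "131072 / e ^ 3 \<le> real (2 ^ (17 + 3 * m))"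
  proof -
    have "real (2 ^ (17 + 3 * m)) = 2 ^ 17 * (2 ^ m) ^ 3"
      by (simp add: power_add power_mult[symmetric] mult.commute)
    then show ?thesis unfolding two by (simp add: power_one_over)
  qed
  have Q: "1048576 * real (2 ^ (17 + 3 * m)) / e \<le> real (2 ^ (37 + 4 * m))"
  proof -
    have "37 + 4 * m = 20 + (17 + 3 * m) + m" by simp
    then have "real (2 ^ (37 + 4 * m)) = 2 ^ 20 * real (2 ^ (17 + 3 * m)) * 2 ^ m"
      by (simp only: power_add of_nat_mult of_nat_power of_nat_numeral)
    then show ?thesis unfolding two by simp
  qed
  have "measure_pmf.prob (run orc (scale_alg N m d K f x))
    {k. \<not> log_close (9 * e) (pmf \<mu> x) (exp (- (real k * e)))} \<le> 4 * (1 / 16) ^ m + ((1 / 16) ^ m + 0)"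
    unfolding scale_alg_def run_bind_alg[of _ "search_alg _ _ _"]
  proof (rule prob_bind_pmf_le)
    show "measure_pmf.prob (run orc (search_alg (\<lambda>j. majority_alg m (probe_alg N x ((1 / 2) ^ j))) d 0))
      {j. \<not> (pmf \<mu> x / 64 < (1 / 2) ^ j \<and> (1 / 2) ^ j * G < 768)} \<le> 4 * (1 / 16) ^ m"
      using m d by (intro prob_search_scale) auto
  next
    fix j assume "j \<notin> {j. \<not> (pmf \<mu> x / 64 < (1 / 2) ^ j \<and> (1 / 2) ^ j * G < 768)}"
    then have j: "pmf \<mu> x / 64 < (1 / 2) ^ j" "(1 / 2) ^ j * G < 768" by auto
    let ?a = "truncate_alg 0 (mass_alg N x ((1 / 2) ^ j) f (2 ^ (17 + 3 * m))) (2 ^ (37 + 4 * m))"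
    have "measure_pmf.prob (run orc ?a) {v. \<not> log_close (4 * e) v (pmf \<mu> x)} \<le> 1 / 64"
      using prob_truncated_mass_alg[OF e _ j _ _ n Q] M f unfolding e_def by (simp add: power_le_one)
    from prob_replicate_half_le[OF this, of m]
    have B: "measure_pmf.prob (replicate_pmf (2 * m) (run orc ?a))
      {es. m \<le> length (filter (\<lambda>v. \<not> log_close (4 * e) v (pmf \<mu> x)) es)} \<le> (1 / 16) ^ m" by simp
    show "measure_pmf.prob (run orc (bind_alg (repeat_alg (2 * m) ?a) (\<lambda>es. Output (pick_scale ((1 / 2) ^ m) K m es))))
      {k. \<not> log_close (9 * e) (pmf \<mu> x) (exp (- (real k * e)))} \<le> (1 / 16) ^ m + 0"
      unfolding run_bind_alg run_repeat_alg
    proof (rule prob_bind_pmf_le[OF B])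
      fix es assume es: "es \<in> set_pmf (replicate_pmf (2 * m) (run orc ?a))"
        "es \<notin> {es. m \<le> length (filter (\<lambda>v. \<not> log_close (4 * e) v (pmf \<mu> x)) es)}"
      have len: "length es = 2 * m" using es(1) by (simp add: set_replicate_pmf)
      have "m < length (filter (\<lambda>v. log_close (4 * e) v (pmf \<mu> x)) es)"
        using es(2) len sum_length_filter_compl[of "\<lambda>v. log_close (4 * e) v (pmf \<mu> x)" es] by simp
      then have "log_close (9 * e) (pmf \<mu> x) (exp (- (real (pick_scale e K m es) * e)))"
        using K by (intro pick_scale_close e px pmf_le_1 len) (auto simp: e_def)
      then show "measure_pmf.prob (run orc (Output (pick_scale ((1 / 2) ^ m) K m es)))
        {k. \<not> log_close (9 * e) (pmf \<mu> x) (exp (- (real k * e)))} \<le> 0"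
        by (simp add: e_def)
    qed simp
  qed simp
  also have "\<dots> = 5 * (1 / 16) ^ m" by simp
  also have "\<dots> \<le> (1 / 2) ^ m"
  proof -
    have "(1 / 16 :: real) ^ m = (1 / 2) ^ m * (1 / 8) ^ m" by (simp add: power_mult_distrib[symmetric])
    moreover have "(1 / 8 :: real) ^ m \<le> (1 / 8) ^ 1" using m by (intro power_decreasing) auto
    ultimately show ?thesis using mult_left_mono[of "(1 / 8 :: real) ^ m" "1 / 8" "(1 / 2) ^ m"] by simp
  qed
  finally show ?thesis by (simp add: e_def)
qed

text \<open>An element \<open>y\<close> no heavier than \<open>x\<close> wins against
  \<open>x\<close> with probability at least \<open>pmf \<mu> y / (2 * pmf \<mu> x)\<close>.\<close>

lemma light_mass_ge:
  assumes "e \<le> (\<Sum>y\<in>{y \<in> {1..N}. pmf \<mu> y \<le> pmf \<mu> x}. pmf \<mu> y)"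
  shows "e / 2 \<le> pmf \<mu> x * G"
proof -
  have "(\<Sum>y\<in>{y \<in> {1..N}. pmf \<mu> y \<le> pmf \<mu> x}. pmf \<mu> y / 2)
    \<le> (\<Sum>y\<in>{y \<in> {1..N}. pmf \<mu> y \<le> pmf \<mu> x}. pmf \<mu> x * g y)"
  proof (rule sum_mono)
    fix y assume "y \<in> {y \<in> {1..N}. pmf \<mu> y \<le> pmf \<mu> x}"
    then have y: "pmf \<mu> y \<le> pmf \<mu> x" by simp
    show "pmf \<mu> y / 2 \<le> pmf \<mu> x * g y"
    proof (cases "y = x")
      case False
      have s: "0 < pmf \<mu> x + pmf \<mu> y" using px pmf_nonneg[of \<mu> y] by linarith
      have "pmf \<mu> y * pmf \<mu> y \<le> pmf \<mu> y * pmf \<mu> x" using y by (intro mult_left_mono) auto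
      then have "pmf \<mu> y * (pmf \<mu> x + pmf \<mu> y) \<le> 2 * (pmf \<mu> x * pmf \<mu> y)" by (simp add: algebra_simps)
      then show ?thesis using False s by (simp add: g_def pos_le_divide_eq)
    qed (use px in \<open>simp add: g_def\<close>)
  qed
  also have "\<dots> \<le> (\<Sum>y\<in>{1..N}. pmf \<mu> x * g y)"
    using g_bounds by (intro sum_mono2) auto
  finally show ?thesis using assms by (simp add: sum_divide_distrib[symmetric] sum_distrib_left)
qed

end

section \<open>The histogram learner\<close>

definition sample_alg :: "nat \<Rightarrow> nat \<Rightarrow> nat \<Rightarrow> nat \<Rightarrow> nat \<Rightarrow> nat cond_alg" where
  "sample_alg N m d K f = Query {1..N} (scale_alg N m d K f)"

text \<open>The deficit \<open>4 * (1 / 2) ^ m\<close> has room for \<open>2 * e\<close> of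
  neglected elements, \<open>e\<close> for wrongly reported scales and \<open>e\<close> for the
  empirical deviation.\<close>

definition fits_empirical :: "nat \<Rightarrow> nat \<Rightarrow> nat \<Rightarrow> nat pmf \<Rightarrow> (nat \<Rightarrow> real) \<Rightarrow> bool" where
  "fits_empirical N m K \<tau> \<beta> \<longleftrightarrow> set_pmf \<tau> \<subseteq> {1..N} \<and>
     fits_scales {1..N} {..K} (\<lambda>k. exp (- (real k * (1 / 2) ^ m)))
       (9 * (1 / 2) ^ m) (4 * (1 / 2) ^ m) \<tau> \<beta>"

text \<open>The sample size makes \<open>(K + 1) / (n * e\<^sup>2)\<close> equal to
  \<open>1 / 3\<close>, the whole permitted failure probability. Finding a fitting \<tau> takes no
  query, so a choice operator suffices.\<close>

definition learn_alg :: "nat \<Rightarrow> nat \<Rightarrow> nat \<Rightarrow> nat \<Rightarrow> nat \<Rightarrow> nat pmf cond_alg" where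
  "learn_alg N m d K f = (let n = 3 * (K + 1) * 4 ^ m in
     bind_alg (repeat_alg n (sample_alg N m d K f))
       (\<lambda>ks. Output (SOME \<tau>. fits_empirical N m K \<tau> (\<lambda>k. real (count_list ks k) / real n))))"

lemma queries_within_learn_alg:
  "1 \<le> N \<Longrightarrow> queries_within {1..N} (learn_alg N m d K f)"
  unfolding learn_alg_def Let_def sample_alg_def
  by (intro queries_within_bind_alg queries_within_repeat_alg)
    (auto simp del: One_nat_def intro: queries_within_scale_alg)

lemma queries_at_most_learn_alg:
  "queries_at_most (learn_alg N m d K f)
     (3 * (K + 1) * 4 ^ m * (1 + (d * (2 * m) + 2 * m * 2 ^ (37 + 4 * m))))"
proof -
  have "queries_at_most (sample_alg N m d K f) (1 + (d * (2 * m) + 2 * m * 2 ^ (37 + 4 * m)))"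
    using queries_at_most_scale_alg[of N m d K f] by (simp add: sample_alg_def)
  from queries_at_most_repeat_alg[OF this, of "3 * (K + 1) * 4 ^ m"]
  have "queries_at_most (learn_alg N m d K f)
     (3 * (K + 1) * 4 ^ m * (1 + (d * (2 * m) + 2 * m * 2 ^ (37 + 4 * m))) + 0)"
    unfolding learn_alg_def Let_def by (rule queries_at_most_bind_alg) simp
  then show ?thesis by simp
qed

text \<open>The heaviest element of the set dominates all the others, so the whole set is among the
  elements summed below it.\<close>

lemma mass_of_light_tail_le:
  fixes p :: "nat \<Rightarrow> real"
  assumes fin: "finite A" and p: "\<And>x. x \<in> A \<Longrightarrow> 0 \<le> p x" and e: "0 \<le> e"
  shows "(\<Sum>x\<in>{x \<in> A. (\<Sum>y\<in>{y \<in> A. p y \<le> p x}. p y) < e}. p x) \<le> e"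
proof (cases "{x \<in> A. (\<Sum>y\<in>{y \<in> A. p y \<le> p x}. p y) < e} = {}")
  case False
  let ?T = "{x \<in> A. (\<Sum>y\<in>{y \<in> A. p y \<le> p x}. p y) < e}"
  have "finite (p ` ?T)" "p ` ?T \<noteq> {}" using fin False by auto
  then have "Max (p ` ?T) \<in> p ` ?T" by (rule Max_in)
  then obtain x where x: "x \<in> ?T" "p x = Max (p ` ?T)" by auto
  have "p y \<le> p x" if "y \<in> ?T" for y using that fin unfolding x(2) by (intro Max_ge) auto
  then have "(\<Sum>x\<in>?T. p x) \<le> (\<Sum>y\<in>{y \<in> A. p y \<le> p x}. p y)"
    using fin p by (intro sum_mono2) auto
  then show ?thesis using x(1) by simp
next
  case True
  show ?thesis unfolding True using e by simp
qed

lemma sum_count_list_le: "finite I \<Longrightarrow> (\<Sum>k\<in>I. count_list xs k) \<le> length xs"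
proof (induction xs)
  case (Cons a xs)
  have "(\<Sum>k\<in>I. count_list (a # xs) k) = (\<Sum>k\<in>I. of_bool (k = a)) + (\<Sum>k\<in>I. count_list xs k)"
    by (simp add: sum.distrib[symmetric]) (intro sum.cong, auto)
  also have "(\<Sum>k\<in>I. of_bool (k = a) :: nat) \<le> 1"
    using Cons.prems by (simp add: of_bool_def sum.delta)
  finally show ?case using Cons by simp
qed simp

section \<open>Correctness of the learner for given parameters\<close>

locale scale_learning =
  fixes N m d K f :: nat and \<mu> :: "nat pmf" and orc :: "nat set \<Rightarrow> nat pmf" and e :: real
  assumes N: "1 \<le> N" and supp: "set_pmf \<mu> \<subseteq> {1..N}" and orc: "cond_oracle {1..N} \<mu> orc"
    and m: "3 \<le> m" and e_def: "e = (1 / 2) ^ m"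
    and d: "(1 / 2) ^ (2 ^ d) \<le> e / real N" and K: "ln (real N / e) \<le> real K * e"
    and f: "(1 - e / real N) ^ f \<le> e"
begin

text \<open>The first condition bounds the scales, the bisection and the fuel, and discards at most
  \<open>N\<close> elements of mass below \<open>e / N\<close>; the second makes
  \<open>pmf \<mu> x * G\<close> at least \<open>e / 2\<close>. Each loses mass at most
  \<open>e\<close>.\<close>

definition good :: "nat set" where
  "good = {x \<in> set_pmf \<mu>. e / real N \<le> pmf \<mu> x \<and>
     e \<le> (\<Sum>y\<in>{y \<in> {1..N}. pmf \<mu> y \<le> pmf \<mu> x}. pmf \<mu> y)}"

definition close_scales :: "nat \<Rightarrow> nat set" where
  "close_scales x = {k. log_close (9 * e) (pmf \<mu> x) (exp (- (real k * e)))}"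

definition sp :: "nat \<Rightarrow> nat pmf" where "sp x = run orc (scale_alg N m d K f x)"

text \<open>The law of the reported scale, errors of the scale estimate included; the empirical
  distribution is compared with this law, not with that of the true scales.\<close>

definition b :: "nat \<Rightarrow> real" where "b k = (\<Sum>x\<in>{1..N}. pmf \<mu> x * pmf (sp x) k)"

lemma e: "0 < e" "e \<le> 1 / 8"
proof -
  have "(1 / 2 :: real) ^ m \<le> (1 / 2) ^ 3" using m by (intro power_decreasing) auto
  then show "0 < e" "e \<le> 1 / 8" by (auto simp: e_def power3_eq_cube)
qed

lemma mass_Omega: "(\<Sum>x\<in>{1..N}. pmf \<mu> x) = 1"
  using supp by (intro sum_pmf_eq_1) auto

lemma orc_Omega: "orc {1..N} = \<mu>"
proof -
  have ne: "set_pmf \<mu> \<inter> {1..N} \<noteq> {}" using supp set_pmf_not_empty[of \<mu>] by blast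
  then have "orc {1..N} = cond_pmf \<mu> {1..N}" using orc unfolding cond_oracle_def by auto
  also have "\<dots> = \<mu>"
  proof (rule pmf_eqI)
    fix i
    have "measure_pmf.prob \<mu> {1..N} = 1"
      using mass_Omega by (simp add: measure_measure_pmf_finite)
    moreover have "pmf \<mu> i = 0" if "i \<notin> {1..N}"
      unfolding pmf_eq_0_set_pmf using that supp by blast
    ultimately show "pmf (cond_pmf \<mu> {1..N}) i = pmf \<mu> i" by (auto simp: pmf_cond[OF ne] simp del: One_nat_def)
  qed
  finally show ?thesis .
qed

lemma pmf_sample: "pmf (run orc (sample_alg N m d K f)) k = b k"
proof -
  have "pmf (run orc (sample_alg N m d K f)) k = expec \<mu> (\<lambda>x. pmf (sp x) k)"
    by (simp only: sample_alg_def run.simps orc_Omega pmf_bind sp_def)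
  also have "\<dots> = b k" unfolding b_def using supp by (intro expec_finite_support) auto
  finally show ?thesis .
qed

lemma set_sample: "set_pmf (run orc (sample_alg N m d K f)) \<subseteq> {..K}"
  using set_run_scale_alg by (force simp: sample_alg_def)

lemma sum_sp: "(\<Sum>k\<le>K. pmf (sp x) k) = 1"
  using set_run_scale_alg[of orc N m d K f x] by (intro sum_pmf_eq_1) (auto simp: sp_def)

lemma finite_good: "finite good"
proof (rule finite_subset)
  show "good \<subseteq> {1..N}" unfolding good_def using supp by blast
qed simp

lemma good_prob:
  assumes x: "x \<in> good"
  shows "1 - e \<le> (\<Sum>k\<in>{..K} \<inter> close_scales x. pmf (sp x) k)"
proof -
  have x': "x \<in> set_pmf \<mu>" "e / real N \<le> pmf \<mu> x"
    "e \<le> (\<Sum>y\<in>{y \<in> {1..N}. pmf \<mu> y \<le> pmf \<mu> x}. pmf \<mu> y)" using x by (auto simp: good_def)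
  interpret cond_sampling N \<mu> orc x by unfold_locales (use supp orc x' in auto)
  have eN: "0 < e / real N" using e N by simp
  have "ln (e / real N) \<le> ln (pmf \<mu> x)" using x'(2) eN px by simp
  then have "- ln (pmf \<mu> x) \<le> ln (real N / e)" using e N by (simp add: ln_div)
  then have K': "- ln (pmf \<mu> x) \<le> real K * (1 / 2) ^ m" using K by (simp add: e_def)
  have "(1 - pmf \<mu> x) ^ f \<le> (1 - e / real N) ^ f"
    using x'(2) pmf_le_1[of \<mu> x] by (intro power_mono) auto
  then have f': "(1 - pmf \<mu> x) ^ f \<le> (1 / 2) ^ m" using f by (simp add: e_def)
  have "measure_pmf.prob (sp x) {k. k \<notin> close_scales x} \<le> e"
    using prob_scale_alg[OF m light_mass_ge[OF x'(3)[unfolded e_def]] order_trans[OF d x'(2)] K' f',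
        folded e_def]
    by (simp add: sp_def close_scales_def)
  then have "1 - e \<le> measure_pmf.prob (sp x) (close_scales x)"
    using measure_pmf.prob_compl[of "close_scales x" "sp x"]
    by (simp add: Compl_eq_Diff_UNIV[symmetric] Collect_neg_eq)
  also have "\<dots> \<le> measure_pmf.prob (sp x) ({..K} \<inter> close_scales x)"
    using set_run_scale_alg[of orc N m d K f x]
    by (intro measure_pmf.finite_measure_mono_AE AE_pmfI) (auto simp: sp_def)
  also have "\<dots> = (\<Sum>k\<in>{..K} \<inter> close_scales x. pmf (sp x) k)"
    by (simp add: measure_measure_pmf_finite)
  finally show ?thesis .
qed

lemma good_mass: "1 - 2 * e \<le> (\<Sum>x\<in>good. pmf \<mu> x)"
proof -
  define T1 where "T1 = {x \<in> {1..N}. pmf \<mu> x < e / real N}"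
  define T2 where "T2 = {x \<in> {1..N}. (\<Sum>y\<in>{y \<in> {1..N}. pmf \<mu> y \<le> pmf \<mu> x}. pmf \<mu> y) < e}"
  have fin: "finite T1" "finite T2" "finite good" by (auto simp: T1_def T2_def finite_good)
  have "(\<Sum>x\<in>T1. pmf \<mu> x) \<le> (\<Sum>x\<in>T1. e / real N)" by (intro sum_mono) (auto simp: T1_def)
  also have "\<dots> \<le> (\<Sum>x\<in>{1..N}. e / real N)" using e by (intro sum_mono2) (auto simp: T1_def)
  also have "\<dots> = e" using N by simp
  finally have t1: "(\<Sum>x\<in>T1. pmf \<mu> x) \<le> e" .
  have t2: "(\<Sum>x\<in>T2. pmf \<mu> x) \<le> e"
    unfolding T2_def using e by (intro mass_of_light_tail_le) auto
  have eN: "0 < e / real N" using e N by simp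
  have un: "sum (pmf \<mu>) (A \<union> B) \<le> sum (pmf \<mu>) A + sum (pmf \<mu>) B" if "finite A" "finite B" for A B
    using sum.union_inter[OF that, of "pmf \<mu>"] sum_nonneg[of "A \<inter> B" "pmf \<mu>"] by simp
  have "{1..N} \<subseteq> good \<union> (T1 \<union> T2)"
  proof
    fix x assume x: "x \<in> {1..N}"
    show "x \<in> good \<union> (T1 \<union> T2)"
    proof (cases "x \<in> set_pmf \<mu>")
      case False
      then have "pmf \<mu> x = 0" by (simp add: pmf_eq_0_set_pmf)
      then show ?thesis using x eN by (simp add: T1_def)
    qed (use x in \<open>auto simp: good_def T1_def T2_def\<close>)
  qed
  then have "1 \<le> (\<Sum>x\<in>good \<union> (T1 \<union> T2). pmf \<mu> x)"
    unfolding mass_Omega[symmetric] using fin by (intro sum_mono2) auto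
  also have "\<dots> \<le> (\<Sum>x\<in>good. pmf \<mu> x) + ((\<Sum>x\<in>T1. pmf \<mu> x) + (\<Sum>x\<in>T2. pmf \<mu> x))"
    using fin un[of good "T1 \<union> T2"] un[of T1 T2] by simp
  finally show ?thesis using t1 t2 by linarith
qed

text \<open>The joint law of an element and its reported scale couples \<mu> with \<open>b\<close>.
  Shrinking column \<open>k\<close> by \<open>t k\<close> makes it fit under
  \<open>\<beta> k\<close>, at a total cost of at most the \<open>l1\<close> distance. Deleting the
  pairs that are not close costs at most \<open>3 * e\<close>.\<close>

lemma mu_fits_empirical:
  assumes \<beta>0: "\<And>k. 0 \<le> \<beta> k" and dev: "(\<Sum>k\<le>K. \<bar>\<beta> k - b k\<bar>) \<le> e"
  shows "fits_empirical N m K \<mu> \<beta>"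
proof -
  define t where "t k = min 1 (\<beta> k / b k)" for k
  define h where "h x k = pmf \<mu> x * pmf (sp x) k * t k" for x k
  define g where "g x k = (if k \<in> close_scales x then h x k else 0)" for x k
  have b0: "0 \<le> b k" for k unfolding b_def by (intro sum_nonneg mult_nonneg_nonneg) auto
  have t: "0 \<le> t k" "t k \<le> 1" for k using b0 \<beta>0 by (auto simp: t_def)
  have bt: "b k * t k \<le> \<beta> k" "b k * (1 - t k) \<le> \<bar>\<beta> k - b k\<bar>" for k
    using b0[of k] \<beta>0[of k] by (auto simp: t_def min_def field_simps)
  have h0: "0 \<le> h x k" for x k using t by (simp add: h_def)
  have gh: "0 \<le> g x k" "g x k \<le> h x k" for x k using h0 by (auto simp: g_def)
  have hsum: "(\<Sum>x\<in>{1..N}. h x k) = b k * t k" for k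
    by (simp add: h_def b_def sum_distrib_right)
  have row: "(\<Sum>k\<le>K. g x k) \<le> pmf \<mu> x" for x
  proof -
    have "(\<Sum>k\<le>K. g x k) \<le> (\<Sum>k\<le>K. pmf \<mu> x * pmf (sp x) k)"
      using t by (intro sum_mono order_trans[OF gh(2)]) (auto simp: h_def intro!: mult_left_le)
    then show ?thesis by (simp add: sum_distrib_left[symmetric] sum_sp)
  qed
  have col: "(\<Sum>x\<in>{1..N}. g x k) \<le> \<beta> k" for k
    using sum_mono[of "{1..N}" "\<lambda>x. g x k" "\<lambda>x. h x k"] gh hsum[of k] bt(1)[of k] by fastforce
  have "1 - 3 * e \<le> (1 - 2 * e) * (1 - e)" using e by (simp add: algebra_simps)
  also have "\<dots> \<le> (\<Sum>x\<in>good. pmf \<mu> x) * (1 - e)"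
    using good_mass e by (intro mult_right_mono) auto
  also have "\<dots> \<le> (\<Sum>x\<in>good. pmf \<mu> x * (\<Sum>k\<in>{..K} \<inter> close_scales x. pmf (sp x) k))"
    unfolding sum_distrib_right by (intro sum_mono mult_left_mono good_prob) auto
  also have "\<dots> \<le> (\<Sum>x\<in>{1..N}. pmf \<mu> x * (\<Sum>k\<in>{..K} \<inter> close_scales x. pmf (sp x) k))"
    using supp by (intro sum_mono2) (auto simp: good_def intro!: mult_nonneg_nonneg sum_nonneg)
  also have "\<dots> = (\<Sum>x\<in>{1..N}. \<Sum>k\<in>{..K} \<inter> close_scales x. pmf \<mu> x * pmf (sp x) k)"
    by (simp add: sum_distrib_left)
  also have "\<dots> \<le> (\<Sum>x\<in>{1..N}. \<Sum>k\<le>K. g x k + pmf \<mu> x * pmf (sp x) k * (1 - t k))"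
  proof (rule sum_mono)
    fix x
    have "(\<Sum>k\<in>{..K} \<inter> close_scales x. pmf \<mu> x * pmf (sp x) k)
      \<le> (\<Sum>k\<in>{..K} \<inter> close_scales x. g x k + pmf \<mu> x * pmf (sp x) k * (1 - t k))"
      by (intro sum_mono) (auto simp: g_def h_def algebra_simps)
    also have "\<dots> \<le> (\<Sum>k\<le>K. g x k + pmf \<mu> x * pmf (sp x) k * (1 - t k))"
      using gh t by (intro sum_mono2) (auto intro!: add_nonneg_nonneg mult_nonneg_nonneg)
    finally show "(\<Sum>k\<in>{..K} \<inter> close_scales x. pmf \<mu> x * pmf (sp x) k)
      \<le> (\<Sum>k\<le>K. g x k + pmf \<mu> x * pmf (sp x) k * (1 - t k))" .
  qed
  also have "\<dots> = (\<Sum>x\<in>{1..N}. \<Sum>k\<le>K. g x k)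
      + (\<Sum>x\<in>{1..N}. \<Sum>k\<le>K. pmf \<mu> x * pmf (sp x) k * (1 - t k))"
    by (simp add: sum.distrib)
  also have "(\<Sum>x\<in>{1..N}. \<Sum>k\<le>K. pmf \<mu> x * pmf (sp x) k * (1 - t k)) = (\<Sum>k\<le>K. b k * (1 - t k))"
    by (subst sum.swap) (simp add: b_def sum_distrib_right)
  also have "\<dots> \<le> (\<Sum>k\<le>K. \<bar>\<beta> k - b k\<bar>)" by (intro sum_mono bt)
  finally have tot: "1 - 4 * e \<le> (\<Sum>x\<in>{1..N}. \<Sum>k\<le>K. g x k)" using dev by simp
  have "log_close (9 * e) (pmf \<mu> x) (exp (- (real k * e)))" if "0 < g x k" for x k
    using that by (auto simp: g_def close_scales_def split: if_splits)
  then show ?thesis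
    unfolding fits_empirical_def fits_scales_def e_def[symmetric]
    using supp gh(1) row col tot by blast
qed

text \<open>With \<open>D = 9 * e\<close> and \<open>\<eta> = 4 * e\<close> the stronger condition
  is \<open>4 * D \<le> \<epsilon>\<close>, hence the 36. Only a large empirical deviation can spoil
  the output.\<close>

lemma prob_learn_alg:
  assumes \<epsilon>: "36 * e \<le> \<epsilon>" "\<epsilon> \<le> 1"
  shows "2 / 3 \<le> measure_pmf.prob (run orc (learn_alg N m d K f))
    {\<tau>. set_pmf \<tau> \<subseteq> {1..N} \<and> hist_div {1..N} \<mu> \<tau> \<le> \<epsilon>}"
proof -
  define n where "n = 3 * (K + 1) * 4 ^ m"
  define \<beta> where "\<beta> ks k = real (count_list ks k) / real n" for ks :: "nat list" and k
  define S where "S = run orc (sample_alg N m d K f)"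
  define R where "R = {ks. e < (\<Sum>k\<le>K. \<bar>\<beta> ks k - b k\<bar>)}"
  let ?E = "{\<tau>. set_pmf \<tau> \<subseteq> {1..N} \<and> hist_div {1..N} \<mu> \<tau> \<le> \<epsilon>}"
  have n: "0 < n" by (simp add: n_def)
  have four: "4 ^ m * e\<^sup>2 = 1"
    by (simp add: e_def power2_eq_square power_mult_distrib[symmetric])
  have "measure_pmf.prob (replicate_pmf n S) R \<le> real (card {..K}) / (real n * e\<^sup>2)"
    unfolding R_def \<beta>_def S_def pmf_sample[symmetric]
    using set_sample e n by (intro empirical_l1_deviation) auto
  also have "real n * e\<^sup>2 = 3 * real (K + 1) * (4 ^ m * e\<^sup>2)" by (simp add: n_def)
  also have "real (card {..K}) / \<dots> = 1 / 3" unfolding four by simp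
  finally have PR: "measure_pmf.prob (replicate_pmf n S) R \<le> 1 / 3" .
  have run: "run orc (learn_alg N m d K f)
    = replicate_pmf n S \<bind> (\<lambda>ks. return_pmf (SOME \<tau>. fits_empirical N m K \<tau> (\<beta> ks)))"
    by (simp only: learn_alg_def Let_def run_bind_alg run_repeat_alg n_def[symmetric] S_def
        \<beta>_def[abs_def] run.simps)
  have "measure_pmf.prob (run orc (learn_alg N m d K f)) (- ?E) \<le> 1 / 3 + 0"
    unfolding run
  proof (rule prob_bind_pmf_le[OF PR])
    fix ks assume ks: "ks \<in> set_pmf (replicate_pmf n S)" "ks \<notin> R"
    define \<tau> where "\<tau> = (SOME \<tau>. fits_empirical N m K \<tau> (\<beta> ks))"
    \<comment> \<open>\<mu> itself is a witness, so the choice operator returns a \<tau> that fits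
      the same empirical law.\<close>
    have \<mu>: "fits_empirical N m K \<mu> (\<beta> ks)"
      using ks(2) by (intro mu_fits_empirical) (auto simp: R_def \<beta>_def)
    then have \<tau>: "fits_empirical N m K \<tau> (\<beta> ks)" unfolding \<tau>_def by (rule someI)
    have "(\<Sum>k\<le>K. \<beta> ks k) = real (\<Sum>k\<le>K. count_list ks k) / real n"
      by (simp add: \<beta>_def sum_divide_distrib)
    also have "\<dots> \<le> real (length ks) / real n"
      by (intro divide_right_mono) (simp_all only: of_nat_le_iff sum_count_list_le finite_atMost of_nat_0_le_iff)
    also have "\<dots> = 1" using ks(1) n by (simp add: set_replicate_pmf)
    finally have \<beta>1: "(\<Sum>k\<le>K. \<beta> ks k) \<le> 1" .
    have "hist_div {1..N} \<mu> \<tau> \<le> \<epsilon>"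
      using \<mu> \<tau> e \<epsilon> unfolding fits_empirical_def e_def[symmetric]
      by (intro hist_div_le_of_fits_scales[OF _ _ supp \<beta>1, where D = "9 * e" and \<eta> = "4 * e"]) auto
    moreover have "set_pmf \<tau> \<subseteq> {1..N}" using \<tau> by (simp add: fits_empirical_def)
    ultimately show "measure_pmf.prob (return_pmf (SOME \<tau>. fits_empirical N m K \<tau> (\<beta> ks))) (- ?E) \<le> 0"
      unfolding \<tau>_def[symmetric] by simp
  qed simp
  then show ?thesis
    using measure_pmf.prob_compl[of ?E "run orc (learn_alg N m d K f)"] by (simp add: Compl_eq_Diff_UNIV)
qed

end

section \<open>Choice of parameters and asymptotics of the query bound\<close>

definition clog :: "real \<Rightarrow> nat" where "clog y = nat \<lceil>log 2 y\<rceil>"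

lemma clog:
  assumes "1 \<le> y"
  shows "y \<le> 2 ^ clog y" "2 ^ clog y \<le> 2 * y" "real (clog y) \<le> log 2 y + 1"
proof -
  have l: "0 \<le> log 2 y" using assms by simp
  then have c: "log 2 y \<le> real (clog y)" "real (clog y) \<le> log 2 y + 1"
    by (auto simp: clog_def)
  then show "real (clog y) \<le> log 2 y + 1" by simp
  have "y = 2 powr (log 2 y)" using assms by simp
  also have "\<dots> \<le> 2 powr real (clog y)" using c by (intro powr_mono) auto
  finally show "y \<le> 2 ^ clog y" by (simp add: powr_realpow)
  have "(2::real) ^ clog y = 2 powr real (clog y)" by (simp add: powr_realpow)
  also have "\<dots> \<le> 2 powr (log 2 y + 1)" using c by (intro powr_mono) auto
  also have "\<dots> = 2 * y" using assms by (simp add: powr_add)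
  finally show "2 ^ clog y \<le> 2 * y" .
qed

text \<open>The 64 exceeds the factor 36 of \<open>prob_learn_alg\<close> and makes
  \<open>prec \<epsilon>\<close> at least 3 for \<open>\<epsilon> < 1\<close>.\<close>

definition prec :: "real \<Rightarrow> nat" where "prec \<epsilon> = clog (64 / \<epsilon>)"

text \<open>With \<open>e = (1 / 2) ^ prec \<epsilon>\<close>, two to this power is at least
  \<open>N / e\<close>. Densities down to this power of 1/2, and scales up to
  \<open>width N \<epsilon> * 2 ^ prec \<epsilon>\<close>, therefore reach every mass above
  \<open>e / N\<close>.\<close>

definition width :: "nat \<Rightarrow> real \<Rightarrow> nat" where "width N \<epsilon> = clog (real N) + prec \<epsilon>"

text \<open>The fuel does not enter the query bound, so any sufficient value will do.\<close>

definition fuel :: "nat \<Rightarrow> nat \<Rightarrow> nat" where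
  "fuel N m = (SOME f. (1 - (1 / 2) ^ m / real N) ^ f \<le> (1 / 2) ^ m)"

text \<open>For \<open>\<epsilon> \<ge> 1\<close> every distribution over the domain is a correct
  output, as the divergence never exceeds 1.\<close>

definition histogram_learner :: "nat \<Rightarrow> real \<Rightarrow> nat pmf cond_alg" where
  "histogram_learner N \<epsilon> = (if 1 \<le> \<epsilon> then Output (return_pmf 1) else
     learn_alg N (prec \<epsilon>) (clog (real (width N \<epsilon>))) (width N \<epsilon> * 2 ^ prec \<epsilon>) (fuel N (prec \<epsilon>)))"

definition query_bound :: "nat \<Rightarrow> real \<Rightarrow> nat" where
  "query_bound N \<epsilon> = (if 1 \<le> \<epsilon> then 0 else
     3 * (width N \<epsilon> * 2 ^ prec \<epsilon> + 1) * 4 ^ prec \<epsilon> *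
       (1 + (clog (real (width N \<epsilon>)) * (2 * prec \<epsilon>) + 2 * prec \<epsilon> * 2 ^ (37 + 4 * prec \<epsilon>))))"

lemma hist_div_le_1: "finite \<Omega> \<Longrightarrow> set_pmf \<mu> \<subseteq> \<Omega> \<Longrightarrow> hist_div \<Omega> \<mu> \<tau> \<le> 1"
  by (rule hist_div_attained(2))
    (use permutes_id[of \<Omega>] in \<open>auto simp: hist_div_set_iff hist_mismatch_def intro!: exI[of _ id]\<close>)

lemma prec:
  assumes "0 < \<epsilon>" "\<epsilon> < 1"
  shows "64 / \<epsilon> \<le> 2 ^ prec \<epsilon>" "2 ^ prec \<epsilon> \<le> 128 / \<epsilon>" "real (prec \<epsilon>) \<le> log 2 (64 / \<epsilon>) + 1" "3 \<le> prec \<epsilon>"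
proof -
  have y: "1 \<le> 64 / \<epsilon>" using assms by (simp add: field_simps)
  show 1: "64 / \<epsilon> \<le> 2 ^ prec \<epsilon>" and "2 ^ prec \<epsilon> \<le> 128 / \<epsilon>" and "real (prec \<epsilon>) \<le> log 2 (64 / \<epsilon>) + 1"
    using clog[OF y] by (auto simp: prec_def)
  show "3 \<le> prec \<epsilon>"
  proof (rule ccontr)
    assume "\<not> 3 \<le> prec \<epsilon>"
    then have "(2::real) ^ prec \<epsilon> \<le> 2 ^ 3" by (intro power_increasing) auto
    moreover have "64 \<le> 64 / \<epsilon>" using assms by (simp add: field_simps)
    ultimately show False using 1 by simp
  qed
qed

lemma solves_histogram_learner:
  assumes N: "1 \<le> N" and \<epsilon>: "0 < \<epsilon>"
  shows "solves_histogram_learning {1..N} \<epsilon> (histogram_learner N \<epsilon>)"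
proof (cases "1 \<le> \<epsilon>")
  case True
  have "hist_div {1..N} \<mu> (return_pmf 1) \<le> \<epsilon>" if "set_pmf \<mu> \<subseteq> {1..N}" for \<mu>
    using hist_div_le_1[OF _ that] True by (meson finite_atLeastAtMost order_trans)
  then show ?thesis using True N by (auto simp: solves_histogram_learning_def histogram_learner_def)
next
  case False
  define m where "m = prec \<epsilon>"
  define w where "w = width N \<epsilon>"
  define e :: real where "e = (1 / 2) ^ m"
  have p: "64 / \<epsilon> \<le> 2 ^ m" "3 \<le> m" using prec[of \<epsilon>] False \<epsilon> by (auto simp: m_def)
  have e0: "0 < e" "e \<le> 1" by (auto simp: e_def power_le_one)
  have "64 * e \<le> \<epsilon>" using p(1) \<epsilon> by (simp add: e_def power_one_over field_simps)
  then have e\<epsilon>: "36 * e \<le> \<epsilon>" using e0 by linarith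
  have Nw: "real N / e \<le> 2 ^ w"
  proof -
    have "real N \<le> 2 ^ clog (real N)" using clog(1)[of "real N"] N by simp
    then have "real N * 2 ^ m \<le> 2 ^ clog (real N) * 2 ^ m" by (intro mult_right_mono) auto
    then show ?thesis by (simp add: e_def w_def width_def power_add m_def power_one_over)
  qed
  have w1: "1 \<le> w" using p by (simp add: w_def width_def m_def)
  have d: "(1 / 2) ^ (2 ^ clog (real w)) \<le> e / real N"
  proof -
    have "real w \<le> 2 ^ clog (real w)" using clog(1)[of "real w"] w1 by simp
    then have "real w \<le> real (2 ^ clog (real w))" by simp
    then have "w \<le> 2 ^ clog (real w)" by (simp only: of_nat_le_iff)
    then have "(1 / 2 :: real) ^ (2 ^ clog (real w)) \<le> (1 / 2) ^ w" by (intro power_decreasing) auto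
    also have "\<dots> = 1 / 2 ^ w" by (simp add: power_one_over)
    also have "\<dots> \<le> 1 / (real N / e)" using Nw N e0 by (intro divide_left_mono) auto
    finally show ?thesis by simp
  qed
  have K: "ln (real N / e) \<le> real (w * 2 ^ m) * e"
  proof -
    have "ln (real N / e) \<le> ln (2 ^ w)" using Nw N e0 by simp
    also have "\<dots> = real w * ln 2" by (simp add: ln_realpow)
    also have "\<dots> \<le> real w * 1" using ln_le_minus_one[of "2::real"] by (intro mult_left_mono) auto
    also have "\<dots> = real (w * 2 ^ m) * e" by (simp add: e_def power_one_over)
    finally show ?thesis .
  qed
  have f: "(1 - e / real N) ^ fuel N m \<le> e"
  proof -
    have "e / real N \<le> 1" using e0 N by (simp add: divide_le_eq)
    then have "\<exists>f. (1 - e / real N) ^ f < e" using e0 N by (intro real_arch_pow_inv) auto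
    then obtain f where "(1 - e / real N) ^ f < e" by blast
    then have "(1 - (1 / 2) ^ m / real N) ^ f \<le> (1 / 2) ^ m" by (simp add: e_def)
    from someI[where P = "\<lambda>f. (1 - (1 / 2) ^ m / real N) ^ f \<le> (1 / 2) ^ m", OF this] show ?thesis by (simp add: fuel_def e_def)
  qed
  have L: "histogram_learner N \<epsilon> = learn_alg N m (clog (real w)) (w * 2 ^ m) (fuel N m)"
    using False by (simp add: histogram_learner_def m_def w_def)
  show ?thesis
    unfolding solves_histogram_learning_def L
  proof (intro conjI allI impI)
    fix \<mu> orc assume a: "set_pmf \<mu> \<subseteq> {1..N} \<and> cond_oracle {1..N} \<mu> orc"
    interpret scale_learning N m "clog (real w)" "w * 2 ^ m" "fuel N m" \<mu> orc e
      by unfold_locales (use N a p d K f in \<open>auto simp: e_def\<close>)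
    show "2 / 3 \<le> measure_pmf.prob (run orc (learn_alg N m (clog (real w)) (w * 2 ^ m) (fuel N m)))
      {\<tau>. set_pmf \<tau> \<subseteq> {1..N} \<and> hist_div {1..N} \<mu> \<tau> \<le> \<epsilon>}"
      using e\<epsilon> False by (intro prob_learn_alg) auto
  qed (rule queries_within_learn_alg[OF N])
qed

lemma queries_at_most_histogram_learner:
  "queries_at_most (histogram_learner N \<epsilon>) (query_bound N \<epsilon>)"
proof (cases "1 \<le> \<epsilon>")
  case False
  show ?thesis unfolding histogram_learner_def query_bound_def if_not_P[OF False]
    by (rule queries_at_most_learn_alg)
qed (simp add: histogram_learner_def)

lemma ln_3_gt_1: "1 < ln (3::real)"
proof -
  have "ln (exp 1) < ln (3::real)" using e_less_272 by (subst ln_less_cancel_iff) auto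
  then show ?thesis by simp
qed

lemma log_2_le: "1 \<le> y \<Longrightarrow> log 2 y \<le> 2 * ln y"
proof -
  assume y: "1 \<le> y"
  have "1 / 2 \<le> ln (2::real)" using ln_le_minus_one[of "1 / 2 :: real"] by (simp add: ln_div)
  then have "ln y * 1 \<le> ln y * (2 * ln 2)" using y by (intro mult_left_mono) auto
  then show ?thesis using ln_gt_zero[of "2::real"] by (simp add: log_def pos_divide_le_eq mult.commute mult.left_commute)
qed

text \<open>With \<open>T = 2 ^ prec \<epsilon>\<close>, the sample size contributes
  \<open>T ^ 3\<close> and the budget \<open>T ^ 4\<close>. One factor
  \<open>1 + ln (1 / \<epsilon>)\<close> comes from the width and two from probes and repetitions.
  Since \<open>ln (ln N)\<close> is at least \<open>c0 > 0\<close>, constants can be multiplied by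
  \<open>L / c0\<close> to join the product.\<close>

lemma query_bound_le:
  defines "c0 \<equiv> ln (ln (3::real))"
  defines "C \<equiv> 60 * 128 ^ 7 * (1 / c0 + 14 * (2 + 9 / c0) + 7 * 2 ^ 38 / c0)"
  assumes N: "3 \<le> N" and \<epsilon>: "0 < \<epsilon>" "\<epsilon> < 1"
  shows "real (query_bound N \<epsilon>) \<le>
    C * (ln (real N) * ln (ln (real N)) / \<epsilon> ^ 7) * (1 + ln (1 / \<epsilon>)) ^ 3"
proof -
  define a where "a = ln (1 / \<epsilon>)"
  define n where "n = ln (real N)"
  define L where "L = ln n"
  define m where "m = prec \<epsilon>"
  define w where "w = width N \<epsilon>"
  define d where "d = clog (real w)"
  define T where "T = (2::real) ^ m"
  have c0: "0 < c0" using ln_3_gt_1 by (simp add: c0_def)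
  have a: "0 \<le> a" using \<epsilon> by (simp add: a_def)
  have "ln 3 \<le> n" using N by (simp add: n_def)
  then have n: "1 \<le> n" and L: "c0 \<le> L" using ln_3_gt_1 by (auto simp: L_def c0_def)
  have T: "1 \<le> T" "T \<le> 128 / \<epsilon>" using prec[OF \<epsilon>] by (auto simp: T_def m_def)
  have m: "real m \<le> 7 * (1 + a)"
  proof -
    have "log 2 (64 / \<epsilon>) = log 2 (64 * (1 / \<epsilon>))" by simp
    also have "\<dots> = log 2 64 + log 2 (1 / \<epsilon>)" using \<epsilon> by (subst log_mult) auto
    also have "log 2 (64::real) = 6" using log_pow_cancel[of "2::real" 6] by simp
    also have "log 2 (1 / \<epsilon>) \<le> 2 * a" unfolding a_def using \<epsilon> by (intro log_2_le) auto
    finally show ?thesis using prec(3)[OF \<epsilon>] a by (simp add: m_def)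
  qed
  have m1: "1 \<le> m" using prec(4)[OF \<epsilon>] by (simp add: m_def)
  have w: "real w \<le> 10 * n * (1 + a)"
  proof -
    have "real (clog (real N)) \<le> 2 * n + 1"
      using clog(3)[of "real N"] log_2_le[of "real N"] N by (simp add: n_def)
    also have "\<dots> \<le> 3 * n * (1 + a)" using n a mult_left_mono[of 1 "1 + a" "3 * n"] by linarith
    finally have "real w \<le> 3 * n * (1 + a) + 7 * (1 + a)" using m by (simp add: w_def width_def m_def)
    also have "7 * (1 + a) \<le> 7 * n * (1 + a)" using n a by (intro mult_right_mono) auto
    finally show ?thesis by (simp add: algebra_simps)
  qed
  have w1: "1 \<le> real w" using m1 by (simp add: w_def width_def m_def)
  have d: "real d \<le> (2 + 9 / c0) * (1 + a) * L"
  proof -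
    have "real d \<le> 2 * ln (real w) + 1" using clog(3)[OF w1] log_2_le[OF w1] by (simp add: d_def)
    also have "ln (real w) \<le> ln (10 * n * (1 + a))" using w w1 by simp
    also have "\<dots> = ln 10 + L + ln (1 + a)" using n a by (simp add: ln_mult L_def)
    also have "ln (1 + a) \<le> a" using a ln_add_one_self_le_self by simp
    also have "ln (10::real) \<le> 4"
    proof -
      have "(10::real) \<le> 2 ^ 4" by simp
      then have "ln (10::real) \<le> ln (2 ^ 4)" by (subst ln_le_cancel_iff) auto
      also have "\<dots> = 4 * ln 2" by (subst ln_realpow) auto
      also have "\<dots> \<le> 4" using ln_le_minus_one[of "2::real"] by simp
      finally show ?thesis .
    qed
    finally have "real d \<le> 2 * L + 9 * (1 + a)" using a by simp
    also have "\<dots> \<le> 2 * (1 + a) * L + 9 * (1 + a) * (L / c0)"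
    proof (rule add_mono)
      show "2 * L \<le> 2 * (1 + a) * L" using a L c0 by (intro mult_right_mono) auto
      have "1 \<le> L / c0" using L c0 by simp
      then show "9 * (1 + a) \<le> 9 * (1 + a) * (L / c0)"
        using mult_left_mono[of 1 "L / c0" "9 * (1 + a)"] a by simp
    qed
    also have "\<dots> = (2 + 9 / c0) * (1 + a) * L" by (simp add: algebra_simps add_divide_distrib)
    finally show ?thesis .
  qed
  have X: "3 * (real w * T + 1) * T\<^sup>2 \<le> 60 * n * (1 + a) * T ^ 3"
  proof -
    have "1 \<le> real w * T" using mult_mono[of 1 "real w" 1 T] w1 T by simp
    then have "3 * (real w * T + 1) * T\<^sup>2 \<le> 3 * (2 * (real w * T)) * T\<^sup>2"
      by (intro mult_right_mono) (auto simp: mult.commute)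
    also have "\<dots> = 6 * real w * T ^ 3" by (simp add: power2_eq_square power3_eq_cube)
    also have "\<dots> \<le> 6 * (10 * n * (1 + a)) * T ^ 3" using w T by (intro mult_right_mono mult_left_mono) auto
    finally show ?thesis by simp
  qed
  define C2 where "C2 = 1 / c0 + 14 * (2 + 9 / c0) + 7 * 2 ^ 38 / c0"
  have Y: "1 + (real d * (2 * real m) + 2 * real m * (2 ^ 37 * T ^ 4)) \<le> C2 * L * (1 + a)\<^sup>2 * T ^ 4"
  proof -
    have T4: "1 \<le> T ^ 4" using T by simp
    have L1: "1 \<le> L / c0" using L c0 by simp
    have s1: "1 \<le> (1 + a)\<^sup>2" using a by simp
    have s2: "1 + a \<le> (1 + a)\<^sup>2" using a by (simp add: power2_eq_square)
    have i1: "1 \<le> L / c0 * (1 + a)\<^sup>2" using mult_mono[OF L1 s1] L c0 by simp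
    have "real d * (2 * real m) \<le> ((2 + 9 / c0) * (1 + a) * L) * (2 * (7 * (1 + a)))"
      using d m a L c0 by (intro mult_mono) auto
    moreover have "(u * v * L) * (2 * (7 * v)) = 14 * u * L * v\<^sup>2" for u v
      by (simp add: power2_eq_square)
    ultimately have "real d * (2 * real m) \<le> 14 * (2 + 9 / c0) * L * (1 + a)\<^sup>2" by metis
    moreover have "2 ^ 38 * real m \<le> 7 * 2 ^ 38 / c0 * L * (1 + a)\<^sup>2"
    proof -
      have "real m \<le> 7 * (1 + a)\<^sup>2" by (rule order_trans[OF m mult_left_mono[OF s2]]) simp
      also have "\<dots> \<le> 7 * (1 + a)\<^sup>2 * (L / c0)"
        using mult_left_mono[OF L1, of "7 * (1 + a)\<^sup>2"] by simp
      finally have "2 ^ 38 * real m \<le> 2 ^ 38 * (7 * (1 + a)\<^sup>2 * (L / c0))"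
        by (rule mult_left_mono) simp
      moreover have "u * (7 * v * (L / c0)) = 7 * u / c0 * L * v" for u v by simp
      ultimately show ?thesis by metis
    qed
    moreover have "(1 / c0 + u + v) * L * (1 + a)\<^sup>2
      = L / c0 * (1 + a)\<^sup>2 + u * L * (1 + a)\<^sup>2 + v * L * (1 + a)\<^sup>2" for u v
      by (simp add: distrib_right)
    ultimately have *: "1 + real d * (2 * real m) + 2 ^ 38 * real m \<le> C2 * L * (1 + a)\<^sup>2"
      unfolding C2_def using i1 by (simp only: add_mono)
    have "1 + (real d * (2 * real m) + 2 * real m * (2 ^ 37 * T ^ 4))
      \<le> (1 + real d * (2 * real m)) * T ^ 4 + 2 ^ 38 * real m * T ^ 4"
      using mult_left_mono[OF T4, of "1 + real d * (2 * real m)"] by simp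
    also have "\<dots> = (1 + real d * (2 * real m) + 2 ^ 38 * real m) * T ^ 4" by (simp add: algebra_simps)
    also have "\<dots> \<le> C2 * L * (1 + a)\<^sup>2 * T ^ 4" using * T by (intro mult_right_mono) auto
    finally show ?thesis .
  qed
  have C2: "0 \<le> C2" using c0 by (simp add: C2_def)
  have four: "(4::real) ^ m = T\<^sup>2" by (simp add: T_def power2_eq_square power_mult_distrib[symmetric])
  have big: "(2::real) ^ (37 + 4 * m) = 2 ^ 37 * T ^ 4"
    by (simp only: T_def power_add power_mult[symmetric] mult.commute[of m 4])
  have "real (query_bound N \<epsilon>) = 3 * (real w * T + 1) * T\<^sup>2 * (1 + (real d * (2 * real m) + 2 * real m * (2 ^ 37 * T ^ 4)))"
    using \<epsilon> unfolding four[symmetric] big[symmetric]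
    by (simp add: query_bound_def m_def[symmetric] w_def[symmetric] d_def[symmetric] T_def algebra_simps)
  also have "\<dots> \<le> (60 * n * (1 + a) * T ^ 3) * (C2 * L * (1 + a)\<^sup>2 * T ^ 4)"
    using n a T by (intro mult_mono X Y) (auto intro!: mult_nonneg_nonneg add_nonneg_nonneg)
  also have "\<dots> = 60 * C2 * (n * L) * (1 + a) ^ 3 * T ^ 7"
    by (simp add: power2_eq_square power3_eq_cube power_numeral_reduce)
  also have "\<dots> \<le> 60 * C2 * (n * L) * (1 + a) ^ 3 * (128 / \<epsilon>) ^ 7"
    using T C2 n a L c0 by (intro mult_left_mono power_mono) auto
  also have "\<dots> = C * (n * L / \<epsilon> ^ 7) * (1 + a) ^ 3"
    by (simp add: C_def C2_def power_divide)
  finally show ?thesis by (simp add: n_def L_def a_def)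
qed

text \<open>The polynomial is \<open>(1 + X\<^sup>2) ^ 3\<close> instead of
  \<open>(1 + X) ^ 3\<close> because \<open>ln (1 / \<epsilon>)\<close> is negative for
  \<open>\<epsilon> > 1\<close>, where the right-hand side still has to be nonnegative. The factor 8
  comes from \<open>1 + a \<le> 2 * (1 + a\<^sup>2)\<close>.\<close>

theorem theorem9p21:
  "\<exists>(learner :: nat \<Rightarrow> real \<Rightarrow> nat pmf cond_alg) (q :: nat \<Rightarrow> real \<Rightarrow> nat) (C :: real) (p :: real poly).
     (\<forall>N \<epsilon>. N \<ge> 1 \<and> \<epsilon> > 0 \<longrightarrow>
        solves_histogram_learning {1..N} \<epsilon> (learner N \<epsilon>) \<and>
        queries_at_most (learner N \<epsilon>) (q N \<epsilon>)) \<and>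
     (\<forall>N \<epsilon>. N \<ge> 3 \<and> \<epsilon> > 0 \<longrightarrow>
        real (q N \<epsilon>) \<le> C * (ln (real N) * ln (ln (real N)) / \<epsilon> ^ 7 * poly p (ln (1 / \<epsilon>))))"
proof -
  define c0 where "c0 = ln (ln (3::real))"
  define C where "C = 60 * 128 ^ 7 * (1 / c0 + 14 * (2 + 9 / c0) + 7 * 2 ^ 38 / c0)"
  have c0: "0 < c0" using ln_3_gt_1 by (simp add: c0_def)
  then have C: "0 \<le> C" by (simp add: C_def)
  have "real (query_bound N \<epsilon>) \<le>
      8 * C * (ln (real N) * ln (ln (real N)) / \<epsilon> ^ 7 * poly ([:1, 0, 1:] ^ 3) (ln (1 / \<epsilon>)))"
    if N: "3 \<le> N" and \<epsilon>: "0 < \<epsilon>" for N \<epsilon>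
  proof -
    define a where "a = ln (1 / \<epsilon>)"
    have p: "poly ([:1, 0, 1:] ^ 3) a = (1 + a\<^sup>2) ^ 3" by (simp add: power2_eq_square)
    have "1 < ln (real N)" using N ln_3_gt_1 less_le_trans[of 1 "ln 3" "ln (real N)"] by simp
    then have u: "0 \<le> ln (real N) * ln (ln (real N)) / \<epsilon> ^ 7" using \<epsilon> by simp
    show ?thesis
    proof (cases "1 \<le> \<epsilon>")
      case True
      have "0 \<le> 8 * C * (ln (real N) * ln (ln (real N)) / \<epsilon> ^ 7 * (1 + a\<^sup>2) ^ 3)"
        using C by (intro mult_nonneg_nonneg[OF _ mult_nonneg_nonneg[OF u]]) auto
      then show ?thesis using True unfolding a_def[symmetric] p by (simp add: query_bound_def)
    next
      case False
      have a0: "0 \<le> a" using False \<epsilon> by (simp add: a_def)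
      have 2: "2 * a \<le> 1 + a\<^sup>2" using zero_le_power2[of "a - 1"] by (simp add: power2_diff)
      have "1 + a \<le> 2 * (1 + s)" if "2 * a \<le> 1 + s" "0 \<le> s" for s using that by simp
      from this[OF 2 zero_le_power2] have "1 + a \<le> 2 * (1 + a\<^sup>2)" .
      then have "(1 + a) ^ 3 \<le> (2 * (1 + a\<^sup>2)) ^ 3" using a0 by (intro power_mono) auto
      then have 3: "(1 + a) ^ 3 \<le> 8 * (1 + a\<^sup>2) ^ 3" unfolding power_mult_distrib by simp
      have "real (query_bound N \<epsilon>) \<le> C * (ln (real N) * ln (ln (real N)) / \<epsilon> ^ 7) * (1 + a) ^ 3"
        using query_bound_le[OF N \<epsilon>] False by (simp add: C_def c0_def a_def)
      also have "\<dots> \<le> C * (ln (real N) * ln (ln (real N)) / \<epsilon> ^ 7) * (8 * (1 + a\<^sup>2) ^ 3)"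
        using 3 u C by (intro mult_left_mono mult_nonneg_nonneg) auto
      also have "\<dots> = 8 * C * (ln (real N) * ln (ln (real N)) / \<epsilon> ^ 7 * (1 + a\<^sup>2) ^ 3)"
        by (simp only: mult_ac)
      finally show ?thesis unfolding a_def[symmetric] p .
    qed
  qed
  then show ?thesis
    using solves_histogram_learner queries_at_most_histogram_learner
    by (intro exI[of _ histogram_learner] exI[of _ query_bound] exI[of _ "8 * C"]
        exI[of _ "[:1, 0, 1:] ^ 3"]) blast
qed

end
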